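(* Let $1\le m\le\infty$, let $\mathbf S_m$ be the Cuntz semigroup, let $\ell^1(\mathbf S_m)$ be its semigroup algebra and let $\mathcal A_S=\ell^1(\mathbf S_m)/\mathbb C z_0$ be the reduced Cuntz algebra. For $\mathcal A=\ell^1(\mathbf S_m)$ and for $\mathcal A=\mathcal A_S$, the simplicial cohomology satisfies $\mathcal{HH}^n(\mathcal A)=0$ for all $n\ge2$, and $\mathcal{HH}^1(\mathcal A)$ is isomorphic to the space of traces $\tau$ on $\mathcal A_S$ with $\tau(\mathbf 1)=0$.
   Context: The Cuntz semigroup: for $1\le m\le\infty$, $\mathbf S_m$ is the semigroup generated by a unit $\mathbf 1$, a zero $z_0$ and elements $p_i,q_i$ ($i$ an integer, $1\le i\le m$) subject to $q_ip_j=\delta_{ij}\mathbf 1$ (meaning $\mathbf 1$ if $i=j$ and $z_0$ if $i\neq j$). For a finite string $\alpha=i_1i_2\cdots i_k$ of such integers, $p_\alpha=p_{i_1}\cdots p_{i_k}$ and $q_\alpha=q_{i_k}\cdots q_{i_1}$ (with $p_\alpha=q_\alpha=\mathbf 1$ for the empty string), so $q_\alpha p_\alpha=\mathbf 1$. Every element other than $z_0$ is uniquely of the form $p_\alpha q_\beta$ with $\alpha,\beta$ finite, possibly empty, strings; products are $(p_\alpha q_{\beta\gamma})(p_\beta q_{\beta'})=p_\alpha q_{\beta'\gamma}$, $(p_\alpha q_\beta)(p_{\beta\gamma}q_{\beta'})=p_{\alpha\gamma}q_{\beta'}$, and $z_0$ in all other cases. $\ell^1(\mathbf S_m)$ carries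 the convolution product; point masses are identified with semigroup elements. $\mathbb Cz_0$ is the ideal generated by the point mass $z_0$. Cohomology: for a Banach algebra $\mathcal A$ and $n\ge0$, $\mathcal C_n(\mathcal A,\mathcal A)=\mathcal A^{\hat\otimes(n+1)}$ is the $(n+1)$-fold completed projective tensor product, and $d^n:\mathcal C_{n+1}(\mathcal A,\mathcal A)\to\mathcal C_n(\mathcal A,\mathcal A)$ is the bounded linear map with $$d^n(a_1\otimes\cdots\otimes a_{n+2})=a_2\otimes\cdots\otimes a_{n+1}\otimes a_{n+2}a_1+\sum_{j=1}^{n+1}(-1)^j a_1\otimes\cdots\otimes a_ja_{j+1}\otimes\cdots\otimes a_{n+2}.$$ The space of $n$-cochains $\mathcal C^n(\mathcal A,\mathcal A')$ is the dual of $\mathcal C_n(\mathcal A,\mathcal A)$ (equivalently, bounded $n$-linear maps $T:\mathcal A^n\to\mathcal A'$ via $T(a_1\otimes\cdots\otimes a_{n+1})=T(a_1,\dots,a_n)(a_{n+1})$), with $\mathcal C^n=0$ for $n<0$, and $\delta^n:\mathcal C^n\to\mathcal C^{n+1}$ is the adjoint of $d^n$. The simplicial cohomology group is $\mathcal{HH}^n(\mathcal A)=\ker\delta^n/\operatorname{im}\delta^{n-1}$. A trace on a Banach algebra $\mathcal A$ is an element $\tau$ of the dual $\mathcal A'$ with $\tau(ab)=\tau(ba)$ for all $a,b\in\mathcal A$. *)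

theory Defs
  imports "HOL-Analysis.Analysis" "HOL-Library.Sublist"
begin

section \<open>The Cuntz semigroup\<close>

text \<open>
  The Cuntz semigroup over an index type \<^typ>\<open>'i\<close> in normal form: \<open>PQ \<alpha> \<beta>\<close> stands for the
  element \<open>p\<^sub>\<alpha> q\<^sub>\<beta>\<close>.  Letting \<^typ>\<open>'i\<close> range over the types of class \<^class>\<open>countable\<close>
  gives exactly the semigroups \<open>S\<^sub>m\<close> with \<open>1 \<le> m \<le> \<infinity>\<close> (\<open>m\<close> is the cardinality of the index type).
  The unit and the zero of the semigroup are the constants \<open>1\<close> and \<open>0\<close> of the type.
  That this is the semigroup given by the generators \<open>p\<^sub>i, q\<^sub>i\<close> and the relations
  \<open>q\<^sub>i p\<^sub>j = \<delta>\<^sub>i\<^sub>j\<close> is confirmed by \<open>cuntz_relations\<close> and \<open>cuntz_universal\<close> below.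
\<close>

datatype 'i cuntz = Zero | PQ "'i list" "'i list"

instantiation cuntz :: (type) "{zero, one, times}"
begin
definition "0 = Zero"
definition "1 = PQ [] []"
fun times_cuntz :: "'i cuntz \<Rightarrow> 'i cuntz \<Rightarrow> 'i cuntz" where
  "times_cuntz (PQ \<alpha> \<beta>) (PQ \<gamma> \<delta>) =
     (if prefix \<gamma> \<beta> then PQ \<alpha> (\<delta> @ drop (length \<gamma>) \<beta>)
      else if prefix \<beta> \<gamma> then PQ (\<alpha> @ drop (length \<beta>) \<gamma>) \<delta>
      else Zero)"
| "times_cuntz Zero t = Zero"
| "times_cuntz s Zero = Zero"
instance ..
end

lemma cuntz_mult_Zero_right [simp]: "s * (Zero :: 'i cuntz) = Zero"
  by (cases s) auto

lemma cuntz_mult_formulas: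
  "PQ \<alpha> (\<beta> @ \<gamma>) * PQ \<beta> \<beta>' = PQ \<alpha> (\<beta>' @ \<gamma>)"
  "PQ \<alpha> \<beta> * PQ (\<beta> @ \<gamma>) \<beta>' = PQ (\<alpha> @ \<gamma>) \<beta>'"
  "\<lbrakk>\<not> prefix \<gamma> \<beta>; \<not> prefix \<beta> \<gamma>\<rbrakk> \<Longrightarrow> PQ \<alpha> \<beta> * PQ \<gamma> \<delta> = 0"
  by (auto simp: zero_cuntz_def prefix_def)

text \<open>Faithful action by partial injections on finite strings; used for associativity only.\<close>

fun cuntz_act :: "'i cuntz \<Rightarrow> 'i list \<Rightarrow> 'i list option" where
  "cuntz_act Zero x = None"
| "cuntz_act (PQ \<alpha> \<beta>) x = (if prefix \<beta> x then Some (\<alpha> @ drop (length \<beta>) x) else None)"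

lemma cuntz_act_mult: "cuntz_act (s * t) x = Option.bind (cuntz_act t x) (cuntz_act s)"
proof (cases s)
  case (PQ \<alpha> \<beta>)
  note s = this
  show ?thesis
  proof (cases t)
    case t: (PQ \<gamma> \<delta>)
    show ?thesis
    proof (cases "prefix \<delta> x")
      case True
      then obtain y where x: "x = \<delta> @ y" by (auto simp: prefix_def)
      consider z where "\<beta> = \<gamma> @ z" | z where "\<gamma> = \<beta> @ z" "\<not> prefix \<gamma> \<beta>"
        | "\<not> prefix \<gamma> \<beta>" "\<not> prefix \<beta> \<gamma>"
        by (metis prefixE)
      then show ?thesis
      proof cases
        case 1
        then show ?thesis using s t x by simp
      next
        case 2
        then show ?thesis using s t x by simp
      next
        case 3
        then have "\<not> prefix \<beta> (\<gamma> @ y)"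
          by (metis prefix_same_cases prefixI)
        with 3 show ?thesis using s t x by simp
      qed
    next
      case False
      then have "\<not> prefix (\<delta> @ z) x" for z
        by (metis append_prefixD)
      with False show ?thesis using s t by simp
    qed
  qed (simp add: s)
qed (cases t; auto simp: Option.bind_eq_None_conv intro: sym)

lemma cuntz_act_inj: "cuntz_act s = cuntz_act t \<Longrightarrow> s = t"
proof -
  have *: "\<beta> = \<delta> \<and> \<alpha> = \<gamma>" if "cuntz_act (PQ \<alpha> \<beta>) = cuntz_act (PQ \<gamma> \<delta>)"
    for \<alpha> \<beta> \<gamma> \<delta> :: "'i list"
  proof -
    from fun_cong[OF that, of \<beta>] have "prefix \<delta> \<beta>" by (auto split: if_splits)
    moreover from fun_cong[OF that, of \<delta>] have "prefix \<beta> \<delta>" by (auto split: if_splits)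
    ultimately have "\<beta> = \<delta>" using prefix_order.antisym by blast
    with fun_cong[OF that, of \<beta>] show ?thesis by simp
  qed
  have **: "cuntz_act (PQ \<alpha> \<beta>) \<noteq> cuntz_act Zero" for \<alpha> \<beta> :: "'i list"
  proof
    assume "cuntz_act (PQ \<alpha> \<beta>) = cuntz_act Zero"
    from fun_cong[OF this, of \<beta>] show False by simp
  qed
  show "cuntz_act s = cuntz_act t \<Longrightarrow> s = t"
    using * ** **[symmetric] by (cases s; cases t) blast+
qed

lemma bind_assoc_act: "Option.bind x (cuntz_act (s * t)) = Option.bind (Option.bind x (cuntz_act t)) (cuntz_act s)"
  by (cases x) (auto simp: cuntz_act_mult)

instance cuntz :: (type) "{monoid_mult, mult_zero}"
proof
  fix a b c :: "'i cuntz"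
  show "a * b * c = a * (b * c)"
    by (rule cuntz_act_inj) (auto simp: cuntz_act_mult fun_eq_iff bind_assoc_act)
  show "1 * a = a" "a * 1 = a"
    by (cases a; simp add: one_cuntz_def)+
  show "0 * a = 0" "a * 0 = 0"
    by (simp_all add: zero_cuntz_def)
qed

definition p_gen :: "'i \<Rightarrow> 'i cuntz" where "p_gen i = PQ [i] []"
definition q_gen :: "'i \<Rightarrow> 'i cuntz" where "q_gen i = PQ [] [i]"

lemma cuntz_relations: "q_gen i * p_gen j = (if i = j then 1 else 0)"
  by (auto simp: p_gen_def q_gen_def one_cuntz_def zero_cuntz_def)

lemma PQ_eq: "PQ \<alpha> \<beta> = prod_list (map p_gen \<alpha>) * prod_list (map q_gen (rev \<beta>))"
proof -
  have P: "prod_list (map p_gen \<alpha>) = PQ \<alpha> []"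
    by (induction \<alpha>) (auto simp: one_cuntz_def p_gen_def)
  have Q: "prod_list (map q_gen (rev \<beta>)) = PQ [] \<beta>"
    by (induction \<beta>) (auto simp: one_cuntz_def q_gen_def)
  show ?thesis
    unfolding P Q by (cases \<beta>) auto
qed

lemma cuntz_universal:
  fixes P Q :: "'i \<Rightarrow> 'b::{monoid_mult, mult_zero}"
  assumes rel: "\<And>i j. Q i * P j = (if i = j then 1 else 0)"
  shows "\<exists>!h :: 'i cuntz \<Rightarrow> 'b. h 0 = 0 \<and> h 1 = 1 \<and> (\<forall>s t. h (s * t) = h s * h t) \<and>
           (\<forall>i. h (p_gen i) = P i) \<and> (\<forall>i. h (q_gen i) = Q i)"
proof (rule ex_ex1I)
  define PP where "PP \<alpha> = prod_list (map P \<alpha>)" for \<alpha>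
  define QQ where "QQ \<alpha> = prod_list (map Q (rev \<alpha>))" for \<alpha>
  have PPa: "PP (\<alpha> @ \<beta>) = PP \<alpha> * PP \<beta>" for \<alpha> \<beta> by (simp add: PP_def)
  have QQa: "QQ (\<alpha> @ \<beta>) = QQ \<beta> * QQ \<alpha>" for \<alpha> \<beta> by (simp add: QQ_def)
  have cancel: "QQ \<alpha> * (PP \<alpha> * x) = x" for \<alpha> x
  proof (induction \<alpha> arbitrary: x)
    case (Cons i \<alpha>)
    have "QQ (i # \<alpha>) * (PP (i # \<alpha>) * x) = QQ \<alpha> * ((Q i * P i) * (PP \<alpha> * x))"
      by (simp add: PP_def QQ_def mult.assoc)
    with Cons show ?case by (simp add: rel)
  qed (simp add: PP_def QQ_def)
  have cancel': "QQ \<alpha> * PP \<alpha> = 1" for \<alpha>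
    using cancel[of \<alpha> 1] by simp
  have orth: "QQ \<beta> * (PP \<gamma> * x) = 0" if "\<not> prefix \<beta> \<gamma>" "\<not> prefix \<gamma> \<beta>" for \<beta> \<gamma> x
    using that
  proof (induction \<beta> arbitrary: \<gamma>)
    case (Cons i \<beta>)
    then obtain j \<gamma>' where \<gamma>: "\<gamma> = j # \<gamma>'" by (cases \<gamma>) auto
    have "QQ (i # \<beta>) * (PP \<gamma> * x) = QQ \<beta> * ((Q i * P j) * (PP \<gamma>' * x))"
      by (simp add: PP_def QQ_def mult.assoc \<gamma>)
    then show ?case using Cons \<gamma> by (auto simp: rel)
  qed simp
  define h where "h s = (case s of Zero \<Rightarrow> 0 | PQ \<alpha> \<beta> \<Rightarrow> PP \<alpha> * QQ \<beta>)" for s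
  have "h (s * t) = h s * h t" for s t
  proof (cases s)
    case s: (PQ \<alpha> \<beta>)
    show ?thesis
    proof (cases t)
      case t: (PQ \<gamma> \<delta>)
      consider z where "\<beta> = \<gamma> @ z" | z where "\<gamma> = \<beta> @ z" "\<not> prefix \<gamma> \<beta>"
        | "\<not> prefix \<gamma> \<beta>" "\<not> prefix \<beta> \<gamma>"
        by (metis prefixE)
      then show ?thesis
      proof cases
        case 1
        then show ?thesis by (simp add: s t h_def QQa mult.assoc cancel)
      next
        case 2
        then show ?thesis by (simp add: s t h_def PPa mult.assoc cancel)
      next
        case 3
        then show ?thesis by (simp add: s t h_def mult.assoc orth)
      qed
    qed (simp add: h_def)
  qed (simp add: h_def)
  then show "\<exists>h :: 'i cuntz \<Rightarrow> 'b. h 0 = 0 \<and> h 1 = 1 \<and> (\<forall>s t. h (s * t) = h s * h t) \<and>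
           (\<forall>i. h (p_gen i) = P i) \<and> (\<forall>i. h (q_gen i) = Q i)"
    by (intro exI[of _ h]) (auto simp: h_def zero_cuntz_def one_cuntz_def p_gen_def q_gen_def PP_def QQ_def)
next
  fix h k :: "'i cuntz \<Rightarrow> 'b"
  assume h: "h 0 = 0 \<and> h 1 = 1 \<and> (\<forall>s t. h (s * t) = h s * h t) \<and>
           (\<forall>i. h (p_gen i) = P i) \<and> (\<forall>i. h (q_gen i) = Q i)"
    and k: "k 0 = 0 \<and> k 1 = 1 \<and> (\<forall>s t. k (s * t) = k s * k t) \<and>
           (\<forall>i. k (p_gen i) = P i) \<and> (\<forall>i. k (q_gen i) = Q i)"
  have 1: "h (prod_list (map p_gen \<alpha>)) = k (prod_list (map p_gen \<alpha>))" for \<alpha>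
    by (induction \<alpha>) (use h k in auto)
  have 2: "h (prod_list (map q_gen \<alpha>)) = k (prod_list (map q_gen \<alpha>))" for \<alpha>
    by (induction \<alpha>) (use h k in auto)
  show "h = k"
  proof
    fix s show "h s = k s"
    proof (cases s)
      case (PQ \<alpha> \<beta>)
      then show ?thesis using h k 1 2 by (simp add: PQ_eq)
    qed (use h k in \<open>simp add: zero_cuntz_def\<close>)
  qed
qed


section \<open>Complex Banach algebras\<close>

class scaleC =
  fixes scaleC :: "complex \<Rightarrow> 'a \<Rightarrow> 'a" (infixr "*\<^sub>C" 75)

class complex_banach_algebra = scaleC + real_normed_algebra + banach +
  assumes scaleC_add_right: "a *\<^sub>C (x + y) = a *\<^sub>C x + a *\<^sub>C y"
    and scaleC_add_left: "(a + b) *\<^sub>C x = a *\<^sub>C x + b *\<^sub>C x"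
    and scaleC_scaleC: "a *\<^sub>C b *\<^sub>C x = (a * b) *\<^sub>C x"
    and scaleR_scaleC: "r *\<^sub>R x = of_real r *\<^sub>C x"
    and norm_scaleC: "norm (a *\<^sub>C x) = cmod a * norm x"
    and mult_scaleC_left: "(a *\<^sub>C x) * y = a *\<^sub>C (x * y)"
    and mult_scaleC_right: "x * (a *\<^sub>C y) = a *\<^sub>C (x * y)"

definition dual_space :: "('a::complex_banach_algebra \<Rightarrow> complex) set" where
  "dual_space = {\<tau>. bounded_linear \<tau> \<and> (\<forall>c x. \<tau> (c *\<^sub>C x) = c * \<tau> x)}"

definition traces :: "('a::complex_banach_algebra \<Rightarrow> complex) set" where
  "traces = {\<tau> \<in> dual_space. \<forall>a b. \<tau> (a * b) = \<tau> (b * a)}"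


section \<open>The convolution algebra of a semigroup\<close>

typedef 'a ell1 = "{f :: 'a \<Rightarrow> complex. (\<lambda>x. norm (f x)) summable_on UNIV}"
  morphisms coeff Abs_ell1
  by (rule exI[of _ "\<lambda>_. 0"]) simp

setup_lifting type_definition_ell1

lemma ell1_iff: "f \<in> {f :: 'a \<Rightarrow> complex. (\<lambda>x. norm (f x)) summable_on UNIV} \<longleftrightarrow> f summable_on UNIV"
  using summable_on_iff_abs_summable_on_complex by auto

lemma coeff_summable: "coeff f summable_on A"
  using coeff[of f] summable_on_subset_banach[of "coeff f" UNIV A] unfolding ell1_iff by auto

lemma coeff_abs_summable: "(\<lambda>x. norm (coeff f x)) summable_on A"
  using coeff_summable[of f A] summable_on_iff_abs_summable_on_complex by auto

lemma ell1_eqI: "(\<And>x. coeff f x = coeff g x) \<Longrightarrow> f = g"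
  by (metis coeff_inject ext)

lemma summable_cnorm: "f summable_on A \<Longrightarrow> (\<lambda>x. norm (f x :: complex)) summable_on A"
  using summable_on_iff_abs_summable_on_complex by auto

lemma csummable_norm: "(\<lambda>x. norm (f x :: complex)) summable_on A \<Longrightarrow> f summable_on A"
  using summable_on_iff_abs_summable_on_complex by auto

lemma csummable_diff:
  fixes f g :: "'a \<Rightarrow> complex"
  assumes "f summable_on A" "g summable_on A"
  shows "(\<lambda>x. f x - g x) summable_on A"
  using summable_on_add[OF assms(1) summable_on_uminus[THEN iffD2, OF assms(2)]] by simp

lemma summable_prod:
  fixes f :: "'a \<Rightarrow> complex" and g :: "'b \<Rightarrow> complex"
  assumes "f summable_on UNIV" "g summable_on UNIV"
  shows "(\<lambda>(s, t). f s * g t) summable_on UNIV"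
proof -
  have "(\<lambda>z. norm (case z of (s, t) \<Rightarrow> f s * g t)) summable_on UNIV \<times> UNIV"
    unfolding Infinite_Sum.abs_summable_on_Sigma_iff
    using summable_cnorm[OF assms(1)] summable_cnorm[OF assms(2)]
    by (auto simp: norm_mult infsum_cmult_right' abs_mult
             intro!: summable_on_cmult_right summable_on_cmult_left)
  then show ?thesis using csummable_norm by auto
qed

lemma fibre_sum:
  fixes F :: "'b \<Rightarrow> complex" and \<pi> :: "'b \<Rightarrow> 'a"
  assumes F: "F summable_on UNIV"
  shows "(\<lambda>u. infsum F {b. \<pi> b = u}) summable_on UNIV"
    and "infsum (\<lambda>u. norm (infsum F {b. \<pi> b = u})) UNIV \<le> infsum (\<lambda>b. norm (F b)) UNIV"
proof -
  let ?S = "Sigma UNIV (\<lambda>u. {b. \<pi> b = u})"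
  have bij: "bij_betw (\<lambda>b. (\<pi> b, b)) UNIV ?S"
    by (rule bij_betwI[of _ _ _ snd]) auto
  have 1: "(\<lambda>(u, b). F b) summable_on ?S"
    using summable_on_reindex_bij_betw[OF bij, of "\<lambda>(u, b). F b"] F by simp
  have 2: "(\<lambda>(u, b). norm (F b)) summable_on ?S"
    using summable_on_reindex_bij_betw[OF bij, of "\<lambda>(u, b). norm (F b)"] summable_cnorm[OF F] by simp
  show s: "(\<lambda>u. infsum F {b. \<pi> b = u}) summable_on UNIV"
    using summable_on_Sigma_banach[OF 1] .
  have "infsum (\<lambda>u. norm (infsum F {b. \<pi> b = u})) UNIV
        \<le> infsum (\<lambda>u. infsum (\<lambda>b. norm (F b)) {b. \<pi> b = u}) UNIV"
  proof (rule infsum_mono)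
    show "(\<lambda>u. norm (infsum F {b. \<pi> b = u})) summable_on UNIV" using summable_cnorm[OF s] .
    show "(\<lambda>u. infsum (\<lambda>b. norm (F b)) {b. \<pi> b = u}) summable_on UNIV"
      using summable_on_Sigma_banach[OF 2] .
    show "norm (infsum F {b. \<pi> b = u}) \<le> infsum (\<lambda>b. norm (F b)) {b. \<pi> b = u}" for u
      by (rule norm_infsum_bound) (use summable_on_subset_banach[OF summable_cnorm[OF F]] in auto)
  qed
  also have "\<dots> = infsum (\<lambda>b. norm (F b)) UNIV"
    using infsum_Sigma'_banach[OF 2] infsum_reindex_bij_betw[OF bij, of "\<lambda>(u, b). norm (F b)"] by simp
  finally show "infsum (\<lambda>u. norm (infsum F {b. \<pi> b = u})) UNIV \<le> infsum (\<lambda>b. norm (F b)) UNIV" .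
qed

lemma fibre_fibre:
  fixes F :: "'c \<Rightarrow> complex" and \<rho> :: "'c \<Rightarrow> 'b" and B :: "'b set"
  assumes F: "F summable_on UNIV"
  shows "infsum (\<lambda>b. infsum F {c. \<rho> c = b}) B = infsum F {c. \<rho> c \<in> B}"
proof -
  let ?S = "Sigma B (\<lambda>b. {c. \<rho> c = b})"
  have bij: "bij_betw (\<lambda>c. (\<rho> c, c)) {c. \<rho> c \<in> B} ?S"
    by (rule bij_betwI[of _ _ _ snd]) auto
  have 1: "(\<lambda>(u, b). F b) summable_on ?S"
    using summable_on_reindex_bij_betw[OF bij, of "\<lambda>(u, b). F b"] summable_on_subset_banach[OF F] by simp
  show ?thesis
    using infsum_Sigma'_banach[OF 1] infsum_reindex_bij_betw[OF bij, of "\<lambda>(u, b). F b"] by simp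
qed

instantiation ell1 :: (type) "{real_vector, scaleC}"
begin
lift_definition zero_ell1 :: "'a ell1" is "\<lambda>_. 0" by simp
lift_definition plus_ell1 :: "'a ell1 \<Rightarrow> 'a ell1 \<Rightarrow> 'a ell1" is "\<lambda>f g x. f x + g x"
  by (rule summable_cnorm, rule summable_on_add; rule csummable_norm)
lift_definition uminus_ell1 :: "'a ell1 \<Rightarrow> 'a ell1" is "\<lambda>f x. - f x" by simp
lift_definition minus_ell1 :: "'a ell1 \<Rightarrow> 'a ell1 \<Rightarrow> 'a ell1" is "\<lambda>f g x. f x - g x"
  by (rule summable_cnorm, rule csummable_diff; rule csummable_norm)
lift_definition scaleC_ell1 :: "complex \<Rightarrow> 'a ell1 \<Rightarrow> 'a ell1" is "\<lambda>c f x. c * f x"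
  by (rule summable_cnorm, rule summable_on_cmult_right, rule csummable_norm)
lift_definition scaleR_ell1 :: "real \<Rightarrow> 'a ell1 \<Rightarrow> 'a ell1" is "\<lambda>r f x. of_real r * f x"
  by (rule summable_cnorm, rule summable_on_cmult_right, rule csummable_norm)
instance
  by standard
    (rule ell1_eqI; simp add: zero_ell1.rep_eq plus_ell1.rep_eq uminus_ell1.rep_eq minus_ell1.rep_eq
      scaleR_ell1.rep_eq algebra_simps)+
end

lemmas coeff_simps [simp] = zero_ell1.rep_eq plus_ell1.rep_eq uminus_ell1.rep_eq minus_ell1.rep_eq
  scaleC_ell1.rep_eq scaleR_ell1.rep_eq

instantiation ell1 :: (type) real_normed_vector
begin
definition norm_ell1 :: "'a ell1 \<Rightarrow> real" where
  "norm_ell1 f = infsum (\<lambda>x. norm (coeff f x)) UNIV"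
definition dist_ell1 :: "'a ell1 \<Rightarrow> 'a ell1 \<Rightarrow> real" where
  "dist_ell1 f g = norm (f - g)"
definition sgn_ell1 :: "'a ell1 \<Rightarrow> 'a ell1" where
  "sgn_ell1 f = f /\<^sub>R norm f"
definition [code del]: "(uniformity :: ('a ell1 \<times> 'a ell1) filter) =
  (INF e\<in>{0 <..}. principal {(x, y). dist x y < e})"
definition [code del]: "open (U :: 'a ell1 set) \<longleftrightarrow>
  (\<forall>x\<in>U. \<forall>\<^sub>F (x', y) in uniformity. x' = x \<longrightarrow> y \<in> U)"
instance
proof
  fix f g :: "'a ell1" and r :: real
  show "norm f = 0 \<longleftrightarrow> f = 0"
  proof
    assume "norm f = 0"
    then have "norm (coeff f x) = 0" for x
      by (intro nonneg_infsum_le_0D[of "\<lambda>x. norm (coeff f x)" UNIV x] coeff_abs_summable)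
        (simp_all add: norm_ell1_def)
    then show "f = 0" by (auto intro!: ell1_eqI)
  qed (simp add: norm_ell1_def)
  show "norm (f + g) \<le> norm f + norm g"
    unfolding norm_ell1_def infsum_add[OF coeff_abs_summable coeff_abs_summable, symmetric]
    by (intro infsum_mono summable_on_add coeff_abs_summable) (auto intro: norm_triangle_ineq)
  show "norm (r *\<^sub>R f) = \<bar>r\<bar> * norm f"
    by (simp add: norm_ell1_def norm_mult infsum_cmult_right')
qed (simp_all add: dist_ell1_def sgn_ell1_def uniformity_ell1_def open_ell1_def)
end

lemma norm_coeff_le: "norm (coeff f x) \<le> norm f"
  using finite_sum_le_infsum[of "\<lambda>x. norm (coeff f x)" UNIV "{x}"] coeff_abs_summable[of f UNIV]
  by (simp add: norm_ell1_def)

lemma sum_coeff_le: "finite F \<Longrightarrow> (\<Sum>x\<in>F. norm (coeff f x)) \<le> norm f"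
  using finite_sum_le_infsum[of "\<lambda>x. norm (coeff f x)" UNIV F] coeff_abs_summable[of f UNIV]
  by (simp add: norm_ell1_def)

instance ell1 :: (type) banach
proof
  fix X :: "nat \<Rightarrow> 'a ell1"
  assume X: "Cauchy X"
  have "Cauchy (\<lambda>n. coeff (X n) x)" for x
  proof (rule CauchyI)
    fix e :: real assume "e > 0"
    with X obtain M where "\<forall>m\<ge>M. \<forall>n\<ge>M. norm (X m - X n) < e" by (meson CauchyD)
    then show "\<exists>M. \<forall>m\<ge>M. \<forall>n\<ge>M. norm (coeff (X m) x - coeff (X n) x) < e"
      using norm_coeff_le[of "X m - X n" x for m n] by (metis coeff_simps(4) le_less_trans)
  qed
  then have "\<exists>l. (\<lambda>n. coeff (X n) x) \<longlonglongrightarrow> l" for x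
    by (simp add: Cauchy_convergent_iff convergent_def)
  then obtain g where g: "\<And>x. (\<lambda>n. coeff (X n) x) \<longlonglongrightarrow> g x" by metis
  have key: "\<exists>M. \<forall>m\<ge>M. \<forall>F. finite F \<longrightarrow> (\<Sum>x\<in>F. norm (coeff (X m) x - g x)) \<le> e"
    if e: "e > 0" for e
  proof -
    from X e obtain M where M: "\<forall>m\<ge>M. \<forall>n\<ge>M. norm (X m - X n) < e" by (meson CauchyD)
    show ?thesis
    proof (intro exI[of _ M] allI impI)
      fix m F assume m: "m \<ge> M" and F: "finite (F :: 'a set)"
      have "(\<lambda>n. \<Sum>x\<in>F. norm (coeff (X m) x - coeff (X n) x)) \<longlonglongrightarrow> (\<Sum>x\<in>F. norm (coeff (X m) x - g x))"
        by (intro tendsto_intros g)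
      moreover have "\<forall>\<^sub>F n in sequentially. (\<Sum>x\<in>F. norm (coeff (X m) x - coeff (X n) x)) \<le> e"
        unfolding eventually_sequentially
      proof (intro exI[of _ M] allI impI)
        fix n assume "n \<ge> M"
        with M m have "norm (X m - X n) < e" by blast
        with sum_coeff_le[OF F, of "X m - X n"]
        show "(\<Sum>x\<in>F. norm (coeff (X m) x - coeff (X n) x)) \<le> e" by simp
      qed
      ultimately show "(\<Sum>x\<in>F. norm (coeff (X m) x - g x)) \<le> e"
        by (rule tendsto_upperbound) simp
    qed
  qed
  have summ: "(\<lambda>x. norm (coeff (X m) x - g x)) summable_on UNIV"
    if "\<forall>F. finite F \<longrightarrow> (\<Sum>x\<in>F. norm (coeff (X m) x - g x)) \<le> e" for m e
    by (rule nonneg_bdd_above_summable_on) (use that in \<open>auto intro!: bdd_aboveI[of _ e]\<close>)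
  from key[of 1] obtain M where "\<forall>F. finite F \<longrightarrow> (\<Sum>x\<in>F. norm (coeff (X M) x - g x)) \<le> 1"
    by auto
  from csummable_diff[OF coeff_summable[of "X M"] csummable_norm[OF summ[OF this]]]
  have "g summable_on UNIV" by (rule back_subst[of "\<lambda>f. f summable_on UNIV"]) (simp add: fun_eq_iff)
  then have cg: "coeff (Abs_ell1 g) = g"
    by (intro Abs_ell1_inverse) (simp only: ell1_iff)
  have "X \<longlonglongrightarrow> Abs_ell1 g"
  proof (rule LIMSEQ_I)
    fix e :: real assume e: "e > 0"
    from key[of "e / 2"] e obtain M where
      M: "\<And>m. m \<ge> M \<Longrightarrow> \<forall>F. finite F \<longrightarrow> (\<Sum>x\<in>F. norm (coeff (X m) x - g x)) \<le> e / 2"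
      by auto
    have "norm (X m - Abs_ell1 g) < e" if "m \<ge> M" for m
    proof -
      have "norm (X m - Abs_ell1 g) \<le> e / 2"
        unfolding norm_ell1_def
        by (rule infsum_le_finite_sums) (use M[OF that] summ[OF M[OF that]] in \<open>auto simp: cg\<close>)
      with e show ?thesis by simp
    qed
    then show "\<exists>M. \<forall>m\<ge>M. norm (X m - Abs_ell1 g) < e" by blast
  qed
  then show "convergent X" by (auto simp: convergent_def)
qed

instantiation ell1 :: (semigroup_mult) times
begin
lift_definition times_ell1 :: "'a ell1 \<Rightarrow> 'a ell1 \<Rightarrow> 'a ell1" is
  "\<lambda>f g u. \<Sum>\<^sub>\<infinity>(s, t)\<in>{(s, t). s * t = u}. f s * g t"
proof -
  fix f g :: "'a \<Rightarrow> complex"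
  assume "(\<lambda>x. norm (f x)) summable_on UNIV" "(\<lambda>x. norm (g x)) summable_on UNIV"
  then have "(\<lambda>(s, t). f s * g t) summable_on UNIV" by (intro summable_prod; intro csummable_norm)
  from summable_cnorm[OF fibre_sum(1)[OF this, of "\<lambda>(s, t). s * t"]]
  show "(\<lambda>u. norm (\<Sum>\<^sub>\<infinity>(s, t)\<in>{(s, t). s * t = u}. f s * g t)) summable_on UNIV"
    by (simp add: case_prod_unfold)
qed
instance ..
end

lemma coeff_mult: "coeff (f * g) u = (\<Sum>\<^sub>\<infinity>(s, t)\<in>{(s, t). s * t = u}. coeff f s * coeff g t)"
  by (simp add: times_ell1.rep_eq)

lemma coeff_prod_summable: "(\<lambda>(s, t). coeff f s * coeff g t) summable_on A"
  by (rule summable_on_subset_banach[OF summable_prod]) (auto intro: coeff_summable)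

instance ell1 :: (semigroup_mult) complex_banach_algebra
proof
  fix f g h :: "'a ell1" and a b :: complex and r :: real
  show "f * g * h = f * (g * h)"
  proof (rule ell1_eqI)
    fix v
    let ?F = "\<lambda>((r, s), t). coeff f r * coeff g s * coeff h t"
    have F: "?F summable_on UNIV"
      using summable_prod[OF coeff_prod_summable coeff_summable, of f g h]
      by (simp add: case_prod_unfold)
    let ?G = "\<lambda>(r, (s, t)). coeff f r * (coeff g s * coeff h t)"
    have G: "?G summable_on UNIV"
      using summable_prod[OF coeff_summable coeff_prod_summable, of f g h]
      by (simp add: case_prod_unfold)
    have "coeff (f * g * h) v = (\<Sum>\<^sub>\<infinity>z\<in>{(s, t). s * t = v}. infsum ?F {c. (\<lambda>((r, s), t). (r * s, t)) c = z})"
      unfolding coeff_mult[of "f * g"]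
    proof (rule infsum_cong)
      fix z assume "z \<in> {(s, t). s * t = v}"
      obtain u t where z: "z = (u, t)" by fastforce
      have "infsum ?F {c. (\<lambda>((r, s), t). (r * s, t)) c = (u, t)}
            = infsum (\<lambda>(r, s). (coeff f r * coeff g s) * coeff h t) {(r, s). r * s = u}"
        by (rule infsum_reindex_bij_witness[of _ "\<lambda>z. (z, t)" fst]) auto
      also have "\<dots> = coeff (f * g) u * coeff h t"
        by (simp add: coeff_mult infsum_cmult_left' case_prod_unfold)
      finally show "(case z of (u, t) \<Rightarrow> coeff (f * g) u * coeff h t) = infsum ?F {c. (\<lambda>((r, s), t). (r * s, t)) c = z}"
        by (simp add: z)
    qed
    also have "\<dots> = infsum ?F {c. (\<lambda>((r, s), t). (r * s, t)) c \<in> {(s, t). s * t = v}}"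
      by (rule fibre_fibre[OF F])
    also have "\<dots> = infsum ?G {c. (\<lambda>(r, (s, t)). (r, s * t)) c \<in> {(s, t). s * t = v}}"
      by (rule infsum_reindex_bij_witness[of _ "\<lambda>(r, (s, t)). ((r, s), t)" "\<lambda>((r, s), t). (r, (s, t))"])
         (auto simp: mult.assoc)
    also have "\<dots> = (\<Sum>\<^sub>\<infinity>z\<in>{(s, t). s * t = v}. infsum ?G {c. (\<lambda>(r, (s, t)). (r, s * t)) c = z})"
      by (rule fibre_fibre[OF G, symmetric])
    also have "\<dots> = coeff (f * (g * h)) v"
      unfolding coeff_mult[of f "g * h"]
    proof (rule infsum_cong)
      fix z assume "z \<in> {(s, t). s * t = v}"
      obtain r u where z: "z = (r, u)" by fastforce
      have "infsum ?G {c. (\<lambda>(r, (s, t)). (r, s * t)) c = (r, u)}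
            = infsum (\<lambda>(s, t). coeff f r * (coeff g s * coeff h t)) {(s, t). s * t = u}"
        by (rule infsum_reindex_bij_witness[of _ "\<lambda>z. (r, z)" snd]) auto
      also have "\<dots> = coeff f r * coeff (g * h) u"
        by (simp add: coeff_mult infsum_cmult_right' case_prod_unfold)
      finally show "infsum ?G {c. (\<lambda>(r, (s, t)). (r, s * t)) c = z} = (case z of (r, u) \<Rightarrow> coeff f r * coeff (g * h) u)"
        by (simp add: z)
    qed
    finally show "coeff (f * g * h) v = coeff (f * (g * h)) v" .
  qed
  show "(f + g) * h = f * h + g * h"
  proof (rule ell1_eqI)
    fix u
    show "coeff ((f + g) * h) u = coeff (f * h + g * h) u"
      using infsum_add[OF coeff_prod_summable[of f h] coeff_prod_summable[of g h], of "{(s, t). s * t = u}"]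
      by (simp add: coeff_mult case_prod_unfold algebra_simps)
  qed
  show "f * (g + h) = f * g + f * h"
  proof (rule ell1_eqI)
    fix u
    show "coeff (f * (g + h)) u = coeff (f * g + f * h) u"
      using infsum_add[OF coeff_prod_summable[of f g] coeff_prod_summable[of f h], of "{(s, t). s * t = u}"]
      by (simp add: coeff_mult case_prod_unfold algebra_simps)
  qed
  show L: "(a *\<^sub>C f) * g = a *\<^sub>C (f * g)" for a
    by (rule ell1_eqI) (simp add: coeff_mult case_prod_unfold mult.assoc infsum_cmult_right')
  show R: "f * (a *\<^sub>C g) = a *\<^sub>C (f * g)" for a
    by (rule ell1_eqI) (simp add: coeff_mult case_prod_unfold mult.left_commute[of _ a] infsum_cmult_right')
  show S: "r *\<^sub>R f = of_real r *\<^sub>C f" for r and f :: "'a ell1"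
    by (rule ell1_eqI) simp
  show "(r *\<^sub>R f) * g = r *\<^sub>R (f * g)" "f * (r *\<^sub>R g) = r *\<^sub>R (f * g)"
    by (simp_all only: S L R)
  show "a *\<^sub>C (f + g) = a *\<^sub>C f + a *\<^sub>C g" "(a + b) *\<^sub>C f = a *\<^sub>C f + b *\<^sub>C f"
    "a *\<^sub>C b *\<^sub>C f = (a * b) *\<^sub>C f"
    by (rule ell1_eqI; simp add: algebra_simps)+
  show "norm (a *\<^sub>C f) = cmod a * norm f"
    by (simp add: norm_ell1_def norm_mult infsum_cmult_right')
  show "norm (f * g) \<le> norm f * norm g"
  proof -
    have P: "(\<lambda>(s, t). coeff f s * coeff g t) summable_on UNIV" by (rule coeff_prod_summable)
    have N: "(\<lambda>(s, t). norm (coeff f s) * norm (coeff g t)) summable_on UNIV \<times> UNIV"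
      using summable_cnorm[OF P] by (simp add: case_prod_unfold norm_mult)
    have "norm (f * g) \<le> infsum (\<lambda>z. norm ((\<lambda>(s, t). coeff f s * coeff g t) z)) UNIV"
      using fibre_sum(2)[OF P, of "\<lambda>(s, t). s * t"]
      by (simp add: norm_ell1_def coeff_mult case_prod_unfold)
    also have "\<dots> = infsum (\<lambda>s. infsum (\<lambda>t. norm (coeff f s) * norm (coeff g t)) UNIV) UNIV"
      using infsum_Sigma'_banach[OF N] by (simp add: case_prod_unfold norm_mult)
    also have "\<dots> = norm f * norm g"
      by (simp add: norm_ell1_def infsum_cmult_right' infsum_cmult_left')
    finally show ?thesis .
  qed
qed

lift_definition point :: "'a \<Rightarrow> 'a ell1" is "\<lambda>s x. if x = s then 1 else 0"
proof -
  fix s :: 'a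
  show "(\<lambda>x. norm (if x = s then 1 else 0 :: complex)) summable_on UNIV"
    using summable_on_cong_neutral[of UNIV "{s}" "\<lambda>x. norm (if x = s then 1 else 0 :: complex)" "\<lambda>_. 1"]
    by auto
qed

lemma coeff_point [simp]: "coeff (point s) x = (if x = s then 1 else 0)"
  by (simp add: point.rep_eq)

lemma norm_point [simp]: "norm (point s) = 1"
proof -
  have "norm (point s) = infsum (\<lambda>x. 1 :: real) {s}"
    unfolding norm_ell1_def by (rule infsum_cong_neutral) auto
  then show ?thesis by simp
qed

lemma point_mult: "point s * point t = point (s * t)"
proof (rule ell1_eqI)
  fix u
  have "coeff (point s * point t) u = infsum (\<lambda>_. 1) (if s * t = u then {(s, t)} else {})"
    unfolding coeff_mult by (rule infsum_cong_neutral) (auto split: if_splits)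
  then show "coeff (point s * point t) u = coeff (point (s * t)) u" by auto
qed

instantiation ell1 :: (monoid_mult) real_normed_algebra_1
begin
definition one_ell1 :: "'a ell1" where "1 = point 1"
instance
proof
  fix f :: "'a ell1"
  show "1 * f = f"
  proof (rule ell1_eqI)
    fix u
    have "coeff (1 * f) u = infsum (\<lambda>(s, t). coeff f t) {(1::'a, u)}"
      unfolding coeff_mult one_ell1_def by (rule infsum_cong_neutral) (auto split: if_splits)
    then show "coeff (1 * f) u = coeff f u" by simp
  qed
  show "f * 1 = f"
  proof (rule ell1_eqI)
    fix u
    have "coeff (f * 1) u = infsum (\<lambda>(s, t). coeff f s) {(u, 1::'a)}"
      unfolding coeff_mult one_ell1_def by (rule infsum_cong_neutral) (auto split: if_splits)
    then show "coeff (f * 1) u = coeff f u" by simp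
  qed
  show "(0 :: 'a ell1) \<noteq> 1"
  proof
    assume "(0 :: 'a ell1) = 1"
    then have "norm (1 :: 'a ell1) = 0" by simp
    then show False by (simp add: one_ell1_def)
  qed
  show "norm (1 :: 'a ell1) = 1" by (simp add: one_ell1_def)
qed
end

section \<open>The reduced Cuntz algebra\<close>

lemma point_zero_mult:
  fixes f :: "'a::{semigroup_mult, mult_zero} ell1"
  shows "point 0 * f = infsum (coeff f) UNIV *\<^sub>C point 0"
    and "f * point 0 = infsum (coeff f) UNIV *\<^sub>C point 0"
proof -
  show "point 0 * f = infsum (coeff f) UNIV *\<^sub>C point 0"
  proof (rule ell1_eqI)
    fix u :: 'a
    have "coeff (point 0 * f) u = infsum (\<lambda>z. coeff f (snd z)) (if u = 0 then range (Pair (0::'a)) else {})"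
      unfolding coeff_mult by (rule infsum_cong_neutral) (auto split: if_splits)
    also have "\<dots> = coeff (infsum (coeff f) UNIV *\<^sub>C point 0) u"
      by (auto simp: infsum_reindex inj_on_def o_def)
    finally show "coeff (point 0 * f) u = coeff (infsum (coeff f) UNIV *\<^sub>C point 0) u" .
  qed
  show "f * point 0 = infsum (coeff f) UNIV *\<^sub>C point 0"
  proof (rule ell1_eqI)
    fix u :: 'a
    have "coeff (f * point 0) u = infsum (\<lambda>z. coeff f (fst z)) (if u = 0 then range (\<lambda>s. (s, 0::'a)) else {})"
      unfolding coeff_mult by (rule infsum_cong_neutral) (auto split: if_splits)
    also have "\<dots> = coeff (infsum (coeff f) UNIV *\<^sub>C point 0) u"
      by (auto simp: infsum_reindex inj_on_def o_def)
    finally show "coeff (f * point 0) u = coeff (infsum (coeff f) UNIV *\<^sub>C point 0) u" .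
  qed
qed

definition cong_z0 :: "'i cuntz ell1 \<Rightarrow> 'i cuntz ell1 \<Rightarrow> bool" where
  "cong_z0 f g \<longleftrightarrow> (\<exists>c. f - g = c *\<^sub>C point 0)"

lemma cong_z0_iff: "cong_z0 f g \<longleftrightarrow> (\<forall>x. x \<noteq> 0 \<longrightarrow> coeff f x = coeff g x)"
proof
  assume "cong_z0 f g"
  then obtain c where "f - g = c *\<^sub>C point 0" by (auto simp: cong_z0_def)
  then have "coeff (f - g) x = coeff (c *\<^sub>C point 0) x" for x by simp
  then show "\<forall>x. x \<noteq> 0 \<longrightarrow> coeff f x = coeff g x" by (metis coeff_point coeff_simps(4,5) eq_iff_diff_eq_0 mult_zero_right)
next
  assume "\<forall>x. x \<noteq> 0 \<longrightarrow> coeff f x = coeff g x"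
  then have "f - g = (coeff f 0 - coeff g 0) *\<^sub>C point 0"
    by (intro ell1_eqI) auto
  then show "cong_z0 f g" unfolding cong_z0_def by blast
qed

quotient_type 'i reduced_cuntz = "'i cuntz ell1" / cong_z0
  by (rule equivpI) (auto simp: cong_z0_iff reflp_def symp_def transp_def)

lemma cong_z0_mult:
  assumes "cong_z0 f f'" "cong_z0 g g'" shows "cong_z0 (f * g) (f' * g')"
proof -
  from assms obtain c d where c: "f - f' = c *\<^sub>C point 0" and d: "g - g' = d *\<^sub>C point 0"
    by (auto simp: cong_z0_def)
  have "f * g - f' * g' = (f - f') * g + f' * (g - g')" by (simp add: algebra_simps)
  also have "\<dots> = (c * infsum (coeff g) UNIV + infsum (coeff f') UNIV * d) *\<^sub>C point 0"
    unfolding c d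
    by (simp add: mult_scaleC_left mult_scaleC_right point_zero_mult scaleC_scaleC scaleC_add_left mult.commute)
  finally show ?thesis unfolding cong_z0_def by blast
qed

instantiation reduced_cuntz :: (type) "{zero, one, plus, minus, uminus, times, scaleR, scaleC}"
begin
lift_definition zero_reduced_cuntz :: "'i reduced_cuntz" is 0 .
lift_definition one_reduced_cuntz :: "'i reduced_cuntz" is 1 .
lift_definition plus_reduced_cuntz :: "'i reduced_cuntz \<Rightarrow> 'i reduced_cuntz \<Rightarrow> 'i reduced_cuntz"
  is "(+)" by (simp add: cong_z0_iff)
lift_definition minus_reduced_cuntz :: "'i reduced_cuntz \<Rightarrow> 'i reduced_cuntz \<Rightarrow> 'i reduced_cuntz"
  is "(-)" by (simp add: cong_z0_iff)
lift_definition uminus_reduced_cuntz :: "'i reduced_cuntz \<Rightarrow> 'i reduced_cuntz"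
  is uminus by (simp add: cong_z0_iff)
lift_definition times_reduced_cuntz :: "'i reduced_cuntz \<Rightarrow> 'i reduced_cuntz \<Rightarrow> 'i reduced_cuntz"
  is "(*)" by (rule cong_z0_mult)
lift_definition scaleR_reduced_cuntz :: "real \<Rightarrow> 'i reduced_cuntz \<Rightarrow> 'i reduced_cuntz"
  is "(*\<^sub>R)" by (simp add: cong_z0_iff)
lift_definition scaleC_reduced_cuntz :: "complex \<Rightarrow> 'i reduced_cuntz \<Rightarrow> 'i reduced_cuntz"
  is "(*\<^sub>C)" by (simp add: cong_z0_iff)
instance ..
end

text \<open>The representative of minimal norm, which vanishes at \<open>z\<^sub>0\<close>.\<close>

definition drop_z0 :: "'i cuntz ell1 \<Rightarrow> 'i cuntz ell1" where
  "drop_z0 f = f + (- coeff f 0) *\<^sub>C point 0"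

lemma coeff_drop_z0 [simp]: "coeff (drop_z0 f) x = (if x = 0 then 0 else coeff f x)"
  by (simp add: drop_z0_def)

lemma cong_drop_z0: "cong_z0 f (drop_z0 f)"
  by (simp add: cong_z0_iff)

lemma norm_drop_z0_le: "norm (drop_z0 f) \<le> norm (f + c *\<^sub>C point 0)"
  unfolding norm_ell1_def by (intro infsum_mono coeff_abs_summable) auto

lemma INF_norm_eq: "(INF c. norm (f + c *\<^sub>C point 0)) = norm (drop_z0 f)"
proof (rule antisym)
  show "(INF c. norm (f + c *\<^sub>C point 0)) \<le> norm (drop_z0 f)"
    unfolding drop_z0_def by (rule cINF_lower) (auto intro!: bdd_belowI[of _ 0])
  show "norm (drop_z0 f) \<le> (INF c. norm (f + c *\<^sub>C point 0))"
    by (rule cINF_greatest) (auto intro: norm_drop_z0_le)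
qed

lift_definition reduced_rep :: "'i reduced_cuntz \<Rightarrow> 'i cuntz ell1" is drop_z0
  by (rule ell1_eqI) (simp add: cong_z0_iff)

lemma reduced_rep_diff: "reduced_rep (x - y) = reduced_rep x - reduced_rep y"
  by transfer (rule ell1_eqI, simp)

lemma reduced_rep_add: "reduced_rep (x + y) = reduced_rep x + reduced_rep y"
  by transfer (rule ell1_eqI, simp)

lemma reduced_rep_scaleC: "reduced_rep (c *\<^sub>C x) = c *\<^sub>C reduced_rep x"
  by transfer (rule ell1_eqI, simp)

lemma scaleR_scaleC_reduced: "r *\<^sub>R (x :: 'i reduced_cuntz) = of_real r *\<^sub>C x"
  by (transfer; simp add: cong_z0_iff)

lemma reduced_rep_0 [simp]: "reduced_rep 0 = 0"
  by transfer (rule ell1_eqI, simp)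

lemma reduced_rep_1 [simp]: "reduced_rep 1 = 1"
  by transfer (rule ell1_eqI, simp add: one_ell1_def one_cuntz_def zero_cuntz_def)

lemma abs_reduced_rep [simp]: "abs_reduced_cuntz (reduced_rep x) = x"
  by (transfer, simp add: cong_z0_iff)

instance reduced_cuntz :: (type) real_vector
proof
  fix x y z :: "'a reduced_cuntz" and r s :: real
  show "x + y + z = x + (y + z)" "x + y = y + x" "0 + x = x" "- x + x = 0" "x - y = x + - y"
    by (transfer; simp add: cong_z0_iff)+
  show "r *\<^sub>R (x + y) = r *\<^sub>R x + r *\<^sub>R y" "(r + s) *\<^sub>R x = r *\<^sub>R x + s *\<^sub>R x"
    "r *\<^sub>R s *\<^sub>R x = (r * s) *\<^sub>R x" "1 *\<^sub>R x = x"
    by (transfer; simp add: cong_z0_iff algebra_simps)+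
qed

instantiation reduced_cuntz :: (type) real_normed_vector
begin

lift_definition norm_reduced_cuntz :: "'i reduced_cuntz \<Rightarrow> real"
  is "\<lambda>f. INF c. norm (f + c *\<^sub>C point 0)"
proof -
  fix f g :: "'i cuntz ell1" assume "cong_z0 f g"
  then obtain d where d: "f - g = d *\<^sub>C point 0" by (auto simp: cong_z0_def)
  have "range (\<lambda>c. norm (f + c *\<^sub>C point 0)) = range (\<lambda>c. norm (g + c *\<^sub>C point 0))"
  proof -
    have f: "f = g + d *\<^sub>C point 0" using d by (simp add: algebra_simps)
    have 1: "norm (f + c *\<^sub>C point 0) = norm (g + (d + c) *\<^sub>C point 0)" for c
      by (simp add: f scaleC_add_left add.assoc)
    have 2: "norm (g + c *\<^sub>C point 0) = norm (f + (c - d) *\<^sub>C point 0)" for c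
      using 1[of "c - d"] by simp
    show ?thesis
    proof (intro equalityI subsetI; elim rangeE)
      show "y \<in> range (\<lambda>c. norm (g + c *\<^sub>C point 0))" if "y = norm (f + c *\<^sub>C point 0)" for y c
        by (rule range_eqI[where x = "d + c"]) (simp only: that 1)
      show "y \<in> range (\<lambda>c. norm (f + c *\<^sub>C point 0))" if "y = norm (g + c *\<^sub>C point 0)" for y c
        by (rule range_eqI[where x = "c - d"]) (simp only: that 2)
    qed
  qed
  then show "(INF c. norm (f + c *\<^sub>C point 0)) = (INF c. norm (g + c *\<^sub>C point 0))" by simp
qed
definition dist_reduced_cuntz :: "'i reduced_cuntz \<Rightarrow> 'i reduced_cuntz \<Rightarrow> real" where
  "dist_reduced_cuntz f g = norm (f - g)"
definition sgn_reduced_cuntz :: "'i reduced_cuntz \<Rightarrow> 'i reduced_cuntz" where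
  "sgn_reduced_cuntz f = f /\<^sub>R norm f"
definition [code del]: "(uniformity :: ('a reduced_cuntz \<times> 'a reduced_cuntz) filter) =
  (INF e\<in>{0 <..}. principal {(x, y). dist x y < e})"
definition [code del]: "open (U :: 'a reduced_cuntz set) \<longleftrightarrow>
  (\<forall>x\<in>U. \<forall>\<^sub>F (x', y) in uniformity. x' = x \<longrightarrow> y \<in> U)"

lemma norm_reduced_rep: "norm (x :: 'a reduced_cuntz) = norm (reduced_rep x)"
  by transfer (rule INF_norm_eq)

lemma norm_scaleC_reduced: "norm (a *\<^sub>C (x :: 'a reduced_cuntz)) = cmod a * norm x"
  unfolding norm_reduced_rep reduced_rep_scaleC by (rule norm_scaleC)

lemma norm_abs_reduced_le: "norm (abs_reduced_cuntz f :: 'a reduced_cuntz) \<le> norm f"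
proof -
  have "norm (abs_reduced_cuntz f) = norm (drop_z0 f)"
    by (simp add: norm_reduced_cuntz.abs_eq INF_norm_eq)
  also have "\<dots> \<le> norm (f + 0 *\<^sub>C point 0)" by (rule norm_drop_z0_le)
  also have "f + 0 *\<^sub>C point 0 = f" by (rule ell1_eqI) simp
  finally show ?thesis .
qed

instance
proof
  fix x y :: "'a reduced_cuntz" and r :: real
  show "norm (r *\<^sub>R x) = \<bar>r\<bar> * norm x"
    by (simp add: scaleR_scaleC_reduced norm_scaleC_reduced)
  show "norm x = 0 \<longleftrightarrow> x = 0"
    by (metis norm_reduced_rep reduced_rep_0 abs_reduced_rep norm_eq_zero)
  show "norm (x + y) \<le> norm x + norm y"
    by (simp add: norm_reduced_rep reduced_rep_add norm_triangle_ineq)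
qed (simp_all add: dist_reduced_cuntz_def sgn_reduced_cuntz_def uniformity_reduced_cuntz_def open_reduced_cuntz_def)
end

instance reduced_cuntz :: (type) banach
proof
  fix X :: "nat \<Rightarrow> 'a reduced_cuntz"
  assume X: "Cauchy X"
  have "Cauchy (\<lambda>n. reduced_rep (X n))"
    using X unfolding Cauchy_def dist_norm norm_reduced_rep reduced_rep_diff .
  then obtain L where L: "(\<lambda>n. reduced_rep (X n)) \<longlonglongrightarrow> L"
    using Cauchy_convergent convergent_def by blast
  have "norm (X n - abs_reduced_cuntz L) \<le> norm (reduced_rep (X n) - L)" for n
    using norm_abs_reduced_le[of "reduced_rep (X n) - L"]
    by (simp flip: minus_reduced_cuntz.abs_eq)
  then have "\<forall>\<^sub>F n in sequentially. norm (X n - abs_reduced_cuntz L) \<le> norm (reduced_rep (X n) - L)"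
    by (intro always_eventually allI)
  moreover have "(\<lambda>n. norm (reduced_rep (X n) - L)) \<longlonglongrightarrow> 0"
    using L by (intro tendsto_norm_zero LIM_zero)
  ultimately have "(\<lambda>n. X n - abs_reduced_cuntz L) \<longlonglongrightarrow> 0"
    by (rule Lim_null_comparison)
  then have "X \<longlonglongrightarrow> abs_reduced_cuntz L" by (rule LIM_zero_cancel)
  then show "convergent X" by (rule convergentI)
qed

instance reduced_cuntz :: (type) complex_banach_algebra
proof
  fix x y z :: "'a reduced_cuntz" and a b :: complex and r :: real
  have refl: "cong_z0 f f" for f :: "'a cuntz ell1" by (simp add: cong_z0_iff)
  show "x * y * z = x * (y * z)" "(x + y) * z = x * z + y * z" "x * (y + z) = x * y + x * z"
    "(r *\<^sub>R x) * y = r *\<^sub>R (x * y)" "x * (r *\<^sub>R y) = r *\<^sub>R (x * y)"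
    by (transfer; simp add: refl algebra_simps)+
  show "a *\<^sub>C (x + y) = a *\<^sub>C x + a *\<^sub>C y" "(a + b) *\<^sub>C x = a *\<^sub>C x + b *\<^sub>C x"
    "a *\<^sub>C b *\<^sub>C x = (a * b) *\<^sub>C x"
    by (transfer; simp add: cong_z0_iff algebra_simps)+
  show "(a *\<^sub>C x) * y = a *\<^sub>C (x * y)" "x * (a *\<^sub>C y) = a *\<^sub>C (x * y)"
    by (transfer; simp add: mult_scaleC_left mult_scaleC_right refl)+
  show "norm (x * y) \<le> norm x * norm y"
  proof -
    have "x * y = abs_reduced_cuntz (reduced_rep x * reduced_rep y)"
      by (simp flip: times_reduced_cuntz.abs_eq)
    then have "norm (x * y) \<le> norm (reduced_rep x * reduced_rep y)"
      using norm_abs_reduced_le by metis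
    also have "\<dots> \<le> norm x * norm y" unfolding norm_reduced_rep by (rule norm_mult_ineq)
    finally show ?thesis .
  qed
qed (rule scaleR_scaleC_reduced norm_scaleC_reduced)+

instance reduced_cuntz :: (type) real_normed_algebra_1
proof
  fix x :: "'a reduced_cuntz"
  have refl: "cong_z0 f f" for f :: "'a cuntz ell1" by (simp add: cong_z0_iff)
  show "1 * x = x" "x * 1 = x" by (transfer; simp add: refl)+
  show one: "norm (1 :: 'a reduced_cuntz) = 1" by (simp add: norm_reduced_rep)
  show "(0 :: 'a reduced_cuntz) \<noteq> 1" by (metis one norm_zero zero_neq_one)
qed


section \<open>Simplicial cohomology\<close>

text \<open>
  An \<open>n\<close>-cochain is a bounded functional on the \<open>(n+1)\<close>-fold projective tensor power, that is, by the
  universal property of the projective tensor product, a bounded \<open>(n+1)\<close>-linear form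
  \<open>(a\<^sub>1, \<dots>, a\<^sub>n\<^sub>+\<^sub>1) \<mapsto> T(a\<^sub>1, \<dots>, a\<^sub>n)(a\<^sub>n\<^sub>+\<^sub>1)\<close>.  The arguments are collected in a list of length
  \<open>n + 1\<close>; on lists of any other length a cochain is required to be \<open>0\<close>, so that cochains are equal
  iff they agree as multilinear forms.
\<close>

definition cochains :: "nat \<Rightarrow> ('a::complex_banach_algebra list \<Rightarrow> complex) set" where
  "cochains n = {\<phi>.
     (\<forall>as. length as \<noteq> n + 1 \<longrightarrow> \<phi> as = 0) \<and>
     (\<forall>as i a b. length as = n + 1 \<and> i < n + 1 \<longrightarrow> \<phi> (as[i := a + b]) = \<phi> (as[i := a]) + \<phi> (as[i := b])) \<and>
     (\<forall>as i c a. length as = n + 1 \<and> i < n + 1 \<longrightarrow> \<phi> (as[i := c *\<^sub>C a]) = c * \<phi> (as[i := a])) \<and>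
     (\<exists>K. \<forall>as. length as = n + 1 \<longrightarrow> cmod (\<phi> as) \<le> K * (\<Prod>i<n + 1. norm (as ! i)))}"

text \<open>
  \<open>\<delta>\<^sup>n \<phi>\<close> is \<open>\<phi>\<close> applied to \<open>d\<^sup>n(a\<^sub>1 \<otimes> \<dots> \<otimes> a\<^sub>n\<^sub>+\<^sub>2)\<close>.  List positions start at \<open>0\<close>, so \<open>a\<^sub>j\<close> is
  \<open>as ! (j - 1)\<close>.
\<close>

definition coboundary :: "nat \<Rightarrow> ('a::complex_banach_algebra list \<Rightarrow> complex) \<Rightarrow> 'a list \<Rightarrow> complex" where
  "coboundary n \<phi> as =
     (if length as = n + 2
      then \<phi> (butlast (tl as) @ [last as * hd as]) +
           (\<Sum>j = 1..n + 1. (- 1) ^ j * \<phi> (take (j - 1) as @ [as ! (j - 1) * as ! j] @ drop (j + 1) as))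
      else 0)"

definition cocycles :: "nat \<Rightarrow> ('a::complex_banach_algebra list \<Rightarrow> complex) set" where
  "cocycles n = {\<phi> \<in> cochains n. coboundary n \<phi> = (\<lambda>_. 0)}"

text \<open>There are no cochains in degree \<open>-1\<close>, so \<open>0\<close> is the only \<open>0\<close>-coboundary.\<close>

fun coboundaries :: "nat \<Rightarrow> ('a::complex_banach_algebra list \<Rightarrow> complex) set" where
  "coboundaries 0 = {\<lambda>_. 0}"
| "coboundaries (Suc n) = coboundary n ` cochains n"

text \<open>
  Quotients \<open>V/W\<close> of complex vector spaces of complex-valued functions, with cosets as elements.
\<close>

definition vcoset :: "('x \<Rightarrow> complex) set \<Rightarrow> ('x \<Rightarrow> complex) \<Rightarrow> ('x \<Rightarrow> complex) set" where
  "vcoset W v = {\<lambda>x. v x + w x | w. w \<in> W}"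

definition quotient_space :: "('x \<Rightarrow> complex) set \<Rightarrow> ('x \<Rightarrow> complex) set \<Rightarrow> ('x \<Rightarrow> complex) set set" where
  "quotient_space V W = vcoset W ` V"

text \<open>\<open>V/W\<close> is isomorphic, as a complex vector space, to the function space \<open>U\<close>.\<close>

definition quotient_isomorphic ::
    "('x \<Rightarrow> complex) set \<Rightarrow> ('x \<Rightarrow> complex) set \<Rightarrow> ('y \<Rightarrow> complex) set \<Rightarrow> bool" where
  "quotient_isomorphic V W U \<longleftrightarrow>
     (\<exists>\<Phi>. bij_betw \<Phi> (quotient_space V W) U \<and>
        (\<forall>u\<in>V. \<forall>v\<in>V. \<Phi> (vcoset W (\<lambda>x. u x + v x)) = (\<lambda>y. \<Phi> (vcoset W u) y + \<Phi> (vcoset W v) y)) \<and>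
        (\<forall>c. \<forall>v\<in>V. \<Phi> (vcoset W (\<lambda>x. c * v x)) = (\<lambda>y. c * \<Phi> (vcoset W v) y)))"

definition HH :: "'a::complex_banach_algebra itself \<Rightarrow> nat \<Rightarrow> ('a list \<Rightarrow> complex) set set" where
  "HH _ n = quotient_space (cocycles n) (coboundaries n)"

definition HH_vanishes :: "'a::complex_banach_algebra itself \<Rightarrow> nat \<Rightarrow> bool" where
  "HH_vanishes A n \<longleftrightarrow> HH A n = {vcoset (coboundaries n) (\<lambda>_. 0)}"

definition HH_isomorphic :: "'a::complex_banach_algebra itself \<Rightarrow> nat \<Rightarrow> ('y \<Rightarrow> complex) set \<Rightarrow> bool" where
  "HH_isomorphic _ n U \<longleftrightarrow>
     quotient_isomorphic (cocycles n :: ('a list \<Rightarrow> complex) set) (coboundaries n) U"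

end

theory Submission
  imports Defs
begin

text \<open>
  Cochains are bounded functions on lists \<open>(s\<^sub>0, \<dots>, s\<^sub>r)\<close> of semigroup elements, so it suffices to find bounded
  contracting homotopies on chains with basis the cyclic words \<open>s\<^sub>0 s\<^sub>1 \<dots> s\<^sub>r\<close>.

  Suppose that a cyclic word has \<open>N > 0\<close> letters \<open>p\<close> that do not cancel against a preceding \<open>q\<close>.  Cutting
  the word after each of them in turn, that is, replacing \<open>s\<^sub>i = v w\<close> by \<open>v, w\<close> with sign \<open>(-1)\<^sup>i\<^sup>+\<^sup>1\<close>, and dividing
  by \<open>N\<close> is a homotopy of norm at most \<open>1\<close> between the identity and the map that sends the word to the average of
  \<open>(w, s\<^sub>1, \<dots>, s\<^sub>r v) - (-1)\<^sup>r (s\<^sub>1, \<dots>, s\<^sub>r v, w)\<close> over the cuts \<open>s\<^sub>0 = v w\<close>.  This is \<open>1 - t\<close>, \<open>t\<close> the signed cyclic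
  rotation, applied to an average that commutes with the differential in degrees \<open>r \<ge> 2\<close>; since the
  bar differential is contractible by inserting the unit, it is null homotopic there.  In degree \<open>1\<close> what
  remains is \<open>D(s)(1)\<close>, the trace belonging to a derivation \<open>D\<close>.  Reversal turns words with unmatched letters \<open>q\<close> into words
  with unmatched letters \<open>p\<close>.  The remaining cyclic words have an idempotent product \<open>p\<^sub>\<delta> q\<^sub>\<delta>\<close> and
  contribute nothing in positive degrees: they are cut at a factor \<open>p\<^sub>\<alpha> q\<^sub>\<beta>\<close> through which
  nothing but \<open>p\<^sub>\<alpha>\<close> and \<open>q\<^sub>\<beta>\<close> passes.  Conversely, a trace \<open>\<tau>\<close> with \<open>\<tau>(1) = 0\<close> comes from the derivation
  \<open>D(s)(t) = (n/N) \<tau>(s t)\<close>, where \<open>n\<close> of the \<open>N\<close> unmatched letters lie in \<open>s\<close>.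
\<close>

section \<open>The Hochschild differential on functions of lists\<close>

text \<open>The number of letters in a word of given length is unbounded, so a homotopy that merely
  sums over letters would not be bounded; this forces the division by \<open>N\<close>. It is
  compatible with the differential only if a word and its faces agree on \<open>N\<close> and on the
  special letters. Two things threaten this. Matching letters depends on where the reading starts
  and with which stack; the starting stack is therefore required to reproduce itself after one turn.
  And a face may contain z_0 although the word does not; therefore functions are first made to
  vanish on lists containing z_0 (\<open>reduced\<close>), which amounts to passing from ell^1(S_m)
  to its quotient. The correction that achieves this doubles a zero entry, using z_0 = z_0 z_0.
  Everything of substance happens for bounded functions on lists of semigroup elements; the two
  algebras enter only at the end, as two interpretations of one locale.\<close>

text \<open>
  The face \<open>d\<^sub>0\<close> of \<open>a # ys\<close> is \<open>mult_last a ys\<close>; the faces that multiply two neighbours make up \<open>bar\<close>.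
\<close>

fun mult_last :: "'s::semigroup_mult \<Rightarrow> 's list \<Rightarrow> 's list" where
  "mult_last v [] = []"
| "mult_last v [l] = [l * v]"
| "mult_last v (a # b # ys) = a # mult_last v (b # ys)"

fun bar :: "('s::semigroup_mult list \<Rightarrow> complex) \<Rightarrow> 's list \<Rightarrow> complex" where
  "bar f [] = 0"
| "bar f [a] = 0"
| "bar f (a # b # xs) = - f (a * b # xs) - bar (\<lambda>z. f (a # z)) (b # xs)"

text \<open>Defined over any semigroup, so that it serves lists of semigroup elements as well as
  lists of algebra elements. On the latter it is the coboundary (\<open>coboundary_eq\<close>);
  \<open>hochschild_map\<close> passes between the two.\<close>

definition hochschild :: "('s::semigroup_mult list \<Rightarrow> complex) \<Rightarrow> 's list \<Rightarrow> complex" where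
  "hochschild f x = f (mult_last (hd x) (tl x)) + bar f x"

lemma mult_last_Cons: "ys \<noteq> [] \<Longrightarrow> mult_last v (a # ys) = a # mult_last v ys"
  by (cases ys) auto

lemma mult_last_snoc [simp]: "mult_last v (ys @ [l]) = ys @ [l * v]"
  by (induction ys) (auto simp: mult_last_Cons)

lemma mult_last_append: "ys \<noteq> [] \<Longrightarrow> mult_last v (xs @ ys) = xs @ mult_last v ys"
  by (induction xs) (auto simp: mult_last_Cons)

lemma mult_last_mult_last: "mult_last w (mult_last v ys) = mult_last (v * w) ys"
  by (cases ys rule: rev_cases) (auto simp: mult.assoc)

lemma length_mult_last [simp]: "length (mult_last v ys) = length ys"
  by (induction v ys rule: mult_last.induct) auto

text \<open>\<open>bar f x\<close> evaluates \<open>f\<close> only at lists with two neighbours of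
  \<open>x\<close> merged. Assuming agreement at just these lists lets a function be replaced by one
  that coincides with it only on the faces of a given word.\<close>

lemma bar_cong_merge:
  "(\<And>us a b vs. x = us @ a # b # vs \<Longrightarrow> f (us @ (a * b) # vs) = g (us @ (a * b) # vs)) \<Longrightarrow> bar f x = bar g x"
proof (induction g x arbitrary: f rule: bar.induct)
  case (3 g a b xs)
  have "f (a * b # xs) = g (a * b # xs)" using "3.prems"[of "[]"] by simp
  moreover have "bar (\<lambda>z. f (a # z)) (b # xs) = bar (\<lambda>z. g (a # z)) (b # xs)"
    by (rule "3.IH") (metis "3.prems" append_Cons)
  ultimately show ?case by simp
qed auto

lemma bar_zero [simp]: "bar (\<lambda>_. 0) x = 0"
  by (induction "\<lambda>_ :: 'a list. 0 :: complex" x rule: bar.induct) auto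

lemma bar_add: "bar (\<lambda>z. f z + g z) x = bar f x + bar g x"
proof (induction f x arbitrary: g rule: bar.induct)
  case (3 f a b xs)
  show ?case using "3.IH"[of "\<lambda>z. g (a # z)"] by simp
qed auto

lemma bar_cmult: "bar (\<lambda>z. c * f z) x = c * bar f x"
  by (induction f x rule: bar.induct) (auto simp: algebra_simps)

lemma bar_minus: "bar (\<lambda>z. - f z) x = - bar f x"
  using bar_cmult[of "-1"] by simp

lemma bar_sum: "finite A \<Longrightarrow> bar (\<lambda>z. \<Sum>l\<in>A. f l z) x = (\<Sum>l\<in>A. bar (f l) x)"
  by (induction A rule: finite_induct) (auto simp: bar_add)

text \<open>\<open>bar\<close> recurses from the left, whereas cuts of the last entry and a unit
  inserted at the end act on the right.\<close>

lemma bar_snoc: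
  "bar f (ys @ [a, b]) = bar (\<lambda>z. f (z @ [b])) (ys @ [a]) + (- 1) ^ Suc (length ys) * f (ys @ [a * b])"
proof (induction ys arbitrary: f)
  case (Cons c ys)
  show ?case
  proof (cases ys)
    case (Cons d zs)
    show ?thesis using Cons.IH[of "\<lambda>z. f (c # z)"] Cons by simp
  qed simp
qed simp

lemma bar_mult_last: "bar (\<lambda>z. f (mult_last v z)) ys = bar f (mult_last v ys)"
proof (cases ys rule: rev_cases)
  case (snoc zs l)
  show ?thesis
  proof (cases zs rule: rev_cases)
    case (snoc us k)
    have "bar (\<lambda>z. f (mult_last v z)) (us @ [k, l]) = bar f (mult_last v (us @ [k, l]))"
      using bar_snoc[of "\<lambda>z. f (mult_last v z)" us k l] bar_snoc[of f us k "l * v"]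
        mult_last_append[of "[k, l]" v us]
      by (simp add: mult.assoc)
    then show ?thesis using \<open>ys = zs @ [l]\<close> snoc by simp
  qed (simp add: snoc)
qed simp

lemma bar_hmul: "bar (\<lambda>z. f (a * hd z # tl z)) (b # ys) = bar f (a * b # ys)"
  by (cases ys) (auto simp: mult.assoc)

lemma bar_Cons: "z \<noteq> [] \<Longrightarrow> bar f (a # z) = - f (a * hd z # tl z) - bar (\<lambda>z. f (a # z)) z"
  by (cases z) auto

lemma bar_bar: "bar (bar f) x = 0"
proof (induction f x rule: bar.induct)
  case (3 f a b xs)
  have "bar (\<lambda>z. bar f (a # z)) (b # xs)
      = bar (\<lambda>z. - f (a * hd z # tl z) - bar (\<lambda>z. f (a # z)) z) (b # xs)"
    by (rule bar_cong_merge) (simp add: bar_Cons)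
  also have "\<dots> = bar (\<lambda>z. - f (a * hd z # tl z) + - bar (\<lambda>z. f (a # z)) z) (b # xs)" by simp
  also have "\<dots> = - bar f (a * b # xs)"
    unfolding bar_add bar_minus 3 using bar_hmul[of f a b xs] by simp
  finally show ?case by simp
qed auto

lemma hochschild_add: "hochschild (\<lambda>z. f z + g z) x = hochschild f x + hochschild g x"
  by (simp add: hochschild_def bar_add)

lemma hochschild_cmult: "hochschild (\<lambda>z. c * f z) x = c * hochschild f x"
  by (simp add: hochschild_def bar_cmult algebra_simps)

lemma hochschild_diff: "hochschild (\<lambda>z. f z - g z) x = hochschild f x - hochschild g x"
  using hochschild_add[of f "\<lambda>z. - g z" x] hochschild_cmult[of "-1" g x] by simp

text \<open>Wrapping twice cancels against wrapping the merged pair \<open>a * b\<close>, by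
  \<open>mult_last_mult_last\<close>; merging after or before one wrap cancels by
  \<open>bar_mult_last\<close>; \<open>bar_bar\<close> does the rest.\<close>

lemma hochschild_hochschild:
  assumes "length x \<ge> 3"
  shows "hochschild (hochschild f) x = 0"
proof -
  obtain a b c ys where x: "x = a # b # c # ys"
    using assms by (metis Suc_le_length_iff numeral_3_eq_3)
  have w: "bar (\<lambda>z. f (mult_last (hd z) (tl z))) x = - f (mult_last (a * b) (c # ys)) - bar f (mult_last a (b # c # ys))"
  proof -
    have "bar (\<lambda>z. f (mult_last (hd (a # z)) (tl (a # z)))) (b # c # ys) = bar f (mult_last a (b # c # ys))"
      using bar_mult_last[of f a] by simp
    then show ?thesis using x by simp
  qed
  have "hochschild (hochschild f) x = hochschild f (mult_last a (b # c # ys)) + bar (\<lambda>z. f (mult_last (hd z) (tl z)) + bar f z) x"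
    by (simp add: hochschild_def[of "hochschild f"] x) (simp add: hochschild_def)
  also have "hochschild f (mult_last a (b # c # ys)) = f (mult_last (a * b) (c # ys)) + bar f (mult_last a (b # c # ys))"
    by (simp add: hochschild_def mult_last_Cons mult_last_mult_last)
  finally show ?thesis unfolding bar_add w bar_bar by simp
qed

lemma hochschild_cong:
  assumes "\<And>z. length z + 1 = length x \<Longrightarrow> f z = g z" "x \<noteq> []"
  shows "hochschild f x = hochschild g x"
proof -
  have "bar f x = bar g x" by (rule bar_cong_merge) (auto intro: assms(1))
  then show ?thesis using assms by (simp add: hochschild_def)
qed

section \<open>Cutting cyclic words at unmatched letters\<close>

text \<open>
  Read a cyclic word \<open>s\<^sub>0 s\<^sub>1 \<dots> s\<^sub>r\<close> from left to right, keeping the letters \<open>q\<close> that still await their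
  partner \<open>p\<close> on a stack \<open>\<delta>\<close>.  A letter \<open>p\<close> is special if it meets no partner or the wrong one; \<open>special \<delta> s\<close>
  contains the positions right after the special letters of \<open>s\<close>.  After a failure the stack is
  reset to the \<open>q\<close>-part of the current element, so nonzero products leave the bookkeeping unchanged.
\<close>

fun stack_step :: "'i list \<Rightarrow> 'i cuntz \<Rightarrow> 'i list" where
  "stack_step \<delta> Zero = []"
| "stack_step \<delta> (PQ \<alpha> \<beta>) = (if prefix \<alpha> \<delta> then \<beta> @ drop (length \<alpha>) \<delta> else \<beta>)"

fun special :: "'i list \<Rightarrow> 'i cuntz \<Rightarrow> nat set" where
  "special \<delta> Zero = {}"
| "special \<delta> (PQ \<alpha> \<beta>) = {l. l \<le> length \<alpha> \<and> \<not> prefix (take l \<alpha>) \<delta>}"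

fun left_part :: "'i cuntz \<Rightarrow> nat \<Rightarrow> 'i cuntz" where
  "left_part Zero l = Zero"
| "left_part (PQ \<alpha> \<beta>) l = PQ (take l \<alpha>) []"

fun right_part :: "'i cuntz \<Rightarrow> nat \<Rightarrow> 'i cuntz" where
  "right_part Zero l = Zero"
| "right_part (PQ \<alpha> \<beta>) l = PQ (drop l \<alpha>) \<beta>"

definition cuts :: "'i list \<Rightarrow> 'i cuntz \<Rightarrow> ('i cuntz \<Rightarrow> 'i cuntz \<Rightarrow> complex) \<Rightarrow> complex" where
  "cuts \<delta> s g = (\<Sum>l\<in>special \<delta> s. g (left_part s l) (right_part s l))"

lemma finite_special [simp]: "finite (special \<delta> s)"
  by (cases s) (auto intro: finite_subset[of _ "{..length x}" for x])

lemma left_part_right_part [simp]: "left_part s l * right_part s l = s"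
  by (cases s) auto

lemma PQ_mult_cases:
  fixes a b :: "'i cuntz"
  assumes "a * b \<noteq> Zero"
  obtains \<alpha> \<beta> \<gamma> \<kappa> where "a = PQ \<alpha> \<beta>" "b = PQ (\<beta> @ \<gamma>) \<kappa>" "a * b = PQ (\<alpha> @ \<gamma>) \<kappa>"
  | \<alpha> \<beta> \<gamma> \<kappa> where "a = PQ \<alpha> (\<gamma> @ \<beta>)" "b = PQ \<gamma> \<kappa>" "a * b = PQ \<alpha> (\<kappa> @ \<beta>)" "\<beta> \<noteq> []"
proof -
  obtain \<alpha> \<beta> \<gamma> \<kappa> where ab: "a = PQ \<alpha> \<beta>" "b = PQ \<gamma> \<kappa>"
    using assms by (cases a; cases b) auto
  then consider z where "\<gamma> = \<beta> @ z" | z where "\<beta> = \<gamma> @ z" "z \<noteq> []"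
    using assms by (auto simp: prefix_def split: if_splits)
  then show thesis
    using that ab by cases auto
qed

lemma stack_step_mult: "a * b \<noteq> Zero \<Longrightarrow> stack_step \<delta> (a * b) = stack_step (stack_step \<delta> a) b"
  by (erule PQ_mult_cases) (auto simp: prefix_def)

text \<open>A Leibniz rule: the letters of \<open>b\<close> that cancel in \<open>a * b\<close> meet
  their partners among the letters that \<open>a\<close> has just pushed, so they are not special.
  The special letters of the product are those of \<open>a\<close> and those of
  \<open>b\<close>.\<close>

lemma special_mult:
  assumes "a * b \<noteq> Zero"
  shows "cuts \<delta> (a * b) g = cuts \<delta> a (\<lambda>v w. g v (w * b)) + cuts (stack_step \<delta> a) b (\<lambda>v w. g (a * v) w)"
  using assms
proof (cases rule: PQ_mult_cases)
  case (1 \<alpha> \<beta> \<gamma> \<kappa>)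
  define A where "A = special \<delta> a"
  define \<sigma> where "\<sigma> = stack_step \<delta> a"
  have *: "length \<beta> < l \<and> \<not> prefix (take l (\<beta> @ \<gamma>)) \<sigma> \<and> l \<le> length (\<beta> @ \<gamma>)" if "l \<in> special \<sigma> b" for l
  proof -
    have "prefix \<beta> \<sigma>" using 1 by (auto simp: \<sigma>_def)
    then have "prefix (take l \<beta>) \<sigma>" by (meson take_is_prefix prefix_order.trans)
    then show ?thesis using that 1 by (cases "l \<le> length \<beta>") auto
  qed
  \<comment> \<open>In \<open>b\<close> the surviving letters stand behind \<beta>, in the product
    behind \<alpha>.\<close>
  define h where "h l = l - length \<beta> + length \<alpha>" for l
  have inj: "inj_on h (special \<sigma> b)" by (rule inj_onI) (use * in \<open>auto simp: h_def dest!: *\<close>)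
  have sp: "special \<delta> (a * b) = A \<union> h ` special \<sigma> b"
  proof (intro equalityI subsetI)
    fix l assume l: "l \<in> special \<delta> (a * b)"
    show "l \<in> A \<union> h ` special \<sigma> b"
    proof (cases "l \<le> length \<alpha>")
      case True then show ?thesis using l 1 by (auto simp: A_def)
    next
      case False
      have "l - length \<alpha> + length \<beta> \<in> special \<sigma> b"
        using l False 1 by (auto simp: \<sigma>_def prefix_def)
      moreover have "h (l - length \<alpha> + length \<beta>) = l" using False by (simp add: h_def)
      ultimately show ?thesis by (metis UnI2 imageI)
    qed
  next
    fix l assume "l \<in> A \<union> h ` special \<sigma> b"
    then show "l \<in> special \<delta> (a * b)"
    proof
      assume "l \<in> A" then show ?thesis using 1 by (auto simp: A_def)
    next
      assume "l \<in> h ` special \<sigma> b"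
      then obtain k where k: "k \<in> special \<sigma> b" "l = h k" by auto
      note * [OF k(1)]
      then show ?thesis using k 1 by (auto simp: h_def \<sigma>_def prefix_def split: if_splits)
    qed
  qed
  have disj: "A \<inter> h ` special \<sigma> b = {}"
  proof -
    have "h k \<notin> A" if "k \<in> special \<sigma> b" for k
      using *[OF that] 1(1) by (auto simp: A_def h_def)
    then show ?thesis by auto
  qed
  have "cuts \<delta> (a * b) g = (\<Sum>l\<in>A. g (left_part (a * b) l) (right_part (a * b) l))
      + (\<Sum>l\<in>special \<sigma> b. g (left_part (a * b) (h l)) (right_part (a * b) (h l)))"
    unfolding cuts_def sp using disj by (subst sum.union_disjoint) (auto simp: A_def sum.reindex[OF inj])
  also have "(\<Sum>l\<in>A. g (left_part (a * b) l) (right_part (a * b) l)) = cuts \<delta> a (\<lambda>v w. g v (w * b))"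
    unfolding cuts_def A_def by (rule sum.cong) (use 1 in auto)
  also have "(\<Sum>l\<in>special \<sigma> b. g (left_part (a * b) (h l)) (right_part (a * b) (h l))) = cuts \<sigma> b (\<lambda>v w. g (a * v) w)"
    unfolding cuts_def
  proof (rule sum.cong)
    fix l assume "l \<in> special \<sigma> b"
    note * = *[OF this]
    have "a * left_part b l = left_part (a * b) (h l)" "right_part b l = right_part (a * b) (h l)"
      using * 1 by (auto simp: h_def)
    then show "g (left_part (a * b) (h l)) (right_part (a * b) (h l)) = g (a * left_part b l) (right_part b l)" by simp
  qed simp
  finally show ?thesis by (simp add: \<sigma>_def)
next
  case (2 \<alpha> \<beta> \<gamma> \<kappa>)
  have "prefix (\<gamma> @ \<beta>) (stack_step \<delta> a)" using 2 by auto
  then have "prefix (take l \<gamma>) (stack_step \<delta> a)" for l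
    by (meson take_is_prefix prefix_order.trans append_prefixD)
  then have "special (stack_step \<delta> a) b = {}" using 2(2) by simp
  then have "cuts (stack_step \<delta> a) b h = 0" for h by (simp add: cuts_def)
  moreover have "special \<delta> (a * b) = special \<delta> a" using 2 by auto
  then have "cuts \<delta> (a * b) g = cuts \<delta> a (\<lambda>v w. g v (w * b))"
    unfolding cuts_def by (rule sum.cong) (use 2 in auto)
  ultimately show ?thesis by simp
qed

lemma right_part_mult_Zero: "a * b = Zero \<Longrightarrow> right_part a l * b = Zero"
  by (cases a; cases b) (auto split: if_splits)

text \<open>Every special position of \<open>b\<close> lies beyond the letter whose mismatch makes
  the product vanish, so \<open>left_part b l\<close> contains that letter and already annihilates
  \<open>a\<close>.\<close>

lemma mult_left_part_Zero:
  assumes "a * b = Zero" "l \<in> special (stack_step \<delta> a) b"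
  shows "a * left_part b l = Zero"
proof (cases a)
  case a: (PQ \<alpha> \<beta>)
  show ?thesis
  proof (cases b)
    case b: (PQ \<gamma> \<kappa>)
    have inc: "\<not> prefix \<gamma> \<beta>" "\<not> prefix \<beta> \<gamma>" using assms(1) a b by (auto split: if_splits)
    have "prefix \<beta> (stack_step \<delta> a)" using a by auto
    then have "\<not> prefix (take l \<gamma>) \<beta>" using assms(2) b by (auto intro: prefix_order.trans)
    moreover have "\<not> prefix \<beta> (take l \<gamma>)" using inc(2) by (meson take_is_prefix prefix_order.trans)
    ultimately show ?thesis using a b by simp
  qed (use assms in simp)
qed simp

section \<open>Inserting cuts into lists\<close>

text \<open>These are the functions that live on the quotient by the span of z_0, where a tensor
  with an entry z_0 vanishes.\<close>

definition reduced :: "('i cuntz list \<Rightarrow> complex) \<Rightarrow> bool" where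
  "reduced f \<longleftrightarrow> (\<forall>x. Zero \<in> set x \<longrightarrow> f x = 0)"

fun stack_run :: "'i list \<Rightarrow> 'i cuntz list \<Rightarrow> 'i list" where
  "stack_run \<delta> [] = \<delta>"
| "stack_run \<delta> (s # ys) = stack_run (stack_step \<delta> s) ys"

fun cut_count :: "'i list \<Rightarrow> 'i cuntz list \<Rightarrow> nat" where
  "cut_count \<delta> [] = 0"
| "cut_count \<delta> (s # ys) = card (special \<delta> s) + cut_count (stack_step \<delta> s) ys"

fun insert_cuts :: "'i list \<Rightarrow> ('i cuntz list \<Rightarrow> complex) \<Rightarrow> 'i cuntz list \<Rightarrow> complex" where
  "insert_cuts \<delta> f [] = 0"
| "insert_cuts \<delta> f (s # ys) = - cuts \<delta> s (\<lambda>v w. f (v # w # ys)) - insert_cuts (stack_step \<delta> s) (\<lambda>z. f (s # z)) ys"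

lemma reducedD: "reduced f \<Longrightarrow> Zero \<in> set x \<Longrightarrow> f x = 0"
  by (auto simp: reduced_def)

lemma reduced_Cons: "reduced f \<Longrightarrow> reduced (\<lambda>z. f (a # z))"
  by (auto simp: reduced_def)

lemma reduced_Zero_Cons: "reduced f \<Longrightarrow> (\<lambda>z. f (Zero # z)) = (\<lambda>_. 0)"
  by (auto simp: reduced_def)

lemma cuts_Zero [simp]: "cuts \<delta> Zero g = 0"
  by (simp add: cuts_def)

lemma cuts_cong:
  "(\<And>l. l \<in> special \<delta> s \<Longrightarrow> g (left_part s l) (right_part s l) = h (left_part s l) (right_part s l)) \<Longrightarrow> cuts \<delta> s g = cuts \<delta> s h"
  unfolding cuts_def by (rule sum.cong) auto

lemma cuts_0 [simp]: "cuts \<delta> s (\<lambda>v w. 0) = 0"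
  by (simp add: cuts_def)

lemma cuts_const: "cuts \<delta> s (\<lambda>v w. c) = of_nat (card (special \<delta> s)) * c"
  by (simp add: cuts_def)

lemma cuts_add: "cuts \<delta> s (\<lambda>v w. g v w + h v w) = cuts \<delta> s g + cuts \<delta> s h"
  by (simp add: cuts_def sum.distrib)

lemma cuts_diff: "cuts \<delta> s (\<lambda>v w. g v w - h v w) = cuts \<delta> s g - cuts \<delta> s h"
  by (simp add: cuts_def sum_subtractf)

lemma cuts_minus: "cuts \<delta> s (\<lambda>v w. - g v w) = - cuts \<delta> s g"
  by (simp add: cuts_def sum_negf)

lemma cuts_cmult: "cuts \<delta> s (\<lambda>v w. c * g v w) = c * cuts \<delta> s g"
  by (simp add: cuts_def sum_distrib_left)

lemma bar_cuts: "bar (\<lambda>z. cuts \<delta> s (\<lambda>v w. f v w z)) x = cuts \<delta> s (\<lambda>v w. bar (f v w) x)"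
  unfolding cuts_def by (rule bar_sum) simp

lemma insert_cuts_0 [simp]: "insert_cuts \<delta> (\<lambda>_. 0) x = 0"
  by (induction x arbitrary: \<delta>) auto

lemma insert_cuts_minus: "insert_cuts \<delta> (\<lambda>z. - f z) x = - insert_cuts \<delta> f x"
  by (induction x arbitrary: \<delta> f) (auto simp: cuts_minus)

lemma insert_cuts_diff: "insert_cuts \<delta> (\<lambda>z. f z - g z) x = insert_cuts \<delta> f x - insert_cuts \<delta> g x"
  by (induction x arbitrary: \<delta> f g) (auto simp: cuts_diff)

lemma insert_cuts_cong: "(\<And>z. length z = Suc (length x) \<Longrightarrow> f z = g z) \<Longrightarrow> insert_cuts \<delta> f x = insert_cuts \<delta> g x"
proof (induction x arbitrary: \<delta> f g)
  case (Cons a x)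
  have "cuts \<delta> a (\<lambda>v w. f (v # w # x)) = cuts \<delta> a (\<lambda>v w. g (v # w # x))"
    by (rule cuts_cong) (simp add: Cons.prems)
  then show ?case using Cons.IH[of "\<lambda>z. f (a # z)" "\<lambda>z. g (a # z)"] Cons.prems by simp
qed simp

text \<open>For \<open>a * b = Zero\<close> the Leibniz rule survives because one of the two pieces
  in each term on the right is zero as well, and \<open>g\<close> vanishes there.\<close>

lemma cuts_mult:
  assumes "\<And>v w. v = Zero \<or> w = Zero \<Longrightarrow> g v w = 0"
  shows "cuts \<delta> (a * b) g = cuts \<delta> a (\<lambda>v w. g v (w * b)) + cuts (stack_step \<delta> a) b (\<lambda>v w. g (a * v) w)"
proof (cases "a * b = Zero")
  case True
  have "cuts \<delta> a (\<lambda>v w. g v (w * b)) = cuts \<delta> a (\<lambda>v w. 0)"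
    by (rule cuts_cong) (simp add: assms right_part_mult_Zero[OF True])
  moreover have "cuts (stack_step \<delta> a) b (\<lambda>v w. g (a * v) w) = cuts (stack_step \<delta> a) b (\<lambda>v w. 0)"
    by (rule cuts_cong) (simp add: assms mult_left_part_Zero[OF True])
  ultimately show ?thesis using True by simp
qed (rule special_mult)

text \<open>Merging the two pieces of a cut gives back the word, once for each cut. Cutting and
  merging at different places cancel; where the merged pair itself is cut, this is
  \<open>cuts_mult\<close>.\<close>

lemma bar_insert_cuts:
  assumes "reduced f"
  shows "bar (insert_cuts \<delta> f) x + insert_cuts \<delta> (bar f) x = of_nat (cut_count \<delta> x) * f x"
  using assms
proof (induction f x arbitrary: \<delta> rule: bar.induct)
  case (2 f a)
  have "cuts \<delta> a (\<lambda>v w. bar f [v, w]) = cuts \<delta> a (\<lambda>v w. - f [a])"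
    by (rule cuts_cong) simp
  then show ?case by (simp add: cuts_const)
next
  case (3 f a b ys)
  let ?fa = "\<lambda>z. f (a # z)"
  note IH = "3.IH"[OF reduced_Cons[OF "3.prems"], of "stack_step \<delta> a"]
  have 1: "bar (\<lambda>z. insert_cuts \<delta> f (a # z)) (b # ys)
     = - cuts \<delta> a (\<lambda>v w. bar (\<lambda>z. f (v # w # z)) (b # ys)) - bar (insert_cuts (stack_step \<delta> a) ?fa) (b # ys)"
    using bar_add[of "\<lambda>z. - cuts \<delta> a (\<lambda>v w. f (v # w # z))" "\<lambda>z. - insert_cuts (stack_step \<delta> a) ?fa z" "b # ys"]
    by (simp add: bar_minus bar_cuts)
  have 2: "cuts \<delta> a (\<lambda>v w. bar f (v # w # b # ys))
     = of_nat (card (special \<delta> a)) * - f (a # b # ys) + cuts \<delta> a (\<lambda>v w. f (v # w * b # ys))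
       + cuts \<delta> a (\<lambda>v w. bar (\<lambda>z. f (v # w # z)) (b # ys))"
    unfolding cuts_const[symmetric] cuts_add[symmetric]
    by (rule cuts_cong) simp
  have 3: "insert_cuts (stack_step \<delta> a) (\<lambda>z. bar f (a # z)) (b # ys)
     = - insert_cuts (stack_step \<delta> a) (\<lambda>z. f (a * hd z # tl z)) (b # ys) - insert_cuts (stack_step \<delta> a) (bar ?fa) (b # ys)"
    unfolding insert_cuts_minus[symmetric] insert_cuts_diff[symmetric]
    by (rule insert_cuts_cong) (subst bar_Cons, auto)
  have 4: "insert_cuts \<delta> f (a * b # ys) = - cuts \<delta> a (\<lambda>v w. f (v # w * b # ys))
     + insert_cuts (stack_step \<delta> a) (\<lambda>z. f (a * hd z # tl z)) (b # ys)"
  proof -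
    have "cuts \<delta> (a * b) (\<lambda>v w. f (v # w # ys)) = cuts \<delta> a (\<lambda>v w. f (v # w * b # ys))
        + cuts (stack_step \<delta> a) b (\<lambda>v w. f (a * v # w # ys))"
      by (rule cuts_mult) (auto intro: reducedD[OF "3.prems"])
    \<comment> \<open>After a zero product the two stacks may differ, but then \<open>f\<close>
      vanishes on all lists concerned.\<close>
    moreover have "insert_cuts (stack_step \<delta> (a * b)) (\<lambda>z. f (a * b # z)) ys
        = insert_cuts (stack_step (stack_step \<delta> a) b) (\<lambda>z. f (a * b # z)) ys"
      by (cases "a * b = Zero") (simp_all add: stack_step_mult reduced_Zero_Cons[OF "3.prems"])
    ultimately show ?thesis by simp
  qed
  have 5: "of_nat (cut_count \<delta> (a # b # ys)) * f (a # b # ys) = of_nat (card (special \<delta> a)) * f (a # b # ys)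
     + (bar (insert_cuts (stack_step \<delta> a) ?fa) (b # ys) + insert_cuts (stack_step \<delta> a) (bar ?fa) (b # ys))"
    unfolding IH cut_count.simps(2)[of \<delta> a] of_nat_add by (rule distrib_right)
  show ?case
    unfolding 5 bar.simps(3)[of "insert_cuts \<delta> f"] insert_cuts.simps(2)[of \<delta> "bar f"] 1 2 3 4 by (simp only: algebra_simps) simp
qed simp

lemma stack_run_append: "stack_run \<delta> (xs @ ys) = stack_run (stack_run \<delta> xs) ys"
  by (induction xs arbitrary: \<delta>) auto

text \<open>The entry \<open>s\<close> that wraps around brings its own special letters to the last
  place. The extra term collects these cuts with the sign of that place; it becomes the rotated half
  of the defect 1 - t.\<close>

lemma insert_cuts_mult_last:
  assumes "reduced f" "ys \<noteq> []"
  shows "insert_cuts \<delta> f (mult_last s ys) = insert_cuts \<delta> (\<lambda>z. f (mult_last s z)) ys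
     + (- 1) ^ length ys * cuts (stack_run \<delta> ys) s (\<lambda>v w. f (mult_last v ys @ [w]))"
  using assms
proof (induction ys arbitrary: f \<delta>)
  case (Cons a ys)
  show ?case
  proof (cases "ys = []")
    case True
    have "cuts \<delta> (a * s) (\<lambda>v w. f [v, w]) = cuts \<delta> a (\<lambda>v w. f [v, w * s])
        + cuts (stack_step \<delta> a) s (\<lambda>v w. f [a * v, w])"
      by (rule cuts_mult) (auto intro: reducedD[OF Cons.prems(1)])
    then show ?thesis using True by simp
  next
    case False
    have "cuts \<delta> a (\<lambda>v w. f (v # w # mult_last s ys)) = cuts \<delta> a (\<lambda>v w. f (mult_last s (v # w # ys)))"
      using False by (simp add: mult_last_Cons)
    moreover have "insert_cuts (stack_step \<delta> a) (\<lambda>z. f (mult_last s (a # z))) ys = insert_cuts (stack_step \<delta> a) (\<lambda>z. f (a # mult_last s z)) ys"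
      by (rule insert_cuts_cong) (subst mult_last_Cons, auto)
    ultimately show ?thesis
      using Cons.IH[OF reduced_Cons[OF Cons.prems(1)] False, of "stack_step \<delta> a" a] False
      by (simp add: mult_last_Cons)
  qed
qed simp

text \<open>Appending the unit contracts \<open>bar\<close>. For a cocycle \<open>f\<close> the
  wrap-around face of \<open>c @ [1]\<close> is the rotation of \<open>c\<close>, so the contraction
  yields \<open>f\<close> minus its signed rotation.\<close>

lemma bar_append_one:
  fixes f :: "'s::monoid_mult list \<Rightarrow> complex"
  assumes "hochschild f (c @ [1]) = 0" "c \<noteq> []"
  shows "bar (\<lambda>z. (- 1) ^ length z * f (z @ [1])) c = f c + (- 1) ^ length c * f (tl c @ [hd c])"
proof -
  obtain ys a where c: "c = ys @ [a]" using assms(2) by (cases c rule: rev_cases) auto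
  have "bar (\<lambda>z. (- 1) ^ length z * f (z @ [1])) c = bar (\<lambda>z. (- 1) ^ (length c - 1) * f (z @ [1])) c"
    by (rule bar_cong_merge) simp
  also have "\<dots> = (- 1) ^ length ys * bar (\<lambda>z. f (z @ [1])) c"
    by (simp add: bar_cmult c)
  finally have 1: "bar (\<lambda>z. (- 1) ^ length z * f (z @ [1])) c = (- 1) ^ length ys * bar (\<lambda>z. f (z @ [1])) c" .
  have "mult_last (hd (c @ [1])) (tl (c @ [1])) = tl c @ [hd c]"
    using assms(2) by (simp add: mult_last_append)
  then have "f (tl c @ [hd c]) + bar f (ys @ [a, 1]) = 0"
    using assms(1) by (simp add: hochschild_def c)
  then have *: "bar (\<lambda>z. f (z @ [1])) c = (- 1) ^ length ys * f c - f (tl c @ [hd c])"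
    unfolding bar_snoc by (simp add: c algebra_simps)
  show ?thesis unfolding 1 * by (simp add: c right_diff_distrib flip: mult.assoc power_add)
qed

text \<open>Restarts the cyclic word right after a special letter of its first entry.\<close>

definition move_cut :: "'i list \<Rightarrow> ('i cuntz list \<Rightarrow> complex) \<Rightarrow> 'i cuntz list \<Rightarrow> complex" where
  "move_cut \<delta> m x = cuts \<delta> (hd x) (\<lambda>v w. m (w # mult_last v (tl x)))"

text \<open>Restarting intertwines the full differential with \<open>bar\<close>: the cuts of
  \<open>a * b\<close> are those of \<open>a\<close> and those of \<open>b\<close>, and the latter
  cancel against the wrap-around face, in which \<open>b\<close> comes first.\<close>

lemma hochschild_move_cut:
  assumes "reduced m" "length x \<ge> 3"
  shows "move_cut (stack_step \<delta> (hd x)) m (mult_last (hd x) (tl x)) + bar (move_cut \<delta> m) x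
     = cuts \<delta> (hd x) (\<lambda>v w. bar m (w # mult_last v (tl x)))"
proof -
  obtain a b zs where x: "x = a # b # zs" "zs \<noteq> []"
    using assms(2) by (cases x; cases "tl x"; cases "tl (tl x)") auto
  have 1: "bar (\<lambda>z. move_cut \<delta> m (a # z)) (b # zs) = cuts \<delta> a (\<lambda>v w. bar (\<lambda>z. m (w # z)) (b # mult_last v zs))"
    unfolding move_cut_def using x(2)
    by (simp add: bar_cuts bar_mult_last[of "\<lambda>z. m (_ # z)"] mult_last_Cons)
  have 2: "cuts \<delta> a (\<lambda>v w. bar m (w # mult_last v (b # zs))) =
     - cuts \<delta> a (\<lambda>v w. m (w * b # mult_last v zs)) - cuts \<delta> a (\<lambda>v w. bar (\<lambda>z. m (w # z)) (b # mult_last v zs))"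
    unfolding cuts_minus[symmetric] cuts_diff[symmetric] using x(2)
    by (intro cuts_cong) (simp add: mult_last_Cons)
  have 3: "move_cut \<delta> m (a * b # zs) = cuts \<delta> a (\<lambda>v w. m (w * b # mult_last v zs))
     + cuts (stack_step \<delta> a) b (\<lambda>v w. m (w # mult_last (a * v) zs))"
    unfolding move_cut_def list.sel
  proof (rule cuts_mult)
    fix v w :: "'a cuntz" assume "v = Zero \<or> w = Zero"
    moreover have "Zero \<in> set (mult_last Zero zs)"
      using x(2) by (cases zs rule: rev_cases) auto
    ultimately show "m (w # mult_last v zs) = 0" by (auto intro!: reducedD[OF assms(1)])
  qed
  show ?thesis using 1 2 3 x(2) by (simp add: x(1) mult_last_Cons) (simp add: move_cut_def mult_last_mult_last)
qed

text \<open>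
  A stack that reproduces itself after one turn and meets a special letter on the way is unique;
  this makes the special letters, hence the average over all cuts, invariant under rotation.
\<close>

definition stationary :: "'i cuntz list \<Rightarrow> 'i list \<Rightarrow> bool" where
  "stationary x \<delta> \<longleftrightarrow> stack_run \<delta> x = \<delta> \<and> cut_count \<delta> x > 0"

definition has_cut :: "'i cuntz list \<Rightarrow> bool" where
  "has_cut x \<longleftrightarrow> (\<exists>\<delta>. stationary x \<delta>)"

lemma card_special_mult:
  assumes "a * b \<noteq> Zero"
  shows "card (special \<delta> (a * b)) = card (special \<delta> a) + card (special (stack_step \<delta> a) b)"
proof -
  have "complex_of_nat (card (special \<delta> (a * b))) = of_nat (card (special \<delta> a) + card (special (stack_step \<delta> a) b))"
    using special_mult[OF assms, of \<delta> "\<lambda>v w. 1"] by (simp add: cuts_const)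
  then show ?thesis by (simp only: of_nat_eq_iff)
qed

lemma stack_run_merge: "a * b \<noteq> Zero \<Longrightarrow> stack_run \<delta> (us @ (a * b) # vs) = stack_run \<delta> (us @ a # b # vs)"
  by (simp add: stack_run_append stack_step_mult)

lemma cut_count_append: "cut_count \<delta> (xs @ ys) = cut_count \<delta> xs + cut_count (stack_run \<delta> xs) ys"
  by (induction xs arbitrary: \<delta>) auto

lemma cut_count_merge: "a * b \<noteq> Zero \<Longrightarrow> cut_count \<delta> (us @ (a * b) # vs) = cut_count \<delta> (us @ a # b # vs)"
  by (simp add: cut_count_append stack_step_mult card_special_mult)

lemma stationary_merge: "a * b \<noteq> Zero \<Longrightarrow> stationary (us @ (a * b) # vs) \<delta> \<longleftrightarrow> stationary (us @ a # b # vs) \<delta>"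
  by (simp add: stationary_def stack_run_merge cut_count_merge)

lemma stack_run_prod:
  "prod_list xs \<noteq> Zero \<Longrightarrow> stack_run \<delta> xs = stack_step \<delta> (prod_list xs) \<and> cut_count \<delta> xs = card (special \<delta> (prod_list xs))"
proof (induction xs arbitrary: \<delta>)
  case Nil
  have "special \<delta> (PQ [] []) = {}" by auto
  then show ?case by (simp add: one_cuntz_def)
next
  case (Cons a xs)
  then have "prod_list xs \<noteq> Zero" by auto
  with Cons show ?case by (simp add: stack_step_mult card_special_mult)
qed

text \<open>If the product vanishes although no factor does, some letter p meets a wrong partner
  whatever the initial stack is. That letter is special, and the reset at its entry erases all
  memory of the initial stack.\<close>

lemma stack_run_prod_Zero:
  "Zero \<notin> set xs \<Longrightarrow> prod_list xs = Zero \<Longrightarrow> (\<exists>\<rho>. \<forall>\<delta>. stack_run \<delta> xs = \<rho>) \<and> (\<forall>\<delta>. cut_count \<delta> xs > 0)"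
proof (induction xs rule: rev_induct)
  case Nil
  then show ?case by (simp add: one_cuntz_def)
next
  case (snoc s ys)
  show ?case
  proof (cases "prod_list ys = Zero")
    case True
    with snoc obtain \<rho> where "\<And>\<delta>. stack_run \<delta> ys = \<rho>" "\<And>\<delta>. cut_count \<delta> ys > 0" by auto
    then show ?thesis by (auto simp: stack_run_append cut_count_append)
  next
    case False
    then obtain \<gamma> \<kappa> where u: "prod_list ys = PQ \<gamma> \<kappa>" by (cases "prod_list ys") auto
    obtain \<alpha> \<beta> where s: "s = PQ \<alpha> \<beta>" using snoc.prems by (cases s) auto
    have inc: "\<not> prefix \<alpha> \<kappa>" "\<not> prefix \<kappa> \<alpha>" using snoc.prems u s by (auto split: if_splits)
    have np: "\<not> prefix \<alpha> (stack_run \<delta> ys)" for \<delta>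
    proof
      assume "prefix \<alpha> (stack_run \<delta> ys)"
      moreover have "prefix \<kappa> (stack_run \<delta> ys)" using stack_run_prod[OF False, of \<delta>] u by auto
      ultimately show False using inc prefix_same_cases by blast
    qed
    have "length \<alpha> \<in> special (stack_run \<delta> ys) s" for \<delta> using np s by simp
    then have "card (special (stack_run \<delta> ys) s) > 0" for \<delta> by (metis card_gt_0_iff finite_special empty_iff)
    then show ?thesis using np s by (auto simp: stack_run_append cut_count_append)
  qed
qed

lemma stationary_unique:
  assumes "Zero \<notin> set x" "stationary x \<delta>" "stationary x \<delta>'"
  shows "\<delta> = \<delta>'"
proof (cases "prod_list x = Zero")
  case True
  then show ?thesis using stack_run_prod_Zero[OF assms(1)] assms(2,3) by (metis stationary_def)
next
  case False
  then obtain \<gamma> \<kappa> where T: "prod_list x = PQ \<gamma> \<kappa>" by (cases "prod_list x") auto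
  \<comment> \<open>For a nonzero product, a special letter means that the stack is reset to
    \<kappa>, whatever it was before.\<close>
  have "\<delta> = \<kappa>" if "stationary x \<delta>" for \<delta>
  proof -
    have "special \<delta> (PQ \<gamma> \<kappa>) \<noteq> {}"
      using that stack_run_prod[OF False] T by (auto simp: stationary_def simp del: special.simps)
    then have "\<not> prefix \<gamma> \<delta>" by (auto intro: prefix_order.trans[OF take_is_prefix])
    then show ?thesis using that stack_run_prod[OF False] T by (simp add: stationary_def)
  qed
  then show ?thesis using assms by blast
qed

text \<open>A zero product always produces a cut, and for
  \<open>p\<^sub>\<gamma> q\<^sub>\<kappa>\<close> with \<gamma> no prefix of \<kappa> the stack
  \<kappa> is stationary. So without a cut only letters q can remain unmatched.\<close>

lemma not_has_cut:
  assumes "Zero \<notin> set x" "\<not> has_cut x"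
  obtains \<gamma> \<kappa> where "prod_list x = PQ \<gamma> (\<gamma> @ \<kappa>)"
proof (cases "prod_list x = Zero")
  case True
  then have "stationary x (stack_run [] x)" using stack_run_prod_Zero[OF assms(1)] by (metis stationary_def)
  then show ?thesis using assms by (auto simp: has_cut_def)
next
  case False
  then obtain \<gamma> \<kappa> where T: "prod_list x = PQ \<gamma> \<kappa>" by (cases "prod_list x") auto
  have "prefix \<gamma> \<kappa>"
  proof (rule ccontr)
    assume np: "\<not> prefix \<gamma> \<kappa>"
    then have "length \<gamma> \<in> special \<kappa> (PQ \<gamma> \<kappa>)" by simp
    then have "card (special \<kappa> (PQ \<gamma> \<kappa>)) > 0" by (metis card_gt_0_iff finite_special empty_iff)
    then have "stationary x \<kappa>" using stack_run_prod[OF False, of \<kappa>] T np by (simp add: stationary_def)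
    then show False using assms by (auto simp: has_cut_def)
  qed
  then show ?thesis using T that by (auto simp: prefix_def)
qed

lemma stationary_rotate: "stationary (a # ys) \<delta> \<Longrightarrow> stationary (ys @ [a]) (stack_step \<delta> a)"
  by (auto simp: stationary_def stack_run_append cut_count_append)

lemma stationary_rotate_back: "stationary (ys @ [a]) \<delta> \<Longrightarrow> stationary (a # ys) (stack_run \<delta> ys)"
  by (auto simp: stationary_def stack_run_append cut_count_append)

lemma has_cut_rotate: "has_cut (ys @ [a]) \<longleftrightarrow> has_cut (a # ys)"
  using stationary_rotate stationary_rotate_back unfolding has_cut_def by blast

lemma has_cut_merge: "a * b \<noteq> Zero \<Longrightarrow> has_cut (us @ (a * b) # vs) \<longleftrightarrow> has_cut (us @ a # b # vs)"
  by (simp add: has_cut_def stationary_merge)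

text \<open>The wrap-around face starts reading one entry later, hence with the stack advanced by
  \<open>a\<close>; the cuts are those of a whole turn, so their number does not change.\<close>

lemma stationary_wrap:
  assumes "stationary (a # ys) \<delta>" "ys \<noteq> []" "Zero \<notin> set (mult_last a ys)"
  shows "stationary (mult_last a ys) (stack_step \<delta> a)" "cut_count (stack_step \<delta> a) (mult_last a ys) = cut_count \<delta> (a # ys)"
proof -
  obtain zs l where ys: "ys = zs @ [l]" using assms(2) by (cases ys rule: rev_cases) auto
  have nz: "l * a \<noteq> Zero" using assms(3) ys by auto
  show "stationary (mult_last a ys) (stack_step \<delta> a)"
    using stationary_rotate[OF assms(1)] stationary_merge[OF nz, of zs "[]"] ys by simp
  have "cut_count (stack_step \<delta> a) (mult_last a ys) = cut_count (stack_step \<delta> a) (ys @ [a])"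
    using cut_count_merge[OF nz, of _ zs "[]"] ys by simp
  also have "\<dots> = cut_count \<delta> (a # ys)"
    using assms(1) by (simp add: cut_count_append stationary_def)
  finally show "cut_count (stack_step \<delta> a) (mult_last a ys) = cut_count \<delta> (a # ys)" .
qed

lemma has_cut_wrap:
  assumes "ys \<noteq> []" "Zero \<notin> set (mult_last a ys)"
  shows "has_cut (mult_last a ys) \<longleftrightarrow> has_cut (a # ys)"
proof -
  obtain zs l where ys: "ys = zs @ [l]" using assms(1) by (cases ys rule: rev_cases) auto
  have nz: "l * a \<noteq> Zero" using assms(2) ys by auto
  show ?thesis using has_cut_merge[OF nz, of zs "[]"] has_cut_rotate[of ys a] ys by simp
qed

lemma Zero_in_mult_last: "ys \<noteq> [] \<Longrightarrow> Zero \<in> set (a # ys) \<Longrightarrow> Zero \<in> set (mult_last a ys)"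
  for a :: "'i cuntz"
  by (cases ys rule: rev_cases) auto

lemma Zero_in_merge: "Zero \<in> set (us @ a # b # vs) \<Longrightarrow> Zero \<in> set (us @ (a * b) # vs)"
  for a :: "'i cuntz"
  by auto

lemma hochschild_reduced:
  assumes "reduced f" "Zero \<in> set x" "length x \<ge> 2"
  shows "hochschild f x = 0"
proof -
  obtain a ys where x: "x = a # ys" "ys \<noteq> []" using assms(3) by (cases x; cases "tl x") auto
  have "f (mult_last a ys) = 0" using assms x Zero_in_mult_last by (metis reducedD)
  moreover have "bar f x = bar (\<lambda>_. 0) x"
    by (rule bar_cong_merge) (use assms Zero_in_merge in \<open>blast intro: reducedD\<close>)
  ultimately show ?thesis by (simp add: hochschild_def x)
qed

text \<open>
  Only nonzero faces are compared: reduced functions vanish on the others.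
\<close>

definition face_inv :: "('i cuntz list \<Rightarrow> bool) \<Rightarrow> bool" where
  "face_inv P \<longleftrightarrow> (\<forall>us a b vs. a * b \<noteq> Zero \<longrightarrow> P (us @ (a * b) # vs) = P (us @ a # b # vs)) \<and>
     (\<forall>a ys. ys \<noteq> [] \<and> Zero \<notin> set (mult_last a ys) \<longrightarrow> P (mult_last a ys) = P (a # ys))"

text \<open>The words with \<open>P\<close> and those without span complementary subcomplexes of the
  chains modulo z_0, so restriction to one of them commutes with the differential.\<close>

lemma hochschild_face_inv:
  assumes "reduced f" "face_inv P" "length x \<ge> 2"
  shows "hochschild (\<lambda>z. if P z then f z else 0) x = (if P x then hochschild f x else 0)"
proof -
  obtain a ys where x: "x = a # ys" "ys \<noteq> []" using assms(3) by (cases x; cases "tl x") auto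
  let ?c = "if P x then 1 else 0 :: complex"
  have "(if P (mult_last a ys) then f (mult_last a ys) else 0) = ?c * f (mult_last a ys)"
    using assms(1,2) x by (cases "Zero \<in> set (mult_last a ys)") (auto simp: reducedD face_inv_def)
  moreover have "bar (\<lambda>z. if P z then f z else 0) x = bar (\<lambda>z. ?c * f z) x"
  proof (rule bar_cong_merge)
    fix us a b vs assume "x = us @ a # b # vs"
    then show "(if P (us @ (a * b) # vs) then f (us @ (a * b) # vs) else 0) = ?c * f (us @ (a * b) # vs)"
      using assms(1,2) by (cases "a * b = Zero") (auto simp: reducedD face_inv_def)
  qed
  ultimately show ?thesis by (cases "P x") (auto simp: hochschild_def x bar_cmult)
qed

lemma face_inv_has_cut: "face_inv has_cut"
  by (auto simp: face_inv_def has_cut_merge has_cut_wrap)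

section \<open>Averaging over all cuts of a cyclic word\<close>

text \<open>By \<open>stationary_unique\<close> the stack is determined by the word;
  \<open>F\<close> sums the contributions of one turn started with it. The value 0 on lists with a
  zero makes every average \<open>reduced\<close>.\<close>

definition average :: "('i list \<Rightarrow> 'i cuntz list \<Rightarrow> complex) \<Rightarrow> 'i cuntz list \<Rightarrow> complex" where
  "average F x = (if Zero \<in> set x \<or> \<not> has_cut x then 0
     else let \<delta> = (THE \<delta>. stationary x \<delta>) in F \<delta> x / of_nat (cut_count \<delta> x))"

lemma reduced_average: "reduced (average F)"
  by (simp add: reduced_def average_def)

lemma average_eq: "Zero \<notin> set x \<Longrightarrow> stationary x \<delta> \<Longrightarrow> average F x = F \<delta> x / of_nat (cut_count \<delta> x)"
proof -
  assume "Zero \<notin> set x" "stationary x \<delta>"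
  moreover from this have "(THE \<delta>. stationary x \<delta>) = \<delta>" by (blast intro: stationary_unique)
  ultimately show ?thesis by (auto simp: average_def has_cut_def)
qed

text \<open>All nonzero faces have the same number of cuts, so the division can be pulled out. On
  the merge faces the stack stays the same, on the wrap-around face it advances by
  \<open>a\<close>.\<close>

lemma hochschild_average:
  assumes F: "\<And>\<delta>. reduced (F \<delta>)" and x: "Zero \<notin> set (a # ys)" "ys \<noteq> []" and st: "stationary (a # ys) \<delta>"
  shows "hochschild (average F) (a # ys) = (F (stack_step \<delta> a) (mult_last a ys) + bar (F \<delta>) (a # ys)) / of_nat (cut_count \<delta> (a # ys))"
proof -
  let ?N = "of_nat (cut_count \<delta> (a # ys)) :: complex"
  have "average F (mult_last a ys) = F (stack_step \<delta> a) (mult_last a ys) / ?N"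
  proof (cases "Zero \<in> set (mult_last a ys)")
    case True
    then show ?thesis by (simp add: reducedD[OF F] reducedD[OF reduced_average])
  next
    case False
    then show ?thesis using average_eq stationary_wrap[OF st x(2)] by metis
  qed
  moreover have "bar (average F) (a # ys) = bar (\<lambda>z. (1 / ?N) * F \<delta> z) (a # ys)" (is "?l = _")
  proof (rule bar_cong_merge)
    fix us b c vs assume *: "a # ys = us @ b # c # vs"
    show "average F (us @ (b * c) # vs) = 1 / ?N * F \<delta> (us @ (b * c) # vs)"
    proof (cases "b * c = Zero")
      case True
      then show ?thesis by (simp add: reducedD[OF F] reducedD[OF reduced_average])
    next
      case False
      then show ?thesis
        using average_eq[of "us @ (b * c) # vs" \<delta> F] st x(1) *
        by (auto simp: stationary_merge cut_count_merge simp del: cut_count.simps)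
    qed
  qed
  then have "?l = (1 / ?N) * bar (F \<delta>) (a # ys)" by (simp only: bar_cmult)
  ultimately show ?thesis by (simp add: hochschild_def add_divide_distrib del: cut_count.simps bar.simps)
qed

lemma norm_cuts_le:
  assumes "\<And>l. l \<in> special \<delta> s \<Longrightarrow> norm (g (left_part s l) (right_part s l)) \<le> K"
  shows "norm (cuts \<delta> s g) \<le> real (card (special \<delta> s)) * K"
  unfolding cuts_def using sum_norm_bound[OF assms] .

lemma norm_insert_cuts_le:
  assumes "\<And>z. length z = Suc (length x) \<Longrightarrow> norm (f z) \<le> K"
  shows "norm (insert_cuts \<delta> f x) \<le> real (cut_count \<delta> x) * K"
  using assms
proof (induction x arbitrary: \<delta> f)
  case (Cons a x)
  have "norm (insert_cuts \<delta> f (a # x)) \<le> norm (cuts \<delta> a (\<lambda>v w. f (v # w # x))) + norm (insert_cuts (stack_step \<delta> a) (\<lambda>z. f (a # z)) x)"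
    using norm_triangle_ineq4[of "- cuts \<delta> a (\<lambda>v w. f (v # w # x))" "insert_cuts (stack_step \<delta> a) (\<lambda>z. f (a # z)) x"] by simp
  also have "\<dots> \<le> real (card (special \<delta> a)) * K + real (cut_count (stack_step \<delta> a) x) * K"
    by (intro add_mono norm_cuts_le Cons.IH) (simp_all add: Cons.prems)
  finally show ?case by (simp add: algebra_simps)
qed simp

lemma reduced_insert_cuts: "reduced f \<Longrightarrow> reduced (insert_cuts \<delta> f)"
  unfolding reduced_def
proof (intro allI impI)
  fix x :: "'a cuntz list" assume "\<forall>x. Zero \<in> set x \<longrightarrow> f x = 0" "Zero \<in> set (x :: 'a cuntz list)"
  then show "insert_cuts \<delta> f x = 0"
  proof (induction x arbitrary: \<delta> f)
    case (Cons a x)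
    show ?case
    proof (cases "a = Zero")
      case True
      then show ?thesis using Cons.prems by simp
    next
      case False
      then have "Zero \<in> set x" using Cons.prems by auto
      then show ?thesis using Cons.prems(1) Cons.IH[of "\<lambda>z. f (a # z)"] by simp
    qed
  qed simp
qed

lemma reduced_move_cut: 
  assumes "reduced m"
  shows "reduced (\<lambda>x. if length x \<ge> 2 then move_cut \<delta> m x else 0)"
  unfolding reduced_def
proof (intro allI impI)
  fix x :: "'a cuntz list" assume z: "Zero \<in> set x"
  show "(if length x \<ge> 2 then move_cut \<delta> m x else 0) = 0"
  proof (cases "length x \<ge> 2")
    case True
    then obtain a ys where x: "x = a # ys" "ys \<noteq> []" by (cases x; cases "tl x") auto
    show ?thesis
    proof (cases "a = Zero")
      case False
      then have "Zero \<in> set (mult_last v ys)" for v using z x by (cases ys rule: rev_cases) auto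
      then show ?thesis by (simp add: move_cut_def x reducedD[OF assms])
    qed (simp add: move_cut_def x)
  qed simp
qed

text \<open>\<open>insert_cuts\<close> alone yields \<open>N f - (A - B)\<close>, where
  \<open>A - B\<close> is \<open>f\<close> minus its signed rotation, summed over the cuts of the
  first entry. On cocycles this difference is \<open>bar m\<close> by \<open>bar_append_one\<close>,
  and \<open>hochschild_move_cut\<close> turns \<open>m\<close> into the missing correction
  \<open>M\<close>.\<close>

theorem has_cut_part:
  fixes f :: "'i cuntz list \<Rightarrow> complex"
  assumes f: "reduced f" and cocycle: "\<And>z. length z = n + 2 \<Longrightarrow> hochschild f z = 0" and n: "n \<ge> 1"
    and bound: "\<And>x. length x = n + 1 \<Longrightarrow> norm (f x) \<le> K"
    and one: "n = 1 \<Longrightarrow> (\<And>s. f [s, 1] = 0)"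
  obtains g where "reduced g" "\<And>x. length x = n \<Longrightarrow> norm (g x) \<le> 2 * K"
    "\<And>x. length x = n + 1 \<Longrightarrow> Zero \<notin> set x \<Longrightarrow> hochschild g x = (if has_cut x then f x else 0)"
proof
  define m where "m z = (- 1) ^ length z * f (z @ [1])" for z
  \<comment> \<open>On a singleton \<open>move_cut\<close> would lose the left piece.
    \<open>M\<close> is 0 there, and for n = 1 the hypothesis \<open>one\<close> makes the term to
    be corrected vanish.\<close>
  define M where "M \<delta> x = (if length x \<ge> 2 then move_cut \<delta> m x else 0)" for \<delta> x
  define F where "F \<delta> x = insert_cuts \<delta> f x + M \<delta> x" for \<delta> x
  have m: "reduced m" using f by (auto simp: reduced_def m_def)
  have M: "reduced (M \<delta>)" for \<delta> unfolding M_def by (rule reduced_move_cut[OF m])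
  have F: "reduced (F \<delta>)" for \<delta>
    using reduced_insert_cuts[OF f] M by (auto simp: reduced_def F_def)
  show "reduced (average F)" by (rule reduced_average)
  have K: "K \<ge> 0" by (rule order_trans[OF norm_ge_zero bound[of "replicate (n + 1) 1"]]) simp
  show "norm (average F x) \<le> 2 * K" if len: "length x = n" for x
  proof (cases "Zero \<in> set x \<or> \<not> has_cut x")
    case False
    then obtain \<delta> where \<delta>: "stationary x \<delta>" "Zero \<notin> set x" by (auto simp: has_cut_def)
    have pos: "real (cut_count \<delta> x) > 0" using \<delta> by (simp add: stationary_def)
    obtain a ys where x: "x = a # ys" using len n by (cases x) auto
    \<comment> \<open>Both summands of \<open>F\<close> are bounded by \<open>N\<close> times K;
      after the division by \<open>N\<close> the bound 2 K does not depend on the number of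
      letters.\<close>
    have "norm (M \<delta> x) \<le> real (card (special \<delta> a)) * K"
      unfolding M_def move_cut_def using len K
      by (auto simp: x m_def norm_mult norm_power intro!: norm_cuts_le bound)
    also have "\<dots> \<le> real (cut_count \<delta> x) * K" by (intro mult_right_mono) (auto simp: K x)
    finally have "norm (F \<delta> x) \<le> real (cut_count \<delta> x) * K + real (cut_count \<delta> x) * K"
      unfolding F_def by (intro norm_triangle_le add_mono norm_insert_cuts_le bound) (auto simp: len)
    then show ?thesis
      using pos by (simp add: average_eq[OF \<delta>(2,1)] norm_divide divide_le_eq algebra_simps)
  qed (use K in \<open>auto simp: average_def\<close>)
  show "hochschild (average F) x = (if has_cut x then f x else 0)" if len: "length x = n + 1" and nz: "Zero \<notin> set x" for x
  proof (cases "has_cut x")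
    case False
    have "hochschild (average F) x = hochschild (\<lambda>z. if has_cut z then average F z else 0) x"
    proof (rule hochschild_cong)
      show "average F z = (if has_cut z then average F z else 0)" for z by (simp add: average_def)
    qed (use len in auto)
    then show ?thesis
      using hochschild_face_inv[OF reduced_average[of F] face_inv_has_cut, of x] len n False by simp
  next
    case True
    obtain a ys where x: "x = a # ys" "ys \<noteq> []" using len n by (cases x; cases "tl x") auto
    from True obtain \<delta> where \<delta>: "stationary (a # ys) \<delta>" by (auto simp: has_cut_def x)
    then have stack_run: "stack_run (stack_step \<delta> a) ys = \<delta>" by (simp add: stationary_def)
    \<comment> \<open>\<open>A\<close> comes from the wrap-around faces after cutting the first
      entry, \<open>B\<close> from cutting that entry after it has wrapped around; \<open>C\<close>
      occurs in both computations and cancels.\<close>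
    define A where "A = cuts \<delta> a (\<lambda>v w. f (w # mult_last v ys))"
    define B where "B = cuts \<delta> a (\<lambda>v w. (- 1) ^ length ys * f (mult_last v ys @ [w]))"
    define C where "C = insert_cuts (stack_step \<delta> a) (\<lambda>z. f (mult_last a z)) ys"
    have 1: "insert_cuts (stack_step \<delta> a) f (mult_last a ys) = C + B"
      unfolding insert_cuts_mult_last[OF f x(2)] B_def C_def stack_run by (simp add: cuts_cmult)
    have 2: "insert_cuts \<delta> (bar f) x = A + C"
    proof -
      have "insert_cuts \<delta> (bar f) x = insert_cuts \<delta> (\<lambda>z. - f (mult_last (hd z) (tl z))) x"
      proof (rule insert_cuts_cong)
        fix z :: "'i cuntz list" assume "length z = Suc (length x)"
        then have "hochschild f z = 0" using cocycle len by simp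
        then show "bar f z = - f (mult_last (hd z) (tl z))" by (simp add: hochschild_def eq_neg_iff_add_eq_0 add.commute)
      qed
      then show ?thesis using x by (simp add: insert_cuts_minus A_def C_def mult_last_Cons)
    qed
    have 3: "cuts \<delta> a (\<lambda>v w. bar m (w # mult_last v ys)) = A - B"
    proof -
      have "cuts \<delta> a (\<lambda>v w. bar m (w # mult_last v ys))
        = cuts \<delta> a (\<lambda>v w. f (w # mult_last v ys) - (- 1) ^ length ys * f (mult_last v ys @ [w]))"
      proof (rule cuts_cong)
        fix l
        let ?c = "right_part a l # mult_last (left_part a l) ys"
        have "hochschild f (?c @ [1]) = 0" by (rule cocycle) (use len x in simp)
        from bar_append_one[OF this] show "bar m ?c = f ?c - (- 1) ^ length ys * f (mult_last (left_part a l) ys @ [right_part a l])"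
          by (simp add: m_def[abs_def])
      qed
      then show ?thesis by (simp add: cuts_diff A_def B_def)
    qed
    have 4: "M (stack_step \<delta> a) (mult_last a ys) + bar (M \<delta>) x = A - B"
    proof (cases "n = 1")
      case True
      then obtain b where ys: "ys = [b]" using len x by (cases ys) auto
      have "cuts \<delta> a (\<lambda>v w. bar m (w # mult_last v ys)) = cuts \<delta> a (\<lambda>v w. 0)"
      proof (rule cuts_cong)
        show "bar m (right_part a l # mult_last (left_part a l) ys) = 0" for l
          using one[OF True, of "right_part a l * (b * left_part a l)"] by (simp add: ys m_def)
      qed
      then show ?thesis using 3 by (simp add: M_def ys x)
    next
      case False
      then have len3: "length x \<ge> 3" using n len by simp
      have "bar (M \<delta>) x = bar (move_cut \<delta> m) x"
      proof (rule bar_cong_merge)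
        fix us b c vs assume "x = us @ b # c # vs"
        then show "M \<delta> (us @ (b * c) # vs) = move_cut \<delta> m (us @ (b * c) # vs)" using len3 by (simp add: M_def)
      qed
      then show ?thesis using hochschild_move_cut[OF m len3, of \<delta>] 3 len3 by (simp add: x M_def)
    qed
    have "bar (insert_cuts \<delta> f) x = of_nat (cut_count \<delta> x) * f x - (A + C)"
      using bar_insert_cuts[OF f, of \<delta> x] 2 by (simp add: algebra_simps)
    then have "F (stack_step \<delta> a) (mult_last a ys) + bar (F \<delta>) x = of_nat (cut_count \<delta> x) * f x"
      using 1 eq_diff_eq[THEN iffD2, OF 4[unfolded add.commute[of "M _ _"]]]
      by (simp add: F_def[abs_def] bar_add)
    moreover have "of_nat (cut_count \<delta> x) \<noteq> (0 :: complex)" using \<delta> x by (simp add: stationary_def del: cut_count.simps)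
    ultimately show ?thesis
      using True hochschild_average[OF F, of a ys \<delta>] nz x \<delta> by simp
  qed
qed

section \<open>Reversal\<close>

fun star :: "'i cuntz \<Rightarrow> 'i cuntz" where
  "star Zero = Zero"
| "star (PQ \<alpha> \<beta>) = PQ \<beta> \<alpha>"

lemma star_star [simp]: "star (star s) = s"
  by (cases s) auto

lemma star_mult: "star (a * b) = star b * star a"
  by (cases a; cases b) (auto simp: prefix_def)

lemma star_one [simp]: "star 1 = 1"
  by (simp add: one_cuntz_def)

lemma star_eq_Zero [simp]: "star s = Zero \<longleftrightarrow> s = Zero" "Zero = star s \<longleftrightarrow> s = Zero"
  by (cases s; simp)+

text \<open>Reverses the cyclic order but keeps the last entry last, so that \<open>[s, 1]\<close>,
  where the trace of a derivation is read off, goes to \<open>[star s, 1]\<close>.\<close>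

definition mirror :: "'i cuntz list \<Rightarrow> 'i cuntz list" where
  "mirror x = map star (rev (butlast x)) @ [star (last x)]"

lemma mirror_snoc [simp]: "mirror (ys @ [l]) = map star (rev ys) @ [star l]"
  by (simp add: mirror_def)

lemma mirror_mirror: "x \<noteq> [] \<Longrightarrow> mirror (mirror x) = x"
  by (cases x rule: rev_cases) (auto simp: rev_map o_def)

lemma length_mirror: "x \<noteq> [] \<Longrightarrow> length (mirror x) = length x"
  by (cases x rule: rev_cases) auto

lemma Zero_in_mirror: "x \<noteq> [] \<Longrightarrow> Zero \<in> set (mirror x) \<longleftrightarrow> Zero \<in> set x"
  by (cases x rule: rev_cases) (auto simp: image_iff)

lemma bar_rev_star:
  "bar f (map star (rev ys)) = (- 1) ^ length ys * bar (\<lambda>z. f (map star (rev z))) ys"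
proof (induction "\<lambda>_ :: 'a cuntz list. 0 :: complex" ys arbitrary: f rule: bar.induct)
  case (3 a b xs)
  have "bar f (map star (rev xs) @ [star b, star a])
    = bar (\<lambda>z. f (z @ [star a])) (map star (rev (b # xs))) + (- 1) ^ Suc (length xs) * f (map star (rev xs) @ [star (a * b)])"
    by (simp add: bar_snoc star_mult)
  also have "bar (\<lambda>z. f (z @ [star a])) (map star (rev (b # xs)))
    = (- 1) ^ length (b # xs) * bar (\<lambda>z. f (map star (rev z) @ [star a])) (b # xs)"
    by (rule 3)
  finally show ?case by (simp add: algebra_simps)
qed auto

text \<open>Since \<open>star\<close> reverses products, \<open>mirror\<close> exchanges the
  wrap-around face with the merge of the last two entries and reverses the order of the other faces,
  which yields the sign.\<close>

lemma hochschild_mirror: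
  assumes "length x \<ge> 2"
  shows "hochschild (\<lambda>z. f (mirror z)) x = (- 1) ^ (length x - 1) * hochschild f (mirror x)"
proof -
  obtain ys l where x: "x = ys @ [l]" "ys \<noteq> []"
    using assms by (cases x rule: rev_cases) (auto simp: Suc_le_eq)
  obtain a ws where a: "ys = a # ws" using x(2) by (cases ys) auto
  obtain us k where k: "ys = us @ [k]" using x(2) by (cases ys rule: rev_cases) auto
  define A where "A = f (mirror (us @ [k * l]))"
  define B where "B = f (mirror (ws @ [l * a]))"
  define C where "C = bar (\<lambda>z. f (map star (rev z) @ [star l])) ys"
  have "length ys = Suc (length us)" using k by simp
  moreover have "length ys = Suc (length ws)" using a by simp
  ultimately have len: "length us = length ws" by simp
  have 1: "hochschild (\<lambda>z. f (mirror z)) x = B + C + (- 1) ^ length ys * A"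
  proof -
    have "bar (\<lambda>z. f (mirror z)) x = C + (- 1) ^ length ys * A"
      using bar_snoc[of "\<lambda>z. f (mirror z)" us k l] by (simp add: x(1) k A_def C_def)
    moreover have "mult_last (hd x) (tl x) = ws @ [l * a]" by (simp add: x(1) a)
    ultimately show ?thesis by (simp add: hochschild_def B_def)
  qed
  have "mirror x = star k # map star (rev us) @ [star l]" by (simp add: x(1) k mirror_def butlast_append)
  then have "f (mult_last (hd (mirror x)) (tl (mirror x))) = A" by (simp add: A_def star_mult)
  moreover have "bar f (mirror x) = (- 1) ^ length ys * C + (- 1) ^ length ys * B"
  proof -
    have "mirror x = map star (rev ws) @ [star a, star l]" by (simp add: x(1) a mirror_def butlast_append)
    then have "bar f (mirror x) = bar (\<lambda>z. f (z @ [star l])) (map star (rev ys)) + (- 1) ^ length ys * B"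
      by (simp add: bar_snoc B_def star_mult a)
    then show ?thesis unfolding bar_rev_star C_def .
  qed
  ultimately have 2: "hochschild f (mirror x) = A + ((- 1) ^ length ys * C + (- 1) ^ length ys * B)"
    by (simp add: hochschild_def)
  have "(- 1) ^ length ys * ((- 1) ^ length ys * c) = (c :: complex)" for c
    by (simp flip: mult.assoc power_add)
  then show ?thesis unfolding 1 2 by (simp add: x(1) algebra_simps)
qed

lemma reduced_mirror: "reduced f \<Longrightarrow> reduced (\<lambda>z. f (mirror z))"
  unfolding reduced_def by (metis Zero_in_mirror list.set(1) empty_iff)

section \<open>Cycles whose product is idempotent\<close>

fun p_part :: "'i cuntz \<Rightarrow> 'i cuntz" where
  "p_part Zero = Zero"
| "p_part (PQ \<alpha> \<beta>) = PQ \<alpha> []"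

fun q_part :: "'i cuntz \<Rightarrow> 'i cuntz" where
  "q_part Zero = Zero"
| "q_part (PQ \<alpha> \<beta>) = PQ [] \<beta>"

lemma p_part_q_part [simp]: "p_part s * q_part s = s"
  by (cases s) auto

text \<open>The partial injections of \<open>cuntz_act\<close>, made to compose in reading order by
  \<open>star\<close>. Where \<open>stack_step\<close> resets the stack, this ends in
  \<open>None\<close>.\<close>

definition transport :: "'i list option \<Rightarrow> 'i cuntz \<Rightarrow> 'i list option" where
  "transport d s = Option.bind d (cuntz_act (star s))"

text \<open>
  If the product of a cyclic word is \<open>p\<^sub>\<delta> q\<^sub>\<delta>\<close>, transporting \<open>\<delta>\<close> around the word never fails.  A factor is
  tight if it consumes the whole of the transported string.  A canonical tight factor is chosen, but no
  choice is invariant under rotation; the subcomplex of words ending in a tight factor repairs this.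
\<close>

definition tight :: "'i list option \<Rightarrow> 'i cuntz \<Rightarrow> bool" where
  "tight d s \<longleftrightarrow> (\<exists>\<alpha> \<beta>. s = PQ \<alpha> \<beta> \<and> d = Some \<alpha>)"

fun transport_list :: "'i list option \<Rightarrow> 'i cuntz list \<Rightarrow> 'i list option" where
  "transport_list d [] = d"
| "transport_list d (s # ys) = transport_list (transport d s) ys"

fun insert_tight :: "'i list option \<Rightarrow> ('i cuntz list \<Rightarrow> complex) \<Rightarrow> 'i cuntz list \<Rightarrow> complex" where
  "insert_tight d f [] = 0"
| "insert_tight d f (s # ys) = (if tight d s then - f (p_part s # q_part s # ys) else - insert_tight (transport d s) (\<lambda>z. f (s # z)) ys)"

fun has_tight :: "'i list option \<Rightarrow> 'i cuntz list \<Rightarrow> bool" where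
  "has_tight d [] = False"
| "has_tight d (s # ys) \<longleftrightarrow> tight d s \<or> has_tight (transport d s) ys"

lemma transport_mult: "transport d (a * b) = transport (transport d a) b"
  by (cases d) (auto simp: transport_def star_mult cuntz_act_mult)

lemma transport_Some [simp]:
  "transport (Some \<delta>) (PQ \<alpha> \<beta>) = (if prefix \<alpha> \<delta> then Some (\<beta> @ drop (length \<alpha>) \<delta>) else None)"
  "transport d Zero = None" "transport None s = None"
  by (auto simp: transport_def) (cases d; simp add: transport_def)

lemma transport_list_None [simp]: "transport_list None x = None"
  by (induction x) auto

lemma transport_list_append: "transport_list d (xs @ ys) = transport_list (transport_list d xs) ys"
  by (induction xs arbitrary: d) auto

lemma tight_Some [simp]: "tight (Some \<delta>) (PQ \<alpha> \<beta>) \<longleftrightarrow> \<alpha> = \<delta>" "\<not> tight d Zero" "\<not> tight None s"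
  by (auto simp: tight_def)

text \<open>The p-part of a product stems from the factor that consumes the string, so cutting the
  product means cutting that factor and multiplying the other one on. This compatibility replaces
  the Leibniz rule.\<close>

lemma tight_mult:
  assumes "transport d (a * b) \<noteq> None"
  shows "tight d (a * b) \<longleftrightarrow> tight d a \<or> tight (transport d a) b"
    and "tight d a \<Longrightarrow> p_part (a * b) = p_part a \<and> q_part (a * b) = q_part a * b"
    and "tight (transport d a) b \<Longrightarrow> p_part (a * b) = a * p_part b \<and> q_part (a * b) = q_part b"
proof -
  obtain \<delta> where d: "d = Some \<delta>" using assms by (cases d) auto
  have nz: "a * b \<noteq> Zero" using assms by auto
  from nz have "(tight d (a * b) \<longleftrightarrow> tight d a \<or> tight (transport d a) b) \<and>
    (tight d a \<longrightarrow> p_part (a * b) = p_part a \<and> q_part (a * b) = q_part a * b) \<and>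
    (tight (transport d a) b \<longrightarrow> p_part (a * b) = a * p_part b \<and> q_part (a * b) = q_part b)"
    by (cases rule: PQ_mult_cases) (use assms d in \<open>auto simp: prefix_def split: if_splits\<close>)
  then show "tight d (a * b) \<longleftrightarrow> tight d a \<or> tight (transport d a) b"
    "tight d a \<Longrightarrow> p_part (a * b) = p_part a \<and> q_part (a * b) = q_part a * b"
    "tight (transport d a) b \<Longrightarrow> p_part (a * b) = a * p_part b \<and> q_part (a * b) = q_part b" by auto
qed

lemma insert_tight_minus: "insert_tight d (\<lambda>z. - f z) x = - insert_tight d f x"
  by (induction x arbitrary: d f) auto

lemma insert_tight_diff: "insert_tight d (\<lambda>z. f z - g z) x = insert_tight d f x - insert_tight d g x"
  by (induction x arbitrary: d f g) auto

lemma insert_tight_cong: "(\<And>z. length z = Suc (length x) \<Longrightarrow> f z = g z) \<Longrightarrow> insert_tight d f x = insert_tight d g x"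
proof (induction x arbitrary: d f g)
  case (Cons a x)
  show ?case using Cons.IH[of "\<lambda>z. f (a # z)" "\<lambda>z. g (a # z)"] Cons.prems by simp
qed simp

text \<open>As for \<open>bar_insert_cuts\<close>, but the first tight factor is the only cut, so
  the coefficient is 1 and no division is called for.\<close>

lemma bar_insert_tight:
  "transport_list d x \<noteq> None \<Longrightarrow> bar (insert_tight d f) x + insert_tight d (bar f) x = (if has_tight d x then f x else 0)"
proof (induction f x arbitrary: d rule: bar.induct)
  case (3 f a b ys)
  let ?fa = "\<lambda>z. f (a # z)"
  have alive: "transport d (a * b) \<noteq> None" using "3.prems" by (cases "transport (transport d a) b") (auto simp: transport_mult)
  note tm = tight_mult[OF alive]
  show ?case
  proof (cases "tight d a")
    case True
    have "bar (\<lambda>z. insert_tight d f (a # z)) (b # ys) = - bar (\<lambda>z. f (p_part a # q_part a # z)) (b # ys)"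
      using True by (simp add: bar_minus del: bar.simps)
    moreover have "insert_tight d f (a * b # ys) = - f (p_part a # q_part a * b # ys)"
      using True tm by simp
    moreover have "insert_tight d (bar f) (a # b # ys) = f (a # b # ys) - f (p_part a # q_part a * b # ys)
        - bar (\<lambda>z. f (p_part a # q_part a # z)) (b # ys)"
      using True by simp
    ultimately show ?thesis using True bar.simps(3)[of "insert_tight d f" a b ys] by simp
  next
    case False
    have IH: "bar (insert_tight (transport d a) ?fa) (b # ys) + insert_tight (transport d a) (bar ?fa) (b # ys)
        = (if has_tight (transport d a) (b # ys) then f (a # b # ys) else 0)"
      using "3.IH"[of "transport d a"] "3.prems" by simp
    have 1: "bar (\<lambda>z. insert_tight d f (a # z)) (b # ys) = - bar (insert_tight (transport d a) ?fa) (b # ys)"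
      using False by (simp add: bar_minus del: bar.simps)
    have 2: "insert_tight d (bar f) (a # b # ys) = insert_tight (transport d a) (\<lambda>z. f (a * hd z # tl z)) (b # ys)
        + insert_tight (transport d a) (bar ?fa) (b # ys)"
    proof -
      have "insert_tight (transport d a) (\<lambda>z. bar f (a # z)) (b # ys)
          = insert_tight (transport d a) (\<lambda>z. - f (a * hd z # tl z) - bar ?fa z) (b # ys)"
        by (rule insert_tight_cong) (subst bar_Cons, auto)
      then show ?thesis using False unfolding insert_tight_diff insert_tight_minus by (simp del: bar.simps)
    qed
    have 3: "insert_tight d f (a * b # ys) = insert_tight (transport d a) (\<lambda>z. f (a * hd z # tl z)) (b # ys)"
      using False tm by (simp add: transport_mult)
    show ?thesis using IH False unfolding bar.simps(3)[of "insert_tight d f"] 1 2 3 by (simp del: bar.simps)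
  qed
qed auto

lemma insert_tight_snoc: "\<not> tight (transport_list d zs) l \<Longrightarrow> insert_tight d f (zs @ [l]) = insert_tight d (\<lambda>z. f (z @ [l])) zs"
  by (induction zs arbitrary: d f) auto

lemma insert_tight_eq_0:
  "(\<And>us s vs. x = us @ s # vs \<Longrightarrow> f (us @ p_part s # q_part s # vs) = 0) \<Longrightarrow> insert_tight d f x = 0"
proof (induction x arbitrary: d f)
  case (Cons a x)
  have "f (p_part a # q_part a # x) = 0" using Cons.prems[of "[]"] by simp
  moreover have "insert_tight (transport d a) (\<lambda>z. f (a # z)) x = 0"
    by (rule Cons.IH) (metis Cons.prems append_Cons)
  ultimately show ?case by simp
qed simp

lemma norm_insert_tight_le:
  assumes "\<And>z. length z = Suc (length x) \<Longrightarrow> norm (f z) \<le> K" "K \<ge> 0"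
  shows "norm (insert_tight d f x) \<le> K"
  using assms by (induction x arbitrary: d f) auto

lemma transport_list_prod: "x \<noteq> [] \<Longrightarrow> transport_list d x = transport d (prod_list x)"
proof (induction x arbitrary: d)
  case (Cons a x)
  then show ?case by (cases "x = []") (auto simp: transport_mult)
qed simp

lemma has_tight_prod: "x \<noteq> [] \<Longrightarrow> transport_list d x \<noteq> None \<Longrightarrow> has_tight d x \<longleftrightarrow> tight d (prod_list x)"
proof (induction x arbitrary: d)
  case (Cons a x)
  show ?case
  proof (cases "x = []")
    case False
    then show ?thesis
      using Cons tight_mult(1)[of d a "prod_list x"] transport_list_prod[of "a # x" d] by simp
  qed simp
qed simp

text \<open>Rotation turns the idempotent into another one, whose string is the old one transported
  through the factor that moved.\<close>

lemma idempotent_type_rotate: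
  assumes "s * t = PQ \<delta> \<delta>"
  obtains \<delta>' where "t * s = PQ \<delta>' \<delta>'" "transport (Some \<delta>) s = Some \<delta>'"
proof -
  have "s * t \<noteq> Zero" using assms by simp
  then show thesis
    by (cases rule: PQ_mult_cases) (use assms that in auto)
qed

lemma mult_PQ_right:
  assumes "u * PQ \<alpha> \<beta> = PQ \<gamma> \<delta>"
  shows "prefix \<beta> \<delta>"
proof -
  have "u * PQ \<alpha> \<beta> \<noteq> Zero" using assms by simp
  then show ?thesis by (cases rule: PQ_mult_cases) (use assms in auto)
qed

text \<open>Transporting \<delta> once around returns \<delta>; the last factor consumes all of the
  string that reaches it exactly if its q-part is the whole of \<delta>.\<close>

definition last_tight :: "'i cuntz list \<Rightarrow> bool" where
  "last_tight x \<longleftrightarrow> (\<exists>\<alpha> \<delta>. last x = PQ \<alpha> \<delta> \<and> prod_list x = PQ \<delta> \<delta>)"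

text \<open>Here the choice of the first tight factor breaks: a tight first entry is absorbed into
  the last one by the wrap-around face. That face, however, lies in the subcomplex of words ending
  in a tight factor.\<close>

lemma last_tight_mult_last:
  assumes "prod_list (PQ \<delta> \<beta> # ys) = PQ \<delta> \<delta>" "ys \<noteq> []"
  shows "last_tight (mult_last (PQ \<delta> \<beta>) ys)"
proof -
  let ?a = "PQ \<delta> \<beta>"
  obtain zs l where ys: "ys = zs @ [l]" using assms(2) by (cases ys rule: rev_cases) auto
  from idempotent_type_rotate[of ?a "prod_list ys" \<delta>] assms(1) obtain \<delta>' where
    \<delta>': "prod_list ys * ?a = PQ \<delta>' \<delta>'" "transport (Some \<delta>) ?a = Some \<delta>'" by auto
  then have \<delta>'': "\<delta>' = \<beta>" by simp
  have p: "prod_list (mult_last ?a ys) = PQ \<beta> \<beta>" using \<delta>' \<delta>'' by (simp add: ys mult.assoc)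
  have "l * ?a \<noteq> Zero" using p by (auto simp: ys)
  then obtain \<alpha> \<rho> where la: "l * ?a = PQ \<alpha> \<rho>" by (cases "l * ?a") auto
  have "prefix \<beta> \<rho>" using mult_PQ_right[OF la] .
  moreover have "prefix \<rho> \<beta>" using p mult_PQ_right[of "prod_list zs" \<alpha> \<rho> \<beta> \<beta>] by (simp add: ys la)
  ultimately have "\<rho> = \<beta>" using prefix_order.antisym by blast
  then show ?thesis using p la by (auto simp: last_tight_def ys)
qed

text \<open>The p-part of \<open>a\<close> is a prefix of \<delta>, so multiplying by
  \<open>a\<close> only changes the q-part of the last entry, from \<delta> to the transported
  string.\<close>

lemma last_tight_wrap:
  assumes "last_tight (a # ws @ [l])"
  shows "last_tight (ws @ [l * a])" "p_part (l * a) = p_part l" "q_part (l * a) = q_part l * a"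
proof -
  obtain \<alpha> \<delta> where l: "l = PQ \<alpha> \<delta>" and p: "prod_list (a # ws @ [l]) = PQ \<delta> \<delta>"
    using assms by (auto simp: last_tight_def)
  from idempotent_type_rotate[of a "prod_list (ws @ [l])" \<delta>] p obtain \<delta>' where
    \<delta>': "prod_list (ws @ [l]) * a = PQ \<delta>' \<delta>'" "transport (Some \<delta>) a = Some \<delta>'" by auto
  obtain \<gamma> \<kappa> where g: "a = PQ \<gamma> \<kappa>" using \<delta>'(2) by (cases a) auto
  then have la: "l * a = PQ \<alpha> \<delta>'" using \<delta>'(2) by (auto simp: l split: if_splits)
  then show "last_tight (ws @ [l * a])" using \<delta>'(1) by (auto simp: last_tight_def mult.assoc)
  show "p_part (l * a) = p_part l" using la l by simp
  show "q_part (l * a) = q_part l * a" using g \<delta>'(2) by (auto simp: l split: if_splits)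
qed

lemma last_tight_merge_last:
  assumes "last_tight (us @ [a, l])"
  shows "last_tight (us @ [a * l])" "p_part (a * l) = a * p_part l" "q_part (a * l) = q_part l"
proof -
  obtain \<alpha> \<delta> where l: "l = PQ \<alpha> \<delta>" and p: "prod_list (us @ [a, l]) = PQ \<delta> \<delta>"
    using assms by (auto simp: last_tight_def)
  have nz: "a * l \<noteq> Zero" using p by auto
  then obtain \<rho> \<rho>' where al: "a * l = PQ \<rho> \<rho>'" by (cases "a * l") auto
  have "prefix \<delta> \<rho>'" using mult_PQ_right al by (auto simp: l)
  moreover have "prefix \<rho>' \<delta>"
    using p mult_PQ_right[of "prod_list us" \<rho> \<rho>' \<delta> \<delta>] by (simp add: al flip: mult.assoc)
  ultimately have r: "\<rho>' = \<delta>" using prefix_order.antisym by blast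
  have "p_part (a * l) = a * p_part l \<and> q_part (a * l) = q_part l"
    using nz by (cases rule: PQ_mult_cases) (use r al l in \<open>auto split: if_splits\<close>)
  then show "p_part (a * l) = a * p_part l" "q_part (a * l) = q_part l" by auto
  show "last_tight (us @ [a * l])" using p al r by (auto simp: last_tight_def mult.assoc)
qed

lemma last_tight_merge:
  assumes "last_tight (us @ a # b # vs)"
  shows "last_tight (us @ (a * b) # vs)"
  using assms last_tight_merge_last(1)[of us a b] by (cases "vs = []") (auto simp: last_tight_def mult.assoc)

text \<open>For cocycles, cutting the last entry is a contraction on any set of words that is closed
  under faces and on which the cut commutes with them: merging the pieces returns the word, the
  other terms cancel. It is used for words ending in a tight factor and for words ending in
  zero.\<close>

lemma hochschild_insert_last:
  fixes f :: "'i cuntz list \<Rightarrow> complex"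
  assumes tight: "L x" and len: "length x \<ge> 2"
    and wrap: "\<And>a ws l. L (a # ws @ [l]) \<Longrightarrow> L (ws @ [l * a]) \<and> p_part (l * a) = p_part l \<and> q_part (l * a) = q_part l * a"
    and merge_last: "\<And>us a l. L (us @ [a, l]) \<Longrightarrow> L (us @ [a * l]) \<and> p_part (a * l) = a * p_part l \<and> q_part (a * l) = q_part l"
    and merge: "\<And>us a b vs. L (us @ a # b # vs) \<Longrightarrow> L (us @ (a * b) # vs)"
    and cocycle: "\<And>z. length z = length x + 1 \<Longrightarrow> hochschild f z = 0"
  shows "hochschild (\<lambda>z. if L z then (- 1) ^ length z * f (butlast z @ [p_part (last z), q_part (last z)]) else 0) x = f x"
    (is "hochschild ?g x = _")
proof -
  obtain us a l where x: "x = us @ [a, l]"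
    using len by (cases x rule: rev_cases; cases "butlast x" rule: rev_cases) auto
  let ?h = "\<lambda>z. (- 1) ^ Suc (length us) * f (z @ [p_part l, q_part l])"
  have 1: "?g (mult_last (hd x) (tl x)) = (- 1) ^ Suc (length us) * f (mult_last (hd x) (tl (us @ [a]) @ [p_part l, q_part l]))"
  proof -
    obtain b ws where b: "us @ [a] = b # ws" by (cases us) auto
    have xb: "x = b # ws @ [l]" using b by (simp add: x)
    note wrap[OF tight[unfolded xb]]
    moreover have "mult_last b (ws @ [p_part l, q_part l]) = ws @ [p_part l, q_part l * b]" by (simp add: mult_last_append)
    moreover have "length ws = length us" using arg_cong[OF b, of length] by simp
    moreover have "hd (us @ [a]) = b" "hd x = b" "tl (us @ [a]) = ws" using b xb by simp_all
    ultimately show ?thesis by (simp add: xb)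
  qed
  have 2: "bar (\<lambda>z. ?g (z @ [l])) (us @ [a]) = (- 1) ^ Suc (length us) * bar (\<lambda>z. f (z @ [p_part l, q_part l])) (us @ [a])"
    unfolding bar_cmult[symmetric]
  proof (rule bar_cong_merge)
    fix vs c d ws assume *: "us @ [a] = vs @ c # d # ws"
    have "x = vs @ c # d # ws @ [l]" unfolding x using arg_cong[OF *, of "\<lambda>z. z @ [l]"] by simp
    then have "L ((vs @ c * d # ws) @ [l])"
      using merge[of vs c d "ws @ [l]"] tight by simp
    moreover have "length us = Suc (length vs + length ws)" using arg_cong[OF *, of length] by simp
    ultimately show "?g ((vs @ c * d # ws) @ [l]) = ?h (vs @ c * d # ws)" by (simp add: butlast_append)
  qed
  have 3: "?g (us @ [a * l]) = (- 1) ^ Suc (length us) * f (us @ [a * p_part l, q_part l])"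
    using merge_last[OF tight[unfolded x]] by simp
  have "hochschild f (us @ [a, p_part l, q_part l]) = 0" by (rule cocycle) (simp add: x)
  then have "f (mult_last (hd x) (tl (us @ [a]) @ [p_part l, q_part l])) + bar f (us @ [a, p_part l, q_part l]) = 0"
    by (cases us) (auto simp: hochschild_def x)
  then have 4: "bar f (us @ [a, p_part l, q_part l]) = - f (mult_last (hd x) (tl (us @ [a]) @ [p_part l, q_part l]))"
    by (simp add: eq_neg_iff_add_eq_0 add.commute)
  have 5: "bar f (us @ [a, p_part l, q_part l]) = bar (\<lambda>z. f (z @ [p_part l, q_part l])) (us @ [a])
     + (- 1) ^ Suc (length us) * f (us @ [a * p_part l, q_part l]) - (- 1) ^ Suc (length us) * f x"
    using bar_snoc[of f "us @ [a]" "p_part l" "q_part l"] bar_snoc[of "\<lambda>z. f (z @ [q_part l])" us a "p_part l"]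
    by (simp add: x)
  have s: "(- 1) ^ n * ((- 1) ^ n * c) = (c :: complex)" for n c
    by (simp flip: mult.assoc power_add)
  have "hochschild ?g x = (- 1) ^ Suc (length us) * (f (mult_last (hd x) (tl (us @ [a]) @ [p_part l, q_part l]))
      + bar (\<lambda>z. f (z @ [p_part l, q_part l])) (us @ [a])) + (- 1) ^ Suc (length us) * ((- 1) ^ Suc (length us) * f (us @ [a * p_part l, q_part l]))"
    unfolding hochschild_def 1 unfolding x bar_snoc 2 3 by (simp add: algebra_simps)
  also have "\<dots> = (- 1) ^ Suc (length us) * (f (mult_last (hd x) (tl (us @ [a]) @ [p_part l, q_part l])) + bar f (us @ [a, p_part l, q_part l]))
      + (- 1) ^ Suc (length us) * ((- 1) ^ Suc (length us) * f x)"
    unfolding 5 by (simp only: distrib_left right_diff_distrib) (simp add: algebra_simps)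
  also have "\<dots> = f x" unfolding 4 s by simp
  finally show ?thesis .
qed

lemma norm_bar_le:
  assumes "\<And>z. length z + 1 = length x \<Longrightarrow> norm (g z) \<le> B"
  shows "norm (bar g x) \<le> real (length x - 1) * B"
  using assms
proof (induction g x rule: bar.induct)
  case (3 g a b xs)
  have "norm (bar g (a # b # xs)) \<le> norm (g (a * b # xs)) + norm (bar (\<lambda>z. g (a # z)) (b # xs))"
    using norm_triangle_ineq4[of "- g (a * b # xs)" "bar (\<lambda>z. g (a # z)) (b # xs)"] by (simp del: bar.simps add: bar.simps(3))
  also have "\<dots> \<le> B + real (length (b # xs) - 1) * B"
    by (intro add_mono "3.prems" "3.IH") auto
  finally show ?case by (simp add: algebra_simps del: bar.simps)
qed auto

lemma norm_hochschild_le: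
  assumes "\<And>z. length z + 1 = length x \<Longrightarrow> norm (g z) \<le> B" "x \<noteq> []"
  shows "norm (hochschild g x) \<le> real (length x) * B"
proof -
  have "norm (hochschild g x) \<le> norm (g (mult_last (hd x) (tl x))) + norm (bar g x)"
    unfolding hochschild_def by (rule norm_triangle_ineq)
  also have "\<dots> \<le> B + real (length x - 1) * B"
    by (intro add_mono norm_bar_le assms(1)) (use assms(2) in auto)
  also have "\<dots> = real (length x) * B"
    using assms(2) by (cases x) (auto simp: algebra_simps)
  finally show ?thesis .
qed

definition idempotent_type :: "'i cuntz list \<Rightarrow> bool" where
  "idempotent_type x \<longleftrightarrow> (\<exists>\<delta>. prod_list x = PQ \<delta> \<delta>)"

lemma idempotent_type_mult_last:
  assumes "ys \<noteq> []"
  shows "idempotent_type (mult_last a ys) \<longleftrightarrow> idempotent_type (a # ys)"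
proof -
  have "prod_list (mult_last a ys) = prod_list ys * a"
    using assms by (cases ys rule: rev_cases) (auto simp: mult.assoc)
  then show ?thesis
    unfolding idempotent_type_def by (metis idempotent_type_rotate prod_list.Cons)
qed

lemma idempotent_type_merge: "idempotent_type (us @ (a * b) # vs) \<longleftrightarrow> idempotent_type (us @ a # b # vs)"
  by (simp add: idempotent_type_def mult.assoc)

lemma last_tight_insert:
  assumes "last_tight (us @ s # vs)"
  shows "last_tight (us @ p_part s # q_part s # vs)"
proof -
  have "prod_list (us @ p_part s # q_part s # vs) = prod_list (us @ s # vs)"
    by (simp flip: mult.assoc)
  with assms show ?thesis
    by (cases "vs = []") (auto simp: last_tight_def)
qed

text \<open>Since \<open>f\<close> vanishes on words ending in a tight factor, the jump of the first
  tight factor under rotation does no harm. If the first entry is tight, the terms that would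
  disagree end in a tight factor; if neither the first nor the last entry is tight, the cut lies
  strictly between them and rotation does not affect it.\<close>

lemma hochschild_insert_first:
  assumes len: "length x \<ge> 2" and cocycle: "\<And>z. length z = length x + 1 \<Longrightarrow> hochschild f z = 0"
    and van: "\<And>z. length z = length x \<Longrightarrow> last_tight z \<Longrightarrow> f z = 0"
    and g: "\<And>z. g z = (if idempotent_type z then insert_tight (Some (THE \<delta>. prod_list z = PQ \<delta> \<delta>)) f z else 0)"
  shows "hochschild g x = (if idempotent_type x then f x else 0)"
proof -
  obtain a ys where x: "x = a # ys" "ys \<noteq> []" using len by (cases x; cases "tl x") auto
  have g': "g z = insert_tight (Some \<delta>) f z" if "prod_list z = PQ \<delta> \<delta>" for z \<delta>
    using that by (auto simp: g idempotent_type_def)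
  show ?thesis
  proof (cases "idempotent_type x")
    case False
    have "g (mult_last a ys) = 0" using False idempotent_type_mult_last[OF x(2)] by (simp add: g x(1))
    moreover have "bar g x = bar (\<lambda>_. 0) x"
      by (rule bar_cong_merge) (use False in \<open>auto simp: g idempotent_type_merge\<close>)
    ultimately show ?thesis using False by (simp add: hochschild_def x(1))
  next
    case True
    then obtain \<delta> where p: "prod_list x = PQ \<delta> \<delta>" by (auto simp: idempotent_type_def)
    from idempotent_type_rotate[of a "prod_list ys" \<delta>] p x(1) obtain \<delta>' where
      \<delta>': "prod_list ys * a = PQ \<delta>' \<delta>'" "transport (Some \<delta>) a = Some \<delta>'" by auto
    obtain zs l where ys: "ys = zs @ [l]" using x(2) by (cases ys rule: rev_cases) auto
    have stack_run: "transport_list (Some \<delta>) x = Some \<delta>" using transport_list_prod[of x "Some \<delta>"] p x(1) by simp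
    have "has_tight (Some \<delta>) x" using has_tight_prod[of x "Some \<delta>"] stack_run p x(1) by simp
    then have b: "bar (insert_tight (Some \<delta>) f) x + insert_tight (Some \<delta>) (bar f) x = f x"
      using bar_insert_tight[of "Some \<delta>" x f] stack_run by simp
    have "insert_tight (Some \<delta>) (bar f) x = insert_tight (Some \<delta>) (\<lambda>z. - f (mult_last (hd z) (tl z))) x"
    proof (rule insert_tight_cong)
      fix z :: "'a cuntz list" assume "length z = Suc (length x)"
      then have "hochschild f z = 0" using cocycle by simp
      then show "bar f z = - f (mult_last (hd z) (tl z))" by (simp add: hochschild_def eq_neg_iff_add_eq_0 add.commute)
    qed
    then have w: "insert_tight (Some \<delta>) (bar f) x = - insert_tight (Some \<delta>) (\<lambda>z. f (mult_last (hd z) (tl z))) x"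
      by (simp only: insert_tight_minus)
    have bg: "bar g x = bar (insert_tight (Some \<delta>) f) x"
      by (rule bar_cong_merge, rule g') (use p in \<open>simp add: mult.assoc\<close>)
    have pl: "prod_list (mult_last a ys) = PQ \<delta>' \<delta>'" using \<delta>' by (simp add: ys mult.assoc)
    have wg: "g (mult_last a ys) = insert_tight (Some \<delta>') f (mult_last a ys)" by (rule g'[OF pl])
    \<comment> \<open>Cutting keeps a word in the subcomplex, where \<open>f\<close>
      vanishes.\<close>
    have ins0: "insert_tight d f z = 0" if "last_tight z" "length z + 1 = length x" for d z
      by (rule insert_tight_eq_0, rule van) (use that last_tight_insert in auto)
    have "g (mult_last a ys) = - insert_tight (Some \<delta>) (\<lambda>z. f (mult_last (hd z) (tl z))) x" if nt: "\<not> last_tight x"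
    proof (cases "tight (Some \<delta>) a")
      case True
      then obtain \<beta> where a: "a = PQ \<delta> \<beta>" by (auto simp: tight_def)
      have "last_tight (mult_last a ys)"
        using last_tight_mult_last[of \<delta> \<beta> ys] p x by (simp add: a)
      then have "g (mult_last a ys) = 0" unfolding wg by (rule ins0) (simp add: x(1))
      moreover have "last_tight (mult_last (PQ \<delta> []) (q_part a # ys))"
        by (rule last_tight_mult_last) (use p in \<open>simp_all add: x(1) a flip: mult.assoc\<close>)
      then have "f (mult_last (p_part a) (q_part a # ys)) = 0" by (intro van) (simp_all add: x(1) a)
      ultimately show ?thesis using True by (simp add: x(1))
    next
      case False
      \<comment> \<open>The string arriving at the last entry; if that entry consumed all of it,
        \<open>x\<close> would end in a tight factor.\<close>
      define e where "e = transport_list (Some \<delta>') zs"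
      have e: "transport e l = Some \<delta>" using stack_run \<delta>'(2) by (simp add: x(1) ys transport_list_append e_def)
      have nl: "\<not> tight e l"
      proof
        assume "tight e l"
        then obtain \<alpha> \<beta> where "l = PQ \<alpha> \<beta>" "e = Some \<alpha>" by (auto simp: tight_def)
        then have "l = PQ \<alpha> \<delta>" using e by simp
        then show False using nt p by (auto simp: last_tight_def x(1) ys)
      qed
      have "transport e (l * a) \<noteq> None" using e \<delta>'(2) by (simp add: transport_mult)
      from tight_mult(1)[OF this] have nla: "\<not> tight e (l * a)" using nl e False by simp
      have "insert_tight (Some \<delta>') f (zs @ [l * a]) = insert_tight (Some \<delta>') (\<lambda>z. f (z @ [l * a])) zs"
        by (rule insert_tight_snoc) (use nla e_def in simp)
      then have "g (mult_last a ys) = insert_tight (Some \<delta>') (\<lambda>z. f (z @ [l * a])) zs"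
        using wg by (simp add: ys)
      moreover have "insert_tight (Some \<delta>') (\<lambda>z. f (mult_last a z)) ys = insert_tight (Some \<delta>') (\<lambda>z. f (z @ [l * a])) zs"
        unfolding ys by (subst insert_tight_snoc) (use nl e_def in auto)
      ultimately show ?thesis using False \<delta>'(2) by (simp add: x(1))
    qed
    moreover have "g (mult_last a ys) = 0 \<and> bar g x = 0 \<and> f x = 0" if lt: "last_tight x"
    proof (intro conjI)
      show "g (mult_last a ys) = 0"
        unfolding wg using last_tight_wrap(1)[of a zs l] lt by (intro ins0) (simp_all add: x(1) ys)
      show "f x = 0" by (rule van) (simp_all add: lt)
      have "bar g x = bar (\<lambda>_. 0) x"
      proof (rule bar_cong_merge)
        fix us b c vs assume *: "x = us @ b # c # vs"
        have "g (us @ (b * c) # vs) = insert_tight (Some \<delta>) f (us @ (b * c) # vs)"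
          by (rule g') (use p * in \<open>simp add: mult.assoc\<close>)
        also have "\<dots> = 0" by (rule ins0) (use last_tight_merge lt * in auto)
        finally show "g (us @ (b * c) # vs) = 0" .
      qed
      then show "bar g x = 0" by simp
    qed
    ultimately show ?thesis using True b w bg by (cases "last_tight x") (auto simp: hochschild_def x(1))
  qed
qed

lemma not_idempotent_type_Zero: "Zero \<in> set x \<Longrightarrow> \<not> idempotent_type x"
proof -
  assume "Zero \<in> set x"
  then have "prod_list x = Zero" by (induction x) auto
  then show ?thesis by (simp add: idempotent_type_def)
qed

text \<open>\<open>g1\<close> solves the equation on words ending in a tight factor; the remainder
  \<open>f1\<close> vanishes there and \<open>g2\<close> treats it. Restricting to idempotent
  products commutes with all faces and makes \<open>g\<close> reduced.\<close>

theorem idempotent_type_part: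
  fixes f :: "'i cuntz list \<Rightarrow> complex"
  assumes cocycle: "\<And>z. length z = n + 2 \<Longrightarrow> hochschild f z = 0" and n: "n \<ge> 1"
    and bound: "\<And>x. length x = n + 1 \<Longrightarrow> norm (f x) \<le> K"
  obtains g K' where "reduced g" "\<And>x. length x = n \<Longrightarrow> norm (g x) \<le> K'"
    "\<And>x. length x = n + 1 \<Longrightarrow> hochschild g x = (if idempotent_type x then f x else 0)"
proof
  define g1 where "g1 z = (if last_tight z then (- 1) ^ length z * f (butlast z @ [p_part (last z), q_part (last z)]) else 0)" for z
  define f1 where "f1 z = f z - hochschild g1 z" for z
  define g2 where "g2 z = (if idempotent_type z then insert_tight (Some (THE \<delta>. prod_list z = PQ \<delta> \<delta>)) f1 z else 0)" for z
  define g where "g z = (if idempotent_type z then g1 z + g2 z else 0)" for z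
  have K: "K \<ge> 0" by (rule order_trans[OF norm_ge_zero bound[of "replicate (n + 1) 1"]]) simp
  have b1: "norm (g1 z) \<le> K" if "length z = n" for z
    using that n K by (auto simp: g1_def norm_mult norm_power intro!: bound)
  have b2: "norm (f1 z) \<le> K + real (n + 1) * K" if "length z = n + 1" for z
  proof -
    have "norm (hochschild g1 z) \<le> real (length z) * K" by (rule norm_hochschild_le) (use that b1 in auto)
    then show ?thesis unfolding f1_def using that bound[OF that] by (intro order_trans[OF norm_triangle_ineq4] add_mono) auto
  qed
  show "norm (g z) \<le> K + (K + real (n + 1) * K)" if "length z = n" for z
  proof -
    have "norm (g2 z) \<le> K + real (n + 1) * K"
      unfolding g2_def using that K b2 by (auto intro!: norm_insert_tight_le)
    from norm_triangle_mono[OF b1[OF that] this] show ?thesis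
      unfolding g_def using K by simp
  qed
  show "reduced g" by (auto simp: reduced_def g_def not_idempotent_type_Zero)
  show "hochschild g x = (if idempotent_type x then f x else 0)" if len: "length x = n + 1" for x
  proof -
    have g1: "hochschild g1 z = f z" if "length z = n + 1" "last_tight z" for z
      unfolding g1_def[abs_def] by (rule hochschild_insert_last) (use that n cocycle last_tight_wrap last_tight_merge_last last_tight_merge in auto)
    have c1: "hochschild f1 z = 0" if "length z = n + 2" for z
      using hochschild_hochschild[of z g1] cocycle[OF that] that n unfolding f1_def[abs_def] by (simp add: hochschild_diff)
    have g2: "hochschild g2 x = (if idempotent_type x then f1 x else 0)"
    proof (rule hochschild_insert_first)
      show "f1 z = 0" if "length z = length x" "last_tight z" for z
        using g1 that len by (simp add: f1_def)
    qed (use len n c1 g2_def in auto)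
    have lt: "last_tight z \<Longrightarrow> idempotent_type z" for z :: "'i cuntz list" by (auto simp: last_tight_def idempotent_type_def)
    obtain a ys where x: "x = a # ys" "ys \<noteq> []" using len n by (cases x; cases "tl x") auto
    have "hochschild g x = (if idempotent_type x then hochschild (\<lambda>z. g1 z + g2 z) x else 0)"
    proof -
      let ?c = "if idempotent_type x then 1 else 0 :: complex"
      have "g (mult_last a ys) = ?c * (g1 (mult_last a ys) + g2 (mult_last a ys))"
        using idempotent_type_mult_last[OF x(2), of a] by (auto simp: g_def x(1))
      moreover have "bar g x = bar (\<lambda>z. ?c * (g1 z + g2 z)) x"
        by (rule bar_cong_merge) (auto simp: g_def idempotent_type_merge)
      ultimately show ?thesis by (cases "idempotent_type x") (auto simp: hochschild_def x(1) bar_cmult)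
    qed
    then show ?thesis by (simp add: hochschild_add g2 f1_def)
  qed
qed

section \<open>The three kinds of words and the vanishing of reduced cocycles\<close>

fun deg :: "'i cuntz \<Rightarrow> int" where
  "deg Zero = 0"
| "deg (PQ \<alpha> \<beta>) = int (length \<alpha>) - int (length \<beta>)"

lemma deg_mult: "a * b \<noteq> Zero \<Longrightarrow> deg (a * b) = deg a + deg b"
  by (erule PQ_mult_cases) auto

lemma prod_list_mirror: "prod_list (mirror (ys @ [l])) = star (l * prod_list ys)"
proof -
  have "prod_list (map star (rev ys)) = star (prod_list ys)"
    by (induction ys) (auto simp: star_mult)
  then show ?thesis by (simp add: star_mult)
qed

text \<open>Without cuts in \<open>x\<close> the product has degree at most 0; without cuts in the
  mirror the rotated product has degree at least 0. Both are nonzero and rotation preserves the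
  degree, so it is 0 and the product is idempotent.\<close>

lemma trichotomy:
  assumes "Zero \<notin> set x" "x \<noteq> []"
  shows "idempotent_type x \<longleftrightarrow> \<not> has_cut x \<and> \<not> has_cut (mirror x)"
proof -
  obtain ys l where x: "x = ys @ [l]" using assms(2) by (cases x rule: rev_cases) auto
  have no: "\<not> has_cut z" if i: "idempotent_type z" for z :: "'a cuntz list"
  proof
    assume "has_cut z"
    then obtain d where d: "stationary z d" by (auto simp: has_cut_def)
    obtain \<delta> where p: "prod_list z = PQ \<delta> \<delta>" using i by (auto simp: idempotent_type_def)
    have "stack_step d (PQ \<delta> \<delta>) = d" "special d (PQ \<delta> \<delta>) \<noteq> {}"
      using d stack_run_prod[of z d] p by (auto simp: stationary_def simp del: special.simps)
    moreover from this(1) have "prefix \<delta> d" by (auto split: if_splits)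
    ultimately show False by (auto dest: prefix_order.trans[OF take_is_prefix])
  qed
  show ?thesis
  proof
    assume i: "idempotent_type x"
    then obtain \<delta> where p: "prod_list ys * l = PQ \<delta> \<delta>" by (auto simp: idempotent_type_def x)
    from idempotent_type_rotate[OF p] have "idempotent_type (mirror x)" by (metis idempotent_type_def prod_list_mirror star.simps(2) x)
    with no i show "\<not> has_cut x \<and> \<not> has_cut (mirror x)" by blast
  next
    assume ng: "\<not> has_cut x \<and> \<not> has_cut (mirror x)"
    obtain \<gamma> \<kappa> where 1: "prod_list x = PQ \<gamma> (\<gamma> @ \<kappa>)" using not_has_cut assms ng by blast
    obtain \<alpha> \<beta> where "prod_list (mirror x) = PQ \<alpha> (\<alpha> @ \<beta>)"
      using not_has_cut[of "mirror x"] Zero_in_mirror assms ng by metis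
    then have 2: "l * prod_list ys = PQ (\<alpha> @ \<beta>) \<alpha>"
      unfolding x prod_list_mirror by (metis star.simps(2) star_star)
    have "deg (prod_list ys * l) = deg (l * prod_list ys)"
      using deg_mult[of l "prod_list ys"] deg_mult[of "prod_list ys" l] 1 2 by (simp add: x)
    then have "\<kappa> = []" using 1 2 by (simp add: x)
    then show "idempotent_type x" using 1 by (simp add: idempotent_type_def)
  qed
qed

theorem reduced_cocycle_coboundary:
  fixes f :: "'i cuntz list \<Rightarrow> complex"
  assumes f: "reduced f" and cocycle: "\<And>z. length z = n + 2 \<Longrightarrow> hochschild f z = 0" and n: "n \<ge> 1"
    and bound: "\<And>x. length x = n + 1 \<Longrightarrow> norm (f x) \<le> K"
    and one: "n = 1 \<Longrightarrow> (\<And>s. f [s, 1] = 0)"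
  obtains g K' where "reduced g" "\<And>x. length x = n \<Longrightarrow> norm (g x) \<le> K'"
    "\<And>x. length x = n + 1 \<Longrightarrow> hochschild g x = f x"
proof -
  let ?fr = "\<lambda>z. f (mirror z)"
  obtain g1 where g1: "reduced g1" "\<And>x. length x = n \<Longrightarrow> norm (g1 x) \<le> 2 * K"
    "\<And>x. length x = n + 1 \<Longrightarrow> Zero \<notin> set x \<Longrightarrow> hochschild g1 x = (if has_cut x then f x else 0)"
    using has_cut_part[OF f cocycle n bound one] by blast
  have c2: "hochschild ?fr z = 0" if "length z = n + 2" for z
  proof -
    have "length (mirror z) = n + 2" using that by (subst length_mirror) auto
    then show ?thesis using hochschild_mirror[of z f] cocycle that by simp
  qed
  have b2: "norm (?fr x) \<le> K" if "length x = n + 1" for x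
    by (rule bound) (use that in \<open>subst length_mirror; auto\<close>)
  have o2: "?fr [s, 1] = 0" if "n = 1" for s
    using one[OF that, of "star s"] by (simp add: mirror_def)
  obtain g2 where g2: "reduced g2" "\<And>x. length x = n \<Longrightarrow> norm (g2 x) \<le> 2 * K"
    "\<And>x. length x = n + 1 \<Longrightarrow> Zero \<notin> set x \<Longrightarrow> hochschild g2 x = (if has_cut x then ?fr x else 0)"
    using has_cut_part[OF reduced_mirror[OF f] c2 n b2 o2] by blast
  obtain g3 K3 where g3: "reduced g3" "\<And>x. length x = n \<Longrightarrow> norm (g3 x) \<le> K3"
    "\<And>x. length x = n + 1 \<Longrightarrow> hochschild g3 x = (if idempotent_type x then f x else 0)"
    using idempotent_type_part[OF cocycle n bound] by blast
  \<comment> \<open>Words with unmatched letters of both kinds are already served by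
    \<open>g1\<close>, hence the restriction; the factor is the sign of
    \<open>hochschild_mirror\<close>.\<close>
  define h where "h z = (if \<not> has_cut z then (- 1) ^ n * g2 (mirror z) else 0)" for z
  have rh: "reduced (\<lambda>z. (- 1) ^ n * g2 (mirror z))"
    using reduced_mirror[OF g2(1)] by (auto simp: reduced_def)
  then have h: "reduced h" by (auto simp: reduced_def h_def)
  have fi: "face_inv (\<lambda>z. \<not> has_cut z)" using face_inv_has_cut by (auto simp: face_inv_def)
  have dh: "hochschild h x = (if \<not> has_cut x \<and> has_cut (mirror x) then f x else 0)"
    if "length x = n + 1" "Zero \<notin> set x" for x
  proof -
    have ne: "x \<noteq> []" using that by auto
    have "hochschild h x = (if \<not> has_cut x then (- 1) ^ n * hochschild (\<lambda>z. g2 (mirror z)) x else 0)"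
      unfolding h_def[abs_def] using hochschild_face_inv[OF rh fi, of x] that n by (simp add: hochschild_cmult)
    also have "(- 1) ^ n * hochschild (\<lambda>z. g2 (mirror z)) x = hochschild g2 (mirror x)"
      using hochschild_mirror[of x g2] that n by (simp flip: mult.assoc power_add)
    also have "\<dots> = (if has_cut (mirror x) then f x else 0)"
      using g2(3)[of "mirror x"] that ne by (simp add: length_mirror Zero_in_mirror mirror_mirror)
    finally show ?thesis by simp
  qed
  show thesis
  proof
    let ?g = "\<lambda>z. g1 z + h z + g3 z"
    show red: "reduced ?g" using g1(1) h g3(1) by (auto simp: reduced_def)
    have K: "K \<ge> 0" by (rule order_trans[OF norm_ge_zero bound[of "replicate (n + 1) 1"]]) simp
    show "norm (?g x) \<le> 2 * K + 2 * K + K3" if "length x = n" for x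
    proof -
      have "length (mirror x) = n" using that n by (subst length_mirror) auto
      then have "norm (h x) \<le> 2 * K" using g2(2) K by (auto simp: h_def norm_mult norm_power)
      then show ?thesis using g1(2)[OF that] g3(2)[OF that]
        by (intro order_trans[OF norm_triangle_ineq] add_mono) auto
    qed
    show "hochschild ?g x = f x" if len: "length x = n + 1" for x
    proof (cases "Zero \<in> set x")
      case True
      then show ?thesis using hochschild_reduced[OF red True] len n by (simp add: reducedD[OF f])
    next
      case False
      have "idempotent_type x \<longleftrightarrow> \<not> has_cut x \<and> \<not> has_cut (mirror x)" using len by (intro trichotomy False) auto
      then show ?thesis using g1(3)[OF len False] dh[OF len False] g3(3)[OF len] by (auto simp: hochschild_add)
    qed
  qed
qed

section \<open>Lists containing the zero\<close>

lemma bar_split: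
  "bar h (us @ c # ys) = bar (\<lambda>z. h (z @ ys)) (us @ [c]) + (- 1) ^ length us * bar (\<lambda>z. h (us @ z)) (c # ys)"
proof (induction us arbitrary: h)
  case (Cons a us)
  show ?case
  proof (cases us)
    case Nil
    then show ?thesis by simp
  next
    case (Cons b ws)
    then show ?thesis using Cons.IH[of "\<lambda>z. h (a # z)"] by (simp add: algebra_simps)
  qed
qed simp

text \<open>A zero in the last place counts for every \<open>j\<close>, because the wrap-around face
  moves a leading zero there.\<close>

definition zero_upto :: "nat \<Rightarrow> 'i cuntz list \<Rightarrow> bool" where
  "zero_upto j x \<longleftrightarrow> x \<noteq> [] \<and> (last x = Zero \<or> Zero \<in> set (take j x))"

lemma zero_upto_append: "length us \<le> j \<Longrightarrow> Zero \<in> set us \<Longrightarrow> zero_upto j (us @ vs)"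
  by (auto simp: zero_upto_def)

lemma zero_upto_cases:
  assumes "zero_upto j x"
  obtains ys where "x = ys @ [Zero]" | us vs where "x = us @ Zero # vs" "length us < j"
proof -
  consider "last x = Zero" "x \<noteq> []" | "Zero \<in> set (take j x)" using assms by (auto simp: zero_upto_def)
  then show thesis
  proof cases
    case 1 then show thesis using that(1)[of "butlast x"] by (metis append_butlast_last_id)
  next
    case 2
    then obtain us ws where *: "take j x = us @ Zero # ws" by (meson split_list)
    have "length us < length (take j x)" unfolding * by simp
    then have "length us < j" by simp
    moreover have "x = us @ Zero # ws @ drop j x" using * by (metis append.assoc append_Cons append_take_drop_id)
    ultimately show thesis using that(2) by blast
  qed
qed

lemma zero_upto_at: "length us < j \<Longrightarrow> zero_upto j (us @ Zero # vs)"
  using zero_upto_append[of "us @ [Zero]" j vs] by simp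

lemma zero_upto_mult_last:
  assumes "zero_upto j (a # ys)" "ys \<noteq> []"
  shows "zero_upto j (mult_last a ys)"
  using assms(1)
proof (cases rule: zero_upto_cases)
  case (1 zs)
  then show ?thesis using assms(2) by (cases ys rule: rev_cases) (auto simp: zero_upto_def)
next
  case (2 us vs)
  show ?thesis
  proof (cases us)
    case Nil
    then show ?thesis using 2 assms(2) by (cases ys rule: rev_cases) (auto simp: zero_upto_def)
  next
    case (Cons b ws)
    then have ys: "ys = ws @ Zero # vs" "length ws < j" using 2 by auto
    show ?thesis
    proof (cases "vs = []")
      case False
      then have "mult_last a ys = ws @ Zero # mult_last a vs" by (simp add: ys mult_last_append mult_last_Cons)
      then show ?thesis using zero_upto_at ys by metis
    qed (simp add: ys zero_upto_def)
  qed
qed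

lemma zero_upto_merge:
  assumes "zero_upto j (us @ a # b # vs)"
  shows "zero_upto j (us @ (a * b) # vs)"
proof -
  consider "last (us @ a # b # vs) = Zero" | "Zero \<in> set (take j (us @ a # b # vs))"
    using assms by (auto simp: zero_upto_def)
  then show ?thesis
  proof cases
    case 1
    then show ?thesis by (auto simp: zero_upto_def split: if_splits)
  next
    case 2
    then have "Zero \<in> set (take j (us @ (a * b) # vs))"
      by (cases "j \<le> length us"; cases "j - length us"; cases "j - length us - 1") (use set_take_subset_set_take[of "j - length us - 2" "Suc (j - length us - 2)" vs] in \<open>auto dest: in_set_takeD simp: take_Cons' split: if_splits\<close>)
    then show ?thesis by (auto simp: zero_upto_def)
  qed
qed

text \<open>
  Once lists ending in the zero are dealt with, the position of the first zero can be treated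
  inductively, because every face of such a list has a zero at an earlier position or at the same one.
\<close>

lemma hochschild_zero_upto_Suc:
  fixes f :: "'i cuntz list \<Rightarrow> complex"
  assumes len: "length x = n + 1" and j: "j < n"
    and cocycle: "\<And>z. length z = n + 2 \<Longrightarrow> hochschild f z = 0"
    and van: "\<And>z. length z = n + 1 \<Longrightarrow> zero_upto j z \<Longrightarrow> f z = 0"
    and x: "zero_upto (Suc j) x"
    and g: "\<And>z. g z = (if z ! j = Zero then (- 1) ^ Suc j * f (take j z @ Zero # Zero # drop (Suc j) z) else 0)"
  shows "hochschild g x = f x"
proof -
  have g0: "g z = 0" if "zero_upto j z" "length z = n" for z
  proof (cases "z ! j = Zero")
    case True
    have z: "z = take j z @ Zero # drop (Suc j) z"
      using True id_take_nth_drop[of j z] that j by simp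
    have "zero_upto j (take j z @ Zero # Zero # drop (Suc j) z)"
    proof (cases "last z = Zero")
      case True
      then show ?thesis using z by (cases "drop (Suc j) z = []") (auto simp: zero_upto_def)
    next
      case False
      then have "Zero \<in> set (take j z)" using that by (simp add: zero_upto_def)
      then show ?thesis by (intro zero_upto_append) auto
    qed
    then have "f (take j z @ Zero # Zero # drop (Suc j) z) = 0"
      by (rule van[rotated]) (use that j in simp)
    then show ?thesis by (simp add: g)
  qed (simp add: g)
  show ?thesis
  proof (cases "zero_upto j x")
    case True
    obtain a ys where xa: "x = a # ys" "ys \<noteq> []" using len j by (cases x; cases "tl x") auto
    have "g (mult_last a ys) = 0" using True xa len by (intro g0 zero_upto_mult_last) auto
    moreover have "bar g x = bar (\<lambda>_. 0) x"
      by (rule bar_cong_merge, rule g0, rule zero_upto_merge) (use True len in auto)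
    ultimately show ?thesis using van[OF len True] by (simp add: hochschild_def xa)
  next
    case False
    define us where "us = take j x"
    define vs where "vs = drop (Suc j) x"
    have "Zero \<in> set (take (Suc j) x)" "Zero \<notin> set (take j x)" using x False by (auto simp: zero_upto_def)
    then have "x ! j = Zero" using len j by (simp add: take_Suc_conv_app_nth)
    then have xu: "x = us @ Zero # vs" using id_take_nth_drop[of j x] len j by (simp add: us_def vs_def)
    have lu: "length us = j" using len j by (simp add: us_def)
    have vs: "vs \<noteq> []" using len j by (simp add: vs_def)
    define B where "B = bar (\<lambda>z. f (us @ Zero # z)) (Zero # vs)"
    have wg: "g (mult_last (hd x) (tl x)) = 0"
    proof (rule g0)
      show "zero_upto j (mult_last (hd x) (tl x))"
      proof (cases us)
        case Nil
        then show ?thesis using vs xu by (cases vs rule: rev_cases) (auto simp: zero_upto_def)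
      next
        case (Cons b ws)
        have "mult_last b (ws @ Zero # vs) = ws @ Zero # mult_last b vs" using vs by (simp add: mult_last_append mult_last_Cons)
        then show ?thesis using xu Cons lu zero_upto_at[of ws j] by simp
      qed
    qed (use len in simp)
    have bg: "bar g x = - B"
    proof -
      have "bar (\<lambda>z. g (z @ vs)) (us @ [Zero]) = bar (\<lambda>_. 0) (us @ [Zero])"
      proof (rule bar_cong_merge)
        fix us' a b vs' assume *: "us @ [Zero] = us' @ a # b # vs'"
        then have "Zero \<in> set (us' @ (a * b) # vs')" by (intro Zero_in_merge) (metis in_set_conv_decomp)
        moreover have "length (us' @ (a * b) # vs') = j" using arg_cong[OF *, of length] lu by simp
        ultimately show "g ((us' @ (a * b) # vs') @ vs) = 0"
          using len lu xu by (intro g0 zero_upto_append) auto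
      qed
      moreover have "bar (\<lambda>z. g (us @ z)) (Zero # vs) = (- 1) ^ Suc j * B"
        unfolding B_def bar_cmult[symmetric]
      proof (rule bar_cong_merge)
        fix us' a b vs' assume "Zero # vs = us' @ a # b # vs'"
        then obtain ws where "us' @ (a * b) # vs' = Zero # ws" by (cases us') auto
        then show "g (us @ us' @ (a * b) # vs') = (- 1) ^ Suc j * f (us @ Zero # us' @ (a * b) # vs')"
          using lu by (simp add: g nth_append)
      qed
      ultimately show ?thesis
        unfolding xu bar_split[of g] by (simp add: lu flip: power_add mult.assoc)
    qed
    \<comment> \<open>The zero is doubled: merging the copies returns \<open>x\<close>, the
      wrap-around face and the faces on the left fall under \<open>van\<close>, and those on the
      right form the sum \<open>B\<close> that also occurs in the differential of
      \<open>g\<close>.\<close>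
    let ?X = "us @ Zero # Zero # vs"
    have "hochschild f ?X = 0" by (rule cocycle) (use len xu in simp)
    moreover have "f (mult_last (hd ?X) (tl ?X)) = 0"
    proof (rule van)
      show "zero_upto j (mult_last (hd ?X) (tl ?X))"
      proof (cases us)
        case Nil
        then show ?thesis using vs by (cases vs rule: rev_cases) (auto simp: zero_upto_def mult_last_Cons)
      next
        case (Cons b ws)
        have "mult_last b (ws @ Zero # Zero # vs) = ws @ Zero # mult_last b (Zero # vs)" using vs by (simp add: mult_last_append mult_last_Cons)
        then show ?thesis using Cons lu zero_upto_at[of ws j] by simp
      qed
    qed (use len xu in simp)
    moreover have "bar f ?X = (- 1) ^ j * (- f x - B)"
    proof -
      have "bar (\<lambda>z. f (z @ Zero # vs)) (us @ [Zero]) = bar (\<lambda>_. 0) (us @ [Zero])"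
      proof (rule bar_cong_merge)
        fix us' a b vs' assume *: "us @ [Zero] = us' @ a # b # vs'"
        then have "Zero \<in> set (us' @ (a * b) # vs')" by (intro Zero_in_merge) (metis in_set_conv_decomp)
        moreover have "length (us' @ (a * b) # vs') = j" using arg_cong[OF *, of length] lu by simp
        ultimately show "f ((us' @ (a * b) # vs') @ Zero # vs) = 0"
          using len lu xu by (intro van zero_upto_append) auto
      qed
      then show ?thesis unfolding bar_split[of f] by (simp add: B_def lu xu)
    qed
    ultimately have "(- 1) ^ j * (- f x - B) = 0" by (simp add: hochschild_def)
    then have "- f x = B" by simp
    then have "f x = - B" by (metis minus_minus)
    then show ?thesis using wg bg by (simp add: hochschild_def)
  qed
qed

text \<open>Subtracting the coboundary of \<open>g\<close> makes a cocycle vanish on lists with a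
  zero, which reduces ell^1(S_m) to its quotient.\<close>

theorem zero_part:
  fixes f :: "'i cuntz list \<Rightarrow> complex"
  assumes cocycle: "\<And>z. length z = n + 2 \<Longrightarrow> hochschild f z = 0" and n: "n \<ge> 1"
    and bound: "\<And>x. length x = n + 1 \<Longrightarrow> norm (f x) \<le> K"
  obtains g K' where "\<And>x. length x = n \<Longrightarrow> norm (g x) \<le> K'"
    "\<And>x. length x = n + 1 \<Longrightarrow> Zero \<in> set x \<Longrightarrow> hochschild g x = f x"
proof -
  have K: "K \<ge> 0" by (rule order_trans[OF norm_ge_zero bound[of "replicate (n + 1) 1"]]) simp
  have "\<exists>g K'. (\<forall>x. length x = n \<longrightarrow> norm (g x) \<le> K') \<and> (\<forall>x. length x = n + 1 \<and> zero_upto j x \<longrightarrow> hochschild g x = f x)"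
    if "j \<le> n" for j
    using that
  proof (induction j)
    case 0
    define g where "g z = (if z \<noteq> [] \<and> last z = Zero then (- 1) ^ length z * f (butlast z @ [p_part (last z), q_part (last z)]) else 0)" for z
    have "norm (g z) \<le> K" if "length z = n" for z
      using that n K by (auto simp: g_def norm_mult norm_power intro!: bound)
    moreover have "hochschild g x = f x" if "length x = n + 1" "zero_upto 0 x" for x
      unfolding g_def[abs_def] by (rule hochschild_insert_last) (use that n cocycle in \<open>auto simp: zero_upto_def split: if_splits\<close>)
    ultimately show ?case by blast
  next
    case (Suc j)
    then obtain g K' where g: "\<And>x. length x = n \<Longrightarrow> norm (g x) \<le> K'"
      "\<And>x. length x = n + 1 \<Longrightarrow> zero_upto j x \<Longrightarrow> hochschild g x = f x" by auto
    define f1 where "f1 z = f z - hochschild g z" for z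
    define h where "h z = (if z ! j = Zero then (- 1) ^ Suc j * f1 (take j z @ Zero # Zero # drop (Suc j) z) else 0)" for z
    have K1: "norm (f1 z) \<le> K + real (n + 1) * K'" if "length z = n + 1" for z
    proof -
      have "norm (hochschild g z) \<le> real (length z) * K'" by (rule norm_hochschild_le) (use that g(1) in auto)
      then show ?thesis unfolding f1_def using that bound[OF that] by (intro order_trans[OF norm_triangle_ineq4] add_mono) auto
    qed
    then have K1': "K + real (n + 1) * K' \<ge> 0"
      using order_trans[OF norm_ge_zero K1[of "replicate (n + 1) 1"]] by simp
    have "norm (h z) \<le> K + real (n + 1) * K'" if "length z = n" for z
    proof -
      have "norm (f1 (take j z @ Zero # Zero # drop (Suc j) z)) \<le> K + real (n + 1) * K'"
        by (rule K1) (use that Suc.prems in simp)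
      then show ?thesis using K1' by (simp add: h_def norm_mult norm_power)
    qed
    then have "norm (g z + h z) \<le> K' + (K + real (n + 1) * K')" if "length z = n" for z
      using that g(1) by (intro norm_triangle_mono) auto
    moreover have c1: "hochschild f1 z = 0" if "length z = n + 2" for z
      using hochschild_hochschild[of z g] cocycle[OF that] that n unfolding f1_def[abs_def] by (simp add: hochschild_diff)
    have "hochschild h x = f1 x" if "length x = n + 1" "zero_upto (Suc j) x" for x
    proof (rule hochschild_zero_upto_Suc[OF that(1) _ c1 _ that(2) h_def])
      show "f1 z = 0" if "length z = n + 1" "zero_upto j z" for z
        using g(2)[OF that] by (simp add: f1_def)
    qed (use Suc.prems in auto)
    then have "hochschild (\<lambda>z. g z + h z) x = f x" if "length x = n + 1" "zero_upto (Suc j) x" for x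
      using that by (simp add: hochschild_add f1_def)
    ultimately show ?case
      by (intro exI[of _ "\<lambda>z. g z + h z"] exI[of _ "K' + (K + real (n + 1) * K')"]) blast
  qed
  from this[of n] obtain g K' where g: "\<And>x. length x = n \<Longrightarrow> norm (g x) \<le> K'"
    "\<And>x. length x = n + 1 \<Longrightarrow> zero_upto n x \<Longrightarrow> hochschild g x = f x" by auto
  moreover have "zero_upto n x" if len: "length x = n + 1" and z: "Zero \<in> set x" for x :: "'i cuntz list"
  proof -
    obtain ys l where x: "x = ys @ [l]" using len by (cases x rule: rev_cases) auto
    then show ?thesis using len z by (auto simp: zero_upto_def)
  qed
  ultimately show thesis using that by blast
qed

section \<open>Cocycles defined by traces\<close>

lemma has_cut_prod:
  assumes "has_cut x" "prod_list x = PQ \<gamma> \<kappa>"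
  shows "\<not> prefix \<gamma> \<kappa>"
proof
  obtain d where d: "stationary x d" using assms(1) by (auto simp: has_cut_def)
  have *: "stack_step d (PQ \<gamma> \<kappa>) = d" "special d (PQ \<gamma> \<kappa>) \<noteq> {}"
    using d stack_run_prod[of x d] assms(2) by (auto simp: stationary_def simp del: special.simps)
  from *(2) have "\<not> prefix \<gamma> d" by (auto dest: prefix_order.trans[OF take_is_prefix])
  moreover from this *(1) have "d = \<kappa>" by simp
  moreover assume "prefix \<gamma> \<kappa>"
  ultimately show False by simp
qed

text \<open>The number of special letters is additive on nonzero products, and \<open>t\<close>
  takes the same value on all rotations of a product; together this is the cocycle identity.\<close>

lemma trace_cocycle_has_cut:
  fixes t :: "'i cuntz \<Rightarrow> complex"
  assumes t0: "t Zero = 0" and tr: "\<And>a b. t (a * b) = t (b * a)" and bound: "\<And>s. norm (t s) \<le> K"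
  obtains f where "reduced f" "\<And>x. length x = 2 \<Longrightarrow> norm (f x) \<le> K" "\<And>x. length x = 3 \<Longrightarrow> hochschild f x = 0"
    "\<And>s. f [s, 1] = (if s \<noteq> Zero \<and> has_cut [s, 1] then t s else 0)"
proof
  define F where "F \<delta> x = (if length x = 2 then of_nat (card (special \<delta> (hd x))) * t (hd x * hd (tl x)) else 0)" for \<delta> x
  have F2: "F \<delta> [a, b] = of_nat (card (special \<delta> a)) * t (a * b)" for \<delta> a b by (simp add: F_def)
  have F: "reduced (F \<delta>)" for \<delta>
    unfolding reduced_def
  proof (intro allI impI)
    fix x :: "'i cuntz list" assume z: "Zero \<in> set x"
    show "F \<delta> x = 0"
    proof (cases "length x = 2")
      case True
      then obtain a b where "x = [a, b]" by (cases x; cases "tl x") auto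
      then show ?thesis using z t0 by (auto simp: F_def)
    qed (simp add: F_def)
  qed
  show "reduced (average F)" by (rule reduced_average)
  have K: "K \<ge> 0" using order_trans[OF norm_ge_zero bound] .
  show "norm (average F x) \<le> K" if len: "length x = 2" for x
  proof (cases "Zero \<in> set x \<or> \<not> has_cut x")
    case False
    obtain a b where x: "x = [a, b]" using len by (cases x; cases "tl x") auto
    from False obtain \<delta> where \<delta>: "Zero \<notin> set x" "stationary x \<delta>" by (auto simp: has_cut_def)
    let ?m = "card (special \<delta> a)" and ?N = "cut_count \<delta> x"
    have "?m \<le> ?N" by (simp add: x)
    have "norm (F \<delta> x) = real ?m * norm (t (a * b))" by (simp add: x F_def norm_mult)
    also have "\<dots> \<le> real ?N * K" using \<open>?m \<le> ?N\<close> by (intro mult_mono bound) auto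
    finally show ?thesis
      using \<delta>(2) unfolding average_eq[OF \<delta>] by (simp add: stationary_def norm_divide divide_le_eq mult.commute del: cut_count.simps)
  qed (use K in \<open>auto simp: average_def\<close>)
  show "average F [s, 1] = (if s \<noteq> Zero \<and> has_cut [s, 1] then t s else 0)" for s
  proof (cases "s \<noteq> Zero \<and> has_cut [s, 1]")
    case True
    then obtain \<delta> where \<delta>: "stationary [s, 1] \<delta>" by (auto simp: has_cut_def)
    \<comment> \<open>The unit has no letters, so all special letters lie in \<open>s\<close> and
      the weight is 1.\<close>
    have "special (stack_step \<delta> s) 1 = {}" by (auto simp: one_cuntz_def)
    moreover have "Zero \<notin> set [s, 1]" using True by (auto simp: one_cuntz_def)
    ultimately show ?thesis
      using True \<delta> average_eq[OF _ \<delta>, of F] by (auto simp: F_def stationary_def card_gt_0_iff)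
  qed (auto simp: average_def)
  show "hochschild (average F) x = 0" if len: "length x = 3" for x
  proof (cases "Zero \<in> set x")
    case True
    then show ?thesis using hochschild_reduced[OF reduced_average True] len by simp
  next
    case nz: False
    show ?thesis
    proof (cases "has_cut x")
      case False
      have "hochschild (average F) x = hochschild (\<lambda>z. if has_cut z then average F z else 0) x"
      proof (rule hochschild_cong)
        show "average F z = (if has_cut z then average F z else 0)" for z by (simp add: average_def)
      qed (use len in auto)
      then show ?thesis
        using hochschild_face_inv[OF reduced_average[of F] face_inv_has_cut, of x] len False by simp
    next
      case True
      obtain a b c where x: "x = [a, b, c]" using len by (cases x; cases "tl x"; cases "tl (tl x)") auto
      from True obtain \<delta> where \<delta>: "stationary (a # [b, c]) \<delta>" by (auto simp: has_cut_def x)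
      have t1: "t (b * (c * a)) = t (a * b * c)" by (metis mult.assoc tr)
      have "F (stack_step \<delta> a) (mult_last a [b, c]) + bar (F \<delta>) (a # [b, c]) =
         of_nat (card (special (stack_step \<delta> a) b)) * t (a * b * c)
         - of_nat (card (special \<delta> (a * b))) * t (a * b * c) + of_nat (card (special \<delta> a)) * t (a * b * c)"
        using t1 by (simp add: F2 mult.assoc)
      also have "\<dots> = 0"
        by (cases "a * b = Zero") (simp_all add: t0 card_special_mult algebra_simps)
      finally show ?thesis using hochschild_average[OF F _ _ \<delta>] nz x by simp
    qed
  qed
qed

text \<open>Cuts and mirrored cuts are served separately. At \<open>[s, 1]\<close> exactly one of
  them contributes unless \<open>t s = 0\<close>: an idempotent rotates to 1, where \<open>t\<close>
  vanishes, and if letters of both kinds are unmatched, s rotates to a zero product.\<close>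

theorem trace_cocycle:
  fixes t :: "'i cuntz \<Rightarrow> complex"
  assumes t0: "t Zero = 0" and tr: "\<And>a b. t (a * b) = t (b * a)" and t1: "t 1 = 0" and bound: "\<And>s. norm (t s) \<le> K"
  obtains f K' where "reduced f" "\<And>x. length x = 2 \<Longrightarrow> norm (f x) \<le> K'" "\<And>x. length x = 3 \<Longrightarrow> hochschild f x = 0"
    "\<And>s. f [s, 1] = t s"
proof -
  obtain f where f: "reduced f" "\<And>x. length x = 2 \<Longrightarrow> norm (f x) \<le> K" "\<And>x. length x = 3 \<Longrightarrow> hochschild f x = 0"
    "\<And>s. f [s, 1] = (if s \<noteq> Zero \<and> has_cut [s, 1] then t s else 0)"
    using trace_cocycle_has_cut[OF t0 tr bound] by blast
  have tr': "t (star (a * b)) = t (star (b * a))" for a b by (simp add: star_mult tr)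
  obtain g where g: "reduced g" "\<And>x. length x = 2 \<Longrightarrow> norm (g x) \<le> K" "\<And>x. length x = 3 \<Longrightarrow> hochschild g x = 0"
    "\<And>s. g [s, 1] = (if s \<noteq> Zero \<and> has_cut [s, 1] then t (star s) else 0)"
    using trace_cocycle_has_cut[of "\<lambda>s. t (star s)" K] t0 tr' bound by auto
  show thesis
  proof
    let ?h = "\<lambda>x. f x + g (mirror x)"
    show "reduced ?h" using f(1) reduced_mirror[OF g(1)] by (auto simp: reduced_def)
    show "norm (?h x) \<le> K + K" if "length x = 2" for x
    proof -
      have "length (mirror x) = 2" using that by (subst length_mirror) auto
      then show ?thesis by (intro norm_triangle_mono f(2) g(2) that)
    qed
    show "hochschild ?h x = 0" if "length x = 3" for x
    proof -
      have "length (mirror x) = 3" using that by (subst length_mirror) auto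
      then show ?thesis using hochschild_mirror[of x g] that f(3) g(3) by (simp add: hochschild_add)
    qed
    show "?h [s, 1] = t s" for s
    proof (cases s)
      case Zero
      then show ?thesis by (simp add: f(4) g(4) t0 mirror_def)
    next
      case (PQ \<alpha> \<beta>)
      have r: "mirror [s, 1] = [star s, 1]" by (simp add: mirror_def)
      have tri: "idempotent_type [s, 1] \<longleftrightarrow> \<not> has_cut [s, 1] \<and> \<not> has_cut [star s, 1]"
        using trichotomy[of "[s, 1]"] r by (simp add: PQ one_cuntz_def)
      have id: "t s = 0" if "idempotent_type [s, 1]"
      proof -
        have "s = PQ \<alpha> [] * PQ [] \<alpha>" using that PQ by (auto simp: idempotent_type_def)
        then have "t s = t (PQ [] \<alpha> * PQ \<alpha> [])" by (metis tr)
        then show ?thesis using t1 by (simp add: one_cuntz_def)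
      qed
      have both: "t s = 0" if "has_cut [s, 1]" "has_cut [star s, 1]"
      proof -
        have "\<not> prefix \<alpha> \<beta>" "\<not> prefix \<beta> \<alpha>"
          using has_cut_prod[OF that(1)] has_cut_prod[OF that(2)] PQ by auto
        moreover have "s = PQ \<alpha> [] * PQ [] \<beta>" using PQ by simp
        then have "t s = t (PQ [] \<beta> * PQ \<alpha> [])" by (metis tr)
        ultimately show ?thesis using t0 by simp
      qed
      show ?thesis using tri id both by (auto simp: f(4) g(4) r PQ[symmetric])
    qed
  qed
qed

section \<open>Multilinear forms determined on a basis\<close>

definition mlinear :: "nat \<Rightarrow> ('a::complex_banach_algebra list \<Rightarrow> complex) \<Rightarrow> bool" where
  "mlinear N f \<longleftrightarrow> (\<forall>us vs k a b. length us + length vs + 1 = N \<longrightarrow>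
     f (us @ (k *\<^sub>C a + b) # vs) = k * f (us @ a # vs) + f (us @ b # vs))"

lemma scaleC_one [simp]: "1 *\<^sub>C (x :: 'a::complex_banach_algebra) = x"
  using scaleR_scaleC[of 1 x] by simp

lemma mlinearD:
  "mlinear N f \<Longrightarrow> length us + length vs + 1 = N \<Longrightarrow>
     f (us @ (k *\<^sub>C a + b) # vs) = k * f (us @ a # vs) + f (us @ b # vs)"
  by (simp add: mlinear_def)

lemma mlinear_0:
  assumes "mlinear N f" "length us + length vs + 1 = N"
  shows "f (us @ 0 # vs) = 0"
  using mlinearD[OF assms, of 1 0 0] by simp

lemma cochains_iff:
  "\<phi> \<in> cochains n \<longleftrightarrow> (\<forall>as. length as \<noteq> n + 1 \<longrightarrow> \<phi> as = 0) \<and> mlinear (n + 1) \<phi> \<and>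
     (\<exists>K. \<forall>as. length as = n + 1 \<longrightarrow> cmod (\<phi> as) \<le> K * prod_list (map norm as))"
proof -
  have P: "(\<Prod>i<n + 1. norm (as ! i)) = prod_list (map norm as)" if "length as = n + 1" for as :: "'a list"
    using that by (simp add: prod.list_conv_set_nth atLeast0LessThan)
  have B: "(\<exists>K. \<forall>as. length as = n + 1 \<longrightarrow> cmod (\<phi> as) \<le> K * (\<Prod>i<n + 1. norm (as ! i))) \<longleftrightarrow>
    (\<exists>K. \<forall>as. length as = n + 1 \<longrightarrow> cmod (\<phi> as) \<le> K * prod_list (map norm as))"
    using P by metis
  have M: "mlinear (n + 1) \<phi> \<longleftrightarrow>
     (\<forall>as i a b. length as = n + 1 \<and> i < n + 1 \<longrightarrow> \<phi> (as[i := a + b]) = \<phi> (as[i := a]) + \<phi> (as[i := b])) \<and>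
     (\<forall>as i c a. length as = n + 1 \<and> i < n + 1 \<longrightarrow> \<phi> (as[i := c *\<^sub>C a]) = c * \<phi> (as[i := a]))" (is "_ \<longleftrightarrow> ?A \<and> ?S")
  proof
    assume m: "mlinear (n + 1) \<phi>"
    have u: "as[i := a] = take i as @ a # drop (Suc i) as" if "i < length as" for as :: "'a list" and i a
      using that by (rule upd_conv_take_nth_drop)
    show "?A \<and> ?S"
    proof (intro conjI allI impI)
      fix as :: "'a list" and i :: nat and a b :: 'a and c assume *: "length as = n + 1 \<and> i < n + 1"
      then have l: "length (take i as) + length (drop (Suc i) as) + 1 = n + 1" by simp
      show "\<phi> (as[i := a + b]) = \<phi> (as[i := a]) + \<phi> (as[i := b])"
        using mlinearD[OF m l, of 1 a b] * by (simp add: u)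
      show "\<phi> (as[i := c *\<^sub>C a]) = c * \<phi> (as[i := a])"
        using mlinearD[OF m l, of c a 0] mlinear_0[OF m l] * by (simp add: u)
    qed
  next
    assume AS: "?A \<and> ?S"
    show "mlinear (n + 1) \<phi>"
      unfolding mlinear_def
    proof (intro allI impI)
      fix us vs :: "'a list" and k and a b :: 'a assume *: "length us + length vs + 1 = n + 1"
      let ?as = "us @ 0 # vs"
      have u: "?as[length us := c] = us @ c # vs" for c by simp
      have l: "length ?as = n + 1 \<and> length us < n + 1" using * by simp
      have "\<phi> (?as[length us := k *\<^sub>C a + b]) = \<phi> (?as[length us := k *\<^sub>C a]) + \<phi> (?as[length us := b])"
        using AS l by blast
      moreover have "\<phi> (?as[length us := k *\<^sub>C a]) = k * \<phi> (?as[length us := a])" using AS l by blast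
      ultimately show "\<phi> (us @ (k *\<^sub>C a + b) # vs) = k * \<phi> (us @ a # vs) + \<phi> (us @ b # vs)"
        unfolding u by simp
    qed
  qed
  show ?thesis unfolding cochains_def mem_Collect_eq B M by blast
qed

lemma cochainsD:
  assumes "\<phi> \<in> cochains n"
  shows "length as \<noteq> n + 1 \<Longrightarrow> \<phi> as = 0" "mlinear (n + 1) \<phi>"
    and "\<exists>K\<ge>0. \<forall>as. length as = n + 1 \<longrightarrow> cmod (\<phi> as) \<le> K * prod_list (map norm as)"
proof -
  show "length as \<noteq> n + 1 \<Longrightarrow> \<phi> as = 0" "mlinear (n + 1) \<phi>" using assms by (auto simp: cochains_iff)
  obtain K where K: "\<And>as. length as = n + 1 \<Longrightarrow> cmod (\<phi> as) \<le> K * prod_list (map norm as)"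
    using assms by (auto simp: cochains_iff)
  have "K * prod_list (map norm as) \<le> \<bar>K\<bar> * prod_list (map norm as)" for as :: "'a list"
    by (intro mult_right_mono prod_list_nonneg) auto
  then show "\<exists>K\<ge>0. \<forall>as. length as = n + 1 \<longrightarrow> cmod (\<phi> as) \<le> K * prod_list (map norm as)"
    using K by (intro exI[of _ "\<bar>K\<bar>"]) (meson abs_ge_zero order_trans)
qed

lemma mlinear_lincomb:
  "mlinear N f \<Longrightarrow> mlinear N g \<Longrightarrow> mlinear N (\<lambda>z. c * f z + d * g z)"
  unfolding mlinear_def by (simp add: algebra_simps)

lemma cochains_lincomb:
  assumes "\<phi> \<in> cochains n" "\<psi> \<in> cochains n"
  shows "(\<lambda>z. c * \<phi> z + d * \<psi> z) \<in> cochains n"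
proof -
  obtain K where K: "\<And>as. length as = n + 1 \<Longrightarrow> cmod (\<phi> as) \<le> K * prod_list (map norm as)"
    using cochainsD(3)[OF assms(1)] by auto
  obtain L where L: "\<And>as. length as = n + 1 \<Longrightarrow> cmod (\<psi> as) \<le> L * prod_list (map norm as)"
    using cochainsD(3)[OF assms(2)] by auto
  have "cmod (c * \<phi> as + d * \<psi> as) \<le> (cmod c * K + cmod d * L) * prod_list (map norm as)" if "length as = n + 1" for as
  proof -
    have "cmod (c * \<phi> as + d * \<psi> as) \<le> cmod c * (K * prod_list (map norm as)) + cmod d * (L * prod_list (map norm as))"
      using K[OF that] L[OF that] by (intro norm_triangle_mono) (auto simp: norm_mult intro: mult_left_mono)
    then show ?thesis by (simp add: algebra_simps)
  qed
  then show ?thesis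
    using assms unfolding cochains_iff by (auto intro: mlinear_lincomb)
qed

lemma cochains_zero: "(\<lambda>_. 0) \<in> cochains n"
  by (auto simp: cochains_iff mlinear_def intro: exI[of _ 0])

lemma bar_eq_sum:
  "bar f as = (\<Sum>j = 1..<length as. (- 1) ^ j * f (take (j - 1) as @ [as ! (j - 1) * as ! j] @ drop (j + 1) as))"
proof (induction f as rule: bar.induct)
  case (3 f a b xs)
  let ?t = "\<lambda>as j. take (j - 1) as @ [as ! (j - 1) * as ! j] @ drop (j + 1) as"
  have "(\<Sum>j = 1..<length (a # b # xs). (- 1) ^ j * f (?t (a # b # xs) j))
      = - f (a * b # xs) + (\<Sum>j = Suc 1..<Suc (length (b # xs)). (- 1) ^ j * f (?t (a # b # xs) j))"
    by (subst sum.atLeast_Suc_lessThan) auto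
  also have "(\<Sum>j = Suc 1..<Suc (length (b # xs)). (- 1) ^ j * f (?t (a # b # xs) j))
      = (\<Sum>j = 1..<length (b # xs). (- 1) ^ Suc j * f (?t (a # b # xs) (Suc j)))"
    by (rule sum.shift_bounds_Suc_ivl)
  also have "\<dots> = (\<Sum>j = 1..<length (b # xs). - ((- 1) ^ j * f (a # ?t (b # xs) j)))"
  proof (rule sum.cong)
    fix j assume "j \<in> {1..<length (b # xs)}"
    then obtain i where "j = Suc i" by (cases j) auto
    then show "(- 1) ^ Suc j * f (?t (a # b # xs) (Suc j)) = - ((- 1) ^ j * f (a # ?t (b # xs) j))" by simp
  qed simp
  also have "\<dots> = - bar (\<lambda>z. f (a # z)) (b # xs)" unfolding 3 sum_negf ..
  finally show ?case by simp
qed auto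

lemma coboundary_eq: "length as = n + 2 \<Longrightarrow> coboundary n \<phi> as = hochschild \<phi> as"
proof -
  assume l: "length as = n + 2"
  then obtain a zs b where as: "as = a # zs @ [b]"
    by (cases as; cases "tl as" rule: rev_cases) auto
  have "{1..n + 1} = {1..<length as}" using l by auto
  then show ?thesis using l unfolding coboundary_def hochschild_def bar_eq_sum by (simp add: as)
qed

lemma coboundary_0: "length as \<noteq> n + 2 \<Longrightarrow> coboundary n \<phi> as = 0"
  by (simp add: coboundary_def)

lemma coboundary_lincomb:
  "coboundary n (\<lambda>z. c * \<phi> z + d * \<psi> z) = (\<lambda>z. c * coboundary n \<phi> z + d * coboundary n \<psi> z)"
proof
  fix z show "coboundary n (\<lambda>z. c * \<phi> z + d * \<psi> z) z = c * coboundary n \<phi> z + d * coboundary n \<psi> z"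
    by (cases "length z = n + 2") (simp_all add: coboundary_eq coboundary_0 hochschild_add hochschild_cmult)
qed

lemma bar_lincomb: "bar (\<lambda>z. k * f z + g z) x = k * bar f x + bar g x"
  by (simp add: bar_add bar_cmult)

lemma mlinear_hochschild:
  fixes f :: "'a::complex_banach_algebra list \<Rightarrow> complex"
  assumes "mlinear N f" "N \<ge> 1"
  shows "mlinear (Suc N) (hochschild f)"
  unfolding mlinear_def
proof (intro allI impI)
  fix us vs :: "'a list" and k and a b :: 'a
  assume len: "length us + length vs + 1 = Suc N"
  note L = mlinearD[OF assms(1)]
  let ?c = "k *\<^sub>C a + b"
  have dist: "?c * x = k *\<^sub>C (a * x) + b * x" "x * ?c = k *\<^sub>C (x * a) + x * b" for x
    by (simp_all add: distrib_left distrib_right mult_scaleC_left mult_scaleC_right)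
  let ?w = "\<lambda>x. f (mult_last (hd x) (tl x))"
  have w: "?w (us @ ?c # vs) = k * ?w (us @ a # vs) + ?w (us @ b # vs)"
  proof (cases us)
    case Nil
    then obtain zs l where "vs = zs @ [l]" using len assms(2) by (cases vs rule: rev_cases) auto
    then show ?thesis using Nil len L[of zs "[]"] by (simp add: dist)
  next
    case (Cons d ws)
    then show ?thesis
      using len L[of ws "[]"] L[of ws "mult_last d vs"]
      by (cases "vs = []") (auto simp: dist mult_last_append mult_last_Cons)
  qed
  have b1: "bar (\<lambda>z. f (z @ vs)) (us @ [?c]) = k * bar (\<lambda>z. f (z @ vs)) (us @ [a]) + bar (\<lambda>z. f (z @ vs)) (us @ [b])"
  proof (cases us rule: rev_cases)
    case (snoc ws d)
    have A: "bar (\<lambda>z. f (z @ ?c # vs)) us = bar (\<lambda>z. k * f (z @ a # vs) + f (z @ b # vs)) us"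
    proof (rule bar_cong_merge)
      fix us' x y vs' assume "us = us' @ x # y # vs'"
      then show "f ((us' @ x * y # vs') @ ?c # vs) = k * f ((us' @ x * y # vs') @ a # vs) + f ((us' @ x * y # vs') @ b # vs)"
        using len by (intro L) simp
    qed
    have B: "f (ws @ (d * ?c) # vs) = k * f (ws @ (d * a) # vs) + f (ws @ (d * b) # vs)"
      unfolding dist using len snoc by (intro L) simp
    have "bar (\<lambda>z. f (z @ vs)) (us @ [c]) = bar (\<lambda>z. f (z @ c # vs)) us
        + (- 1) ^ Suc (length ws) * f (ws @ (d * c) # vs)" for c
      using bar_snoc[of "\<lambda>z. f (z @ vs)" ws d c] snoc by simp
    note S = this
    show ?thesis unfolding S A B bar_lincomb by (simp add: distrib_left right_diff_distrib mult.left_commute)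
  qed simp
  have b2: "bar (\<lambda>z. f (us @ z)) (?c # vs) = k * bar (\<lambda>z. f (us @ z)) (a # vs) + bar (\<lambda>z. f (us @ z)) (b # vs)"
  proof (cases vs)
    case (Cons d ws)
    have A: "bar (\<lambda>z. f (us @ ?c # z)) vs = bar (\<lambda>z. k * f (us @ a # z) + f (us @ b # z)) vs"
    proof (rule bar_cong_merge)
      fix us' x y vs' assume "vs = us' @ x # y # vs'"
      then show "f (us @ ?c # us' @ x * y # vs') = k * f (us @ a # us' @ x * y # vs') + f (us @ b # us' @ x * y # vs')"
        using len by (intro L) simp
    qed
    have B: "f (us @ (?c * d) # ws) = k * f (us @ (a * d) # ws) + f (us @ (b * d) # ws)"
      unfolding dist using len Cons by (intro L) simp
    have S: "bar (\<lambda>z. f (us @ z)) (c # vs) = - f (us @ (c * d) # ws) - bar (\<lambda>z. f (us @ c # z)) vs" for c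
      by (simp add: Cons)
    show ?thesis unfolding S A B bar_lincomb by (simp add: right_diff_distrib)
  qed simp
  show "hochschild f (us @ ?c # vs) = k * hochschild f (us @ a # vs) + hochschild f (us @ b # vs)"
    unfolding hochschild_def w bar_split[of f] b1 b2 by (simp add: algebra_simps)
qed

lemma norm_bar_le_prod:
  fixes f :: "'a::complex_banach_algebra list \<Rightarrow> complex"
  assumes "\<And>z. length z + 1 = length x \<Longrightarrow> cmod (f z) \<le> K * prod_list (map norm z)" "K \<ge> 0"
  shows "cmod (bar f x) \<le> real (length x) * K * prod_list (map norm x)"
  using assms
proof (induction f x arbitrary: K rule: bar.induct)
  case (1 f) then show ?case by simp
next
  case (2 f a) then show ?case by simp
next
  case (3 f a b xs)
  let ?P = "prod_list (map norm xs)"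
  have P: "?P \<ge> 0" by (rule prod_list_nonneg) auto
  have "cmod (f (a * b # xs)) \<le> K * (norm (a * b) * ?P)" using "3.prems"(1)[of "a * b # xs"] by simp
  also have "\<dots> \<le> K * ((norm a * norm b) * ?P)"
    using P "3.prems"(2) by (intro mult_left_mono mult_right_mono norm_mult_ineq) auto
  finally have 1: "cmod (f (a * b # xs)) \<le> K * (norm a * (norm b * ?P))" by (simp add: mult.assoc)
  have 2: "cmod (bar (\<lambda>z. f (a # z)) (b # xs)) \<le> real (length (b # xs)) * (K * norm a) * prod_list (map norm (b # xs))"
  proof (rule "3.IH")
    show "cmod (f (a # z)) \<le> K * norm a * prod_list (map norm z)" if "length z + 1 = length (b # xs)" for z
      using "3.prems"(1)[of "a # z"] that by (simp add: mult.assoc)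
  qed (use "3.prems"(2) in simp)
  have "cmod (bar f (a # b # xs)) \<le> cmod (f (a * b # xs)) + cmod (bar (\<lambda>z. f (a # z)) (b # xs))"
    using norm_triangle_ineq4[of "- f (a * b # xs)" "bar (\<lambda>z. f (a # z)) (b # xs)"] by (simp del: bar.simps add: bar.simps(3))
  also have "\<dots> \<le> K * (norm a * (norm b * ?P)) + real (length (b # xs)) * (K * norm a) * prod_list (map norm (b # xs))"
    by (intro add_mono 1 2)
  also have "\<dots> = real (length (a # b # xs)) * K * prod_list (map norm (a # b # xs))"
    by (simp add: algebra_simps)
  finally show ?case .
qed

lemma prod_norm_mult_last:
  "ys \<noteq> [] \<Longrightarrow> prod_list (map norm (mult_last a ys)) \<le> norm a * prod_list (map norm ys)"
  for a :: "'a::complex_banach_algebra"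
proof -
  assume "ys \<noteq> []"
  then obtain zs l where ys: "ys = zs @ [l]" by (cases ys rule: rev_cases) auto
  have "prod_list (map norm zs) * norm (l * a) \<le> prod_list (map norm zs) * (norm l * norm a)"
    by (intro mult_left_mono norm_mult_ineq prod_list_nonneg) auto
  then show ?thesis by (simp add: ys ac_simps)
qed

lemma coboundary_cochains:
  assumes "\<phi> \<in> cochains n"
  shows "coboundary n \<phi> \<in> cochains (Suc n)"
  unfolding cochains_iff
proof (intro conjI allI impI)
  fix as :: "'a list" assume "length as \<noteq> Suc n + 1"
  then show "coboundary n \<phi> as = 0" by (simp add: coboundary_0)
next
  have "mlinear (Suc n + 1) (hochschild \<phi>)" using mlinear_hochschild[of "n + 1" \<phi>] cochainsD(2)[OF assms] by simp
  then show "mlinear (Suc n + 1) (coboundary n \<phi>)"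
    unfolding mlinear_def by (simp add: coboundary_eq)
next
  obtain K where K: "K \<ge> 0" "\<And>as. length as = n + 1 \<Longrightarrow> cmod (\<phi> as) \<le> K * prod_list (map norm as)"
    using cochainsD(3)[OF assms] by auto
  show "\<exists>K. \<forall>as. length as = Suc n + 1 \<longrightarrow> cmod (coboundary n \<phi> as) \<le> K * prod_list (map norm as)"
  proof (intro exI allI impI)
    fix as :: "'a list" assume l: "length as = Suc n + 1"
    then obtain a ys where as: "as = a # ys" "ys \<noteq> []" by (cases as; cases "tl as") auto
    have "cmod (\<phi> (mult_last a ys)) \<le> K * prod_list (map norm (mult_last a ys))" using l as by (intro K) simp
    also have "\<dots> \<le> K * (norm a * prod_list (map norm ys))" by (intro mult_left_mono prod_norm_mult_last as K)
    finally have 1: "cmod (\<phi> (mult_last a ys)) \<le> K * prod_list (map norm as)" by (simp add: as)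
    have 2: "cmod (bar \<phi> as) \<le> real (length as) * K * prod_list (map norm as)"
      by (rule norm_bar_le_prod) (use K l in auto)
    have "cmod (coboundary n \<phi> as) \<le> cmod (\<phi> (mult_last a ys)) + cmod (bar \<phi> as)"
      using l by (simp add: coboundary_eq hochschild_def norm_triangle_ineq as(1))
    also have "\<dots> \<le> K * prod_list (map norm as) + real (Suc n + 1) * K * prod_list (map norm as)"
      using 1 2 l by (intro add_mono) auto
    finally show "cmod (coboundary n \<phi> as) \<le> (K + real (Suc n + 1) * K) * prod_list (map norm as)"
      by (simp add: algebra_simps)
  qed
qed

text \<open>Applied to the quotient map and to its section \<open>reduced_rep\<close>, both linear
  and contractive.\<close>

lemma cochains_comp:
  fixes h :: "'b::complex_banach_algebra \<Rightarrow> 'a::complex_banach_algebra"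
  assumes \<phi>: "\<phi> \<in> cochains n" and h: "\<And>k a b. h (k *\<^sub>C a + b) = k *\<^sub>C h a + h b" "\<And>a. norm (h a) \<le> norm a"
  shows "(\<lambda>as. \<phi> (map h as)) \<in> cochains n"
proof -
  obtain K where K: "K \<ge> 0" "\<And>as. length as = n + 1 \<Longrightarrow> cmod (\<phi> as) \<le> K * prod_list (map norm as)"
    using cochainsD(3)[OF \<phi>] by auto
  have pl: "prod_list (map norm (map h as)) \<le> prod_list (map norm as)" for as
    by (induction as) (auto intro!: mult_mono h prod_list_nonneg)
  have "cmod (\<phi> (map h as)) \<le> K * prod_list (map norm as)" if "length as = n + 1" for as
    using K(2)[of "map h as"] mult_left_mono[OF pl K(1), of as] that by simp
  then show ?thesis
    using cochainsD(1,2)[OF \<phi>] unfolding cochains_iff by (auto simp: mlinear_def h)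
qed

section \<open>Extending functions from point masses\<close>

text \<open>As an iterated sum, the multilinear extension involves one summable series at a time,
  and its bound follows by recursion on the list.\<close>

fun extend :: "('s list \<Rightarrow> complex) \<Rightarrow> 's ell1 list \<Rightarrow> complex" where
  "extend f [] = f []"
| "extend f (a # as) = (\<Sum>\<^sub>\<infinity>s. coeff a s * extend (\<lambda>x. f (s # x)) as)"

lemma extend_bound:
  assumes "\<And>x. length x = length as \<Longrightarrow> cmod (f x) \<le> K"
  shows "cmod (extend f as) \<le> K * prod_list (map norm as)"
    and "as = a # bs \<Longrightarrow> (\<lambda>s. coeff a s * extend (\<lambda>x. f (s # x)) bs) summable_on UNIV"
proof -
  have s: "(\<lambda>s. cmod (coeff a s * e s)) summable_on UNIV \<and> (\<Sum>\<^sub>\<infinity>s. cmod (coeff a s * e s)) \<le> norm a * B"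
    if e: "\<And>s. cmod (e s) \<le> B" for a :: "'a ell1" and e B
  proof -
    have m: "(\<lambda>s. cmod (coeff a s) * B) summable_on UNIV"
      by (intro summable_on_cmult_left coeff_abs_summable)
    have le: "cmod (coeff a s * e s) \<le> cmod (coeff a s) * B" for s
      by (simp add: norm_mult mult_left_mono e)
    have 1: "(\<lambda>s. cmod (coeff a s * e s)) summable_on UNIV"
      by (rule summable_on_comparison_test[OF m]) (use le in auto)
    have "(\<Sum>\<^sub>\<infinity>s. cmod (coeff a s * e s)) \<le> (\<Sum>\<^sub>\<infinity>s. cmod (coeff a s) * B)"
      by (rule infsum_mono[OF 1 m le])
    then show ?thesis using 1 by (simp add: norm_ell1_def infsum_cmult_left')
  qed
  have *: "cmod (extend f as) \<le> K * prod_list (map norm as)"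
    if "\<And>x. length x = length as \<Longrightarrow> cmod (f x) \<le> K" for f and as :: "'a ell1 list"
    using that
  proof (induction as arbitrary: f)
    case (Cons a as)
    have e: "cmod (extend (\<lambda>x. f (s # x)) as) \<le> K * prod_list (map norm as)" for s
      by (rule Cons.IH) (simp add: Cons.prems)
    have "cmod (extend f (a # as)) \<le> (\<Sum>\<^sub>\<infinity>s. cmod (coeff a s * extend (\<lambda>x. f (s # x)) as))"
      unfolding extend.simps by (rule norm_infsum_bound) (rule conjunct1[OF s[OF e]])
    also have "\<dots> \<le> norm a * (K * prod_list (map norm as))" by (rule conjunct2[OF s[OF e]])
    finally show ?case by (simp add: algebra_simps)
  qed simp
  show "cmod (extend f as) \<le> K * prod_list (map norm as)" using * assms .
  show "(\<lambda>s. coeff a s * extend (\<lambda>x. f (s # x)) bs) summable_on UNIV" if "as = a # bs"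
  proof -
    have "cmod (extend (\<lambda>x. f (s # x)) bs) \<le> K * prod_list (map norm bs)" for s
      by (rule *) (simp add: assms that)
    from s[OF this] show ?thesis by (intro csummable_norm) (rule conjunct1)
  qed
qed

lemma extend_linear:
  assumes "\<And>x. length x = length us + length vs + 1 \<Longrightarrow> cmod (f x) \<le> K"
  shows "extend f (us @ (k *\<^sub>C a + b) # vs) = k * extend f (us @ a # vs) + extend f (us @ b # vs)"
  using assms
proof (induction us arbitrary: f)
  case Nil
  have sm: "(\<lambda>s. coeff c s * extend (\<lambda>x. f (s # x)) vs) summable_on UNIV" for c
    by (rule extend_bound(2)[of "c # vs" f K]) (auto simp: Nil)
  have "extend f ((k *\<^sub>C a + b) # vs)
     = (\<Sum>\<^sub>\<infinity>s. k * (coeff a s * extend (\<lambda>x. f (s # x)) vs) + coeff b s * extend (\<lambda>x. f (s # x)) vs)"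
    by (simp add: algebra_simps)
  also have "\<dots> = k * extend f (a # vs) + extend f (b # vs)"
    by (subst infsum_add) (auto intro: sm summable_on_cmult_right simp: infsum_cmult_right')
  finally show ?case by simp
next
  case (Cons u us)
  have sm: "(\<lambda>s. coeff u s * extend (\<lambda>x. f (s # x)) (us @ c # vs)) summable_on UNIV" for c
    by (rule extend_bound(2)[of "u # us @ c # vs" f K]) (auto simp: Cons.prems)
  have IH: "extend (\<lambda>x. f (s # x)) (us @ (k *\<^sub>C a + b) # vs)
      = k * extend (\<lambda>x. f (s # x)) (us @ a # vs) + extend (\<lambda>x. f (s # x)) (us @ b # vs)" for s
    by (rule Cons.IH) (simp add: Cons.prems)
  have "extend f ((u # us) @ (k *\<^sub>C a + b) # vs)
     = (\<Sum>\<^sub>\<infinity>s. k * (coeff u s * extend (\<lambda>x. f (s # x)) (us @ a # vs)) + coeff u s * extend (\<lambda>x. f (s # x)) (us @ b # vs))"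
    by (simp add: IH distrib_left mult.left_commute)
  also have "\<dots> = k * extend f ((u # us) @ a # vs) + extend f ((u # us) @ b # vs)"
    by (subst infsum_add) (auto intro: sm summable_on_cmult_right simp: infsum_cmult_right')
  finally show ?case .
qed

lemma extend_point: "extend f (map point xs) = f xs"
proof (induction xs arbitrary: f)
  case (Cons x xs)
  have "extend f (map point (x # xs)) = (\<Sum>\<^sub>\<infinity>s\<in>{x}. coeff (point x) s * extend (\<lambda>z. f (s # z)) (map point xs))"
    unfolding list.map extend.simps by (rule infsum_cong_neutral) auto
  then show ?case by (simp add: Cons)
qed simp

lemma extend_cochain:
  fixes f :: "'s::semigroup_mult list \<Rightarrow> complex"
  assumes "\<And>x. length x = n + 1 \<Longrightarrow> cmod (f x) \<le> K"
  shows "(\<lambda>as. if length as = n + 1 then extend f as else 0) \<in> cochains n"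
proof -
  have "mlinear (n + 1) (\<lambda>as. if length as = n + 1 then extend f as else 0)"
    unfolding mlinear_def
  proof (intro allI impI)
    fix us vs :: "'s ell1 list" and k a b assume l: "length us + length vs + 1 = n + 1"
    have "extend f (us @ (k *\<^sub>C a + b) # vs) = k * extend f (us @ a # vs) + extend f (us @ b # vs)"
      by (rule extend_linear[of _ _ _ K]) (use l assms in simp)
    then show "(if length (us @ (k *\<^sub>C a + b) # vs) = n + 1 then extend f (us @ (k *\<^sub>C a + b) # vs) else 0)
       = k * (if length (us @ a # vs) = n + 1 then extend f (us @ a # vs) else 0)
         + (if length (us @ b # vs) = n + 1 then extend f (us @ b # vs) else 0)" using l by simp
  qed
  moreover have "cmod (extend f as) \<le> K * prod_list (map norm as)" if "length as = n + 1" for as :: "'s ell1 list"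
    by (rule extend_bound(1)) (use that assms in simp)
  ultimately show ?thesis unfolding cochains_iff by auto
qed

text \<open>Finitely supported elements are dense in ell^1, and \<open>L\<close> vanishes on them by
  linearity.\<close>

lemma functional_determined_by_points:
  fixes L :: "'s::semigroup_mult ell1 \<Rightarrow> complex"
  assumes lin: "\<And>k a b. L (k *\<^sub>C a + b) = k * L a + L b" and bound: "\<And>a. cmod (L a) \<le> C * norm a"
    and pt: "\<And>s. L (point s) = 0"
  shows "L a = 0"
proof -
  have L0: "L 0 = 0" using lin[of 1 0 0] by simp
  have fin: "L (\<Sum>s\<in>F. coeff a s *\<^sub>C point s) = 0" if "finite F" for F
    using that by (induction F) (auto simp: L0 lin pt)
  have cf: "coeff (\<Sum>s\<in>F. coeff a s *\<^sub>C point s) x = (if x \<in> F then coeff a x else 0)" if "finite F" for F x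
    using that by (induction F) auto
  have key: "cmod (L a) \<le> \<bar>C\<bar> * e" if e: "e > 0" for e
  proof -
    have "((\<lambda>F. \<Sum>s\<in>F. cmod (coeff a s)) \<longlongrightarrow> norm a) (finite_subsets_at_top UNIV)"
      unfolding norm_ell1_def by (rule infsum_tendsto) (rule coeff_abs_summable)
    then have "\<forall>\<^sub>F F in finite_subsets_at_top UNIV. dist (\<Sum>s\<in>F. cmod (coeff a s)) (norm a) < e"
      using e by (rule tendstoD)
    then obtain F where F: "finite F" "dist (\<Sum>s\<in>F. cmod (coeff a s)) (norm a) < e"
      unfolding eventually_finite_subsets_at_top by blast
    define b where "b = (\<Sum>s\<in>F. coeff a s *\<^sub>C point s)"
    have cb: "coeff (a - b) x = (if x \<in> F then 0 else coeff a x)" for x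
      using cf[OF F(1)] by (simp add: b_def)
    have "norm (a - b) = (\<Sum>\<^sub>\<infinity>x\<in>UNIV - F. cmod (coeff a x))"
      unfolding norm_ell1_def by (rule infsum_cong_neutral) (auto simp: cb simp del: minus_ell1.rep_eq)
    also have "\<dots> = norm a - (\<Sum>s\<in>F. cmod (coeff a s))"
      unfolding norm_ell1_def using infsum_Diff[of "\<lambda>x. cmod (coeff a x)" UNIV F] F(1) coeff_abs_summable[of a] by simp
    finally have "norm (a - b) < e" using F(2) by (simp add: dist_real_def)
    have "L a = L (1 *\<^sub>C (a - b) + b)" by simp
    also have "\<dots> = L (a - b)" unfolding lin using fin[OF F(1)] by (simp add: b_def)
    finally have "cmod (L a) \<le> C * norm (a - b)" using bound by simp
    also have "\<dots> \<le> \<bar>C\<bar> * e" using \<open>norm (a - b) < e\<close> by (intro mult_mono) auto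
    finally show ?thesis .
  qed
  \<comment> \<open>The summand 1 in the denominator covers C = 0.\<close>
  have "cmod (L a) \<le> \<bar>C\<bar> * (e / (\<bar>C\<bar> + 1))" if "e > 0" for e
    by (rule key) (use that in \<open>simp add: add_nonneg_pos\<close>)
  moreover have "\<bar>C\<bar> * (e / (\<bar>C\<bar> + 1)) \<le> e" if "e > 0" for e
    using that by (simp add: divide_le_eq algebra_simps)
  ultimately have "cmod (L a) \<le> 0 + e" if "e > 0" for e
    using that by (metis add.left_neutral order_trans)
  then have "cmod (L a) \<le> 0" by (rule field_le_epsilon)
  then show ?thesis by simp
qed

text \<open>Point masses are replaced by arbitrary entries from left to right, one slot at a time,
  by the result for functionals.\<close>

lemma cochain_determined_by_points:
  fixes \<phi> :: "'s::semigroup_mult ell1 list \<Rightarrow> complex"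
  assumes \<phi>: "\<phi> \<in> cochains n" and pt: "\<And>xs. length xs = n + 1 \<Longrightarrow> \<phi> (map point xs) = 0"
  shows "\<phi> = (\<lambda>_. 0)"
proof
  fix as
  obtain K where K: "K \<ge> 0" "\<And>as. length as = n + 1 \<Longrightarrow> cmod (\<phi> as) \<le> K * prod_list (map norm as)"
    using cochainsD(3)[OF \<phi>] by auto
  have "\<phi> (us @ map point xs) = 0" if "length us + length xs = n + 1" for us xs
    using that
  proof (induction us arbitrary: xs rule: rev_induct)
    case Nil
    then show ?case using pt by simp
  next
    case (snoc a us)
    let ?L = "\<lambda>c. \<phi> (us @ c # map point xs)"
    have "?L a = 0"
    proof (rule functional_determined_by_points)
      show "?L (k *\<^sub>C a + b) = k * ?L a + ?L b" for k a b
        by (rule mlinearD[OF cochainsD(2)[OF \<phi>]]) (use snoc.prems in simp)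
      show "cmod (?L c) \<le> (K * prod_list (map norm us)) * norm c" for c
      proof -
        have "prod_list (map norm (map point xs)) = 1" by (induction xs) auto
        then show ?thesis using K(2)[of "us @ c # map point xs"] snoc.prems by (simp add: ac_simps)
      qed
      show "?L (point s) = 0" for s using snoc.IH[of "s # xs"] snoc.prems by simp
    qed
    then show ?case by simp
  qed
  from this[of as "[]"] show "\<phi> as = 0" using cochainsD(1)[OF \<phi>] by (cases "length as = n + 1") auto
qed

section \<open>Cohomology of algebras with a multiplicative basis\<close>

lemma vcoset_eqI:
  assumes add: "\<And>u v. u \<in> W \<Longrightarrow> v \<in> W \<Longrightarrow> (\<lambda>x. u x + v x) \<in> W"
    and scale: "\<And>c v. v \<in> W \<Longrightarrow> (\<lambda>x. c * v x) \<in> W"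
    and w: "(\<lambda>x. u x - v x) \<in> W"
  shows "vcoset W u = vcoset W v"
proof -
  have sub: "vcoset W u \<subseteq> vcoset W v" if "(\<lambda>x. u x - v x) \<in> W" for u v
  proof
    fix z assume "z \<in> vcoset W u"
    then obtain y where y: "y \<in> W" "z = (\<lambda>x. u x + y x)" by (auto simp: vcoset_def)
    have "(\<lambda>x. (u x - v x) + y x) \<in> W" by (rule add[OF that y(1)])
    then show "z \<in> vcoset W v"
      unfolding vcoset_def y(2) by (intro CollectI exI[of _ "\<lambda>x. (u x - v x) + y x"]) auto
  qed
  have "(\<lambda>x. - 1 * (u x - v x)) \<in> W" by (rule scale[OF w])
  then have "(\<lambda>x. v x - u x) \<in> W" by simp
  then show ?thesis using sub w by blast
qed

lemma vcoset_eqD: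
  assumes "(\<lambda>_. 0) \<in> W" "vcoset W u = vcoset W v"
  shows "(\<lambda>x. u x - v x) \<in> W"
proof -
  have "u \<in> vcoset W u" unfolding vcoset_def using assms(1) by force
  then obtain y where "y \<in> W" "u = (\<lambda>x. v x + y x)" using assms(2) by (auto simp: vcoset_def)
  then show ?thesis by simp
qed

text \<open>The first isomorphism theorem: \<open>L\<close> has kernel \<open>W\<close> and image
  \<open>U\<close> and so induces the required map on cosets.\<close>

lemma quotient_isomorphicI:
  fixes V :: "('x \<Rightarrow> complex) set" and W :: "('x \<Rightarrow> complex) set" and L :: "('x \<Rightarrow> complex) \<Rightarrow> 'y \<Rightarrow> complex"
  assumes V: "\<And>c d u v. u \<in> V \<Longrightarrow> v \<in> V \<Longrightarrow> (\<lambda>x. c * u x + d * v x) \<in> V"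
    and W: "(\<lambda>_. 0) \<in> W" "\<And>c d u v. u \<in> W \<Longrightarrow> v \<in> W \<Longrightarrow> (\<lambda>x. c * u x + d * v x) \<in> W"
    and L: "\<And>c d u v. u \<in> V \<Longrightarrow> v \<in> V \<Longrightarrow> L (\<lambda>x. c * u x + d * v x) = (\<lambda>y. c * L u y + d * L v y)"
    and ker: "\<And>v. v \<in> V \<Longrightarrow> L v = (\<lambda>_. 0) \<longleftrightarrow> v \<in> W"
    and onto: "L ` V = U"
  shows "quotient_isomorphic V W U"
proof -
  have Wadd: "(\<lambda>x. u x + v x) \<in> W" if "u \<in> W" "v \<in> W" for u v using W(2)[OF that, of 1 1] by simp
  have Wscale: "(\<lambda>x. c * v x) \<in> W" if "v \<in> W" for c v using W(2)[OF that that, of c 0] by simp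
  have eq: "vcoset W u = vcoset W v \<longleftrightarrow> L u = L v" if "u \<in> V" "v \<in> V" for u v
  proof -
    have d: "(\<lambda>x. u x - v x) \<in> V" using V[OF that, of 1 "-1"] by simp
    have "L (\<lambda>x. u x - v x) = (\<lambda>y. L u y - L v y)" using L[OF that, of 1 "-1"] by simp
    then have "L u = L v \<longleftrightarrow> L (\<lambda>x. u x - v x) = (\<lambda>_. 0)" by (auto simp: fun_eq_iff)
    also have "\<dots> \<longleftrightarrow> (\<lambda>x. u x - v x) \<in> W" by (rule ker[OF d])
    also have "\<dots> \<longleftrightarrow> vcoset W u = vcoset W v"
      using vcoset_eqI[OF Wadd Wscale] vcoset_eqD[OF W(1)] by blast
    finally show ?thesis by simp
  qed
  \<comment> \<open>\<open>L\<close> is evaluated at a chosen representative; by \<open>eq\<close>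
    the choice does not matter.\<close>
  define \<Phi> where "\<Phi> C = L (SOME v. v \<in> V \<and> vcoset W v = C)" for C
  have \<Phi>: "\<Phi> (vcoset W v) = L v" if "v \<in> V" for v
  proof -
    have "(SOME u. u \<in> V \<and> vcoset W u = vcoset W v) \<in> V \<and> vcoset W (SOME u. u \<in> V \<and> vcoset W u = vcoset W v) = vcoset W v"
      by (rule someI[of _ v]) (simp add: that)
    then show ?thesis unfolding \<Phi>_def using eq that by blast
  qed
  show ?thesis
    unfolding quotient_isomorphic_def
  proof (intro exI[of _ \<Phi>] conjI ballI allI)
    show "bij_betw \<Phi> (quotient_space V W) U"
      unfolding bij_betw_def
    proof
      show "inj_on \<Phi> (quotient_space V W)"
        unfolding quotient_space_def by (rule inj_onI, elim imageE) (simp add: \<Phi> eq)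
      show "\<Phi> ` quotient_space V W = U"
        unfolding onto[symmetric] quotient_space_def image_image by (rule image_cong) (auto simp: \<Phi>)
    qed
    show "\<Phi> (vcoset W (\<lambda>x. u x + v x)) = (\<lambda>y. \<Phi> (vcoset W u) y + \<Phi> (vcoset W v) y)" if "u \<in> V" "v \<in> V" for u v
    proof -
      have "(\<lambda>x. u x + v x) \<in> V" using V[OF that, of 1 1] by simp
      then show ?thesis using L[OF that, of 1 1] \<Phi> that by simp
    qed
    show "\<Phi> (vcoset W (\<lambda>x. c * v x)) = (\<lambda>y. c * \<Phi> (vcoset W v) y)" if "v \<in> V" for c v
    proof -
      have "(\<lambda>x. c * v x) \<in> V" using V[OF that that, of c 0] by simp
      then show ?thesis using L[OF that that, of c 0] \<Phi> that by simp
    qed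
  qed
qed

lemma coboundary_zero: "coboundary n (\<lambda>_. 0) = (\<lambda>_. 0)"
  using coboundary_lincomb[of n 0 "\<lambda>_. 0" 0 "\<lambda>_. 0"] by simp

lemma bar_map:
  fixes e :: "'s::semigroup_mult \<Rightarrow> 'a::semigroup_mult"
  assumes "\<And>a b. e (a * b) = e a * e b"
  shows "bar f (map e x) = bar (\<lambda>z. f (map e z)) x"
proof (induction "\<lambda>z. f (map e z)" x arbitrary: f rule: bar.induct)
  case (3 a b xs)
  show ?case using 3[of "\<lambda>z. f (e a # z)"] by (simp add: assms)
qed auto

lemma hochschild_map:
  fixes e :: "'s::semigroup_mult \<Rightarrow> 'a::semigroup_mult"
  assumes "\<And>a b. e (a * b) = e a * e b" "x \<noteq> []"
  shows "hochschild f (map e x) = hochschild (\<lambda>z. f (map e z)) x"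
proof -
  have "mult_last (e a) (map e ys) = map e (mult_last a ys)" for a ys
    by (cases ys rule: rev_cases) (auto simp: assms(1))
  moreover obtain a ys where "x = a # ys" using assms(2) by (cases x) auto
  ultimately show ?thesis unfolding hochschild_def bar_map[OF assms(1)] by simp
qed

definition bounded_on :: "nat \<Rightarrow> ('s list \<Rightarrow> complex) \<Rightarrow> bool" where
  "bounded_on N f \<longleftrightarrow> (\<exists>K. \<forall>x. length x = N \<longrightarrow> cmod (f x) \<le> K)"

lemma bounded_onI: "(\<And>x. length x = N \<Longrightarrow> cmod (f x) \<le> K) \<Longrightarrow> bounded_on N f"
  by (auto simp: bounded_on_def)

abbreviation point_r :: "'i cuntz \<Rightarrow> 'i reduced_cuntz" where
  "point_r s \<equiv> abs_reduced_cuntz (point s)"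

lemma abs_reduced_linear:
  "abs_reduced_cuntz (k *\<^sub>C a + b) = k *\<^sub>C abs_reduced_cuntz a + abs_reduced_cuntz b"
  by (simp add: plus_reduced_cuntz.abs_eq scaleC_reduced_cuntz.abs_eq)

lemma reduced_rep_linear: "reduced_rep (k *\<^sub>C a + b) = k *\<^sub>C reduced_rep a + reduced_rep b"
  by (simp add: reduced_rep_add reduced_rep_scaleC)

lemma reduced_rep_point: "reduced_rep (point_r s) = (if s = Zero then 0 else point s)"
  by (rule ell1_eqI) (auto simp: reduced_rep.abs_eq zero_cuntz_def)

lemma point_r_mult: "point_r (s * t) = point_r s * point_r t"
  by (simp add: times_reduced_cuntz.abs_eq point_mult)

lemma point_r_Zero: "point_r Zero = 0"
  by (metis abs_reduced_rep reduced_rep_0 reduced_rep_point)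

lemma point_r_one: "point_r 1 = 1"
  by (simp add: one_reduced_cuntz_def one_ell1_def)

lemma norm_point_r: "norm (point_r s) \<le> 1"
  using norm_abs_reduced_le[of "point s"] by simp

text \<open>Pulled back along the quotient map, the cochain is determined by point masses, and that
  map is onto.\<close>

lemma reduced_determined:
  fixes \<phi> :: "'i reduced_cuntz list \<Rightarrow> complex"
  assumes \<phi>: "\<phi> \<in> cochains n" and pt: "\<And>xs. length xs = n + 1 \<Longrightarrow> \<phi> (map point_r xs) = 0"
  shows "\<phi> = (\<lambda>_. 0)"
proof
  fix as :: "'i reduced_cuntz list"
  have "(\<lambda>as. \<phi> (map abs_reduced_cuntz as)) \<in> cochains n"
    by (rule cochains_comp[OF \<phi> abs_reduced_linear norm_abs_reduced_le])
  then have "(\<lambda>as. \<phi> (map abs_reduced_cuntz as)) = (\<lambda>_. 0)"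
    by (rule cochain_determined_by_points) (use pt in \<open>simp add: o_def\<close>)
  from fun_cong[OF this, of "map reduced_rep as"] show "\<phi> as = 0" by (simp add: o_def)
qed

text \<open>The extension is formed on ell^1 and pulled back along \<open>reduced_rep\<close>. The
  latter sends the class of z_0 to 0, in accordance with \<open>f\<close> being
  \<open>reduced\<close>.\<close>

lemma reduced_extension:
  fixes f :: "'i cuntz list \<Rightarrow> complex"
  assumes f: "reduced f" and bd: "bounded_on (n + 1) f"
  obtains \<phi> where "\<phi> \<in> cochains n" "\<And>xs. length xs = n + 1 \<Longrightarrow> \<phi> (map point_r xs) = f xs"
proof -
  obtain K where K: "\<And>x. length x = n + 1 \<Longrightarrow> cmod (f x) \<le> K" using bd by (auto simp: bounded_on_def)
  define \<psi> where "\<psi> as = (if length as = n + 1 then extend f as else 0)" for as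
  have \<psi>: "\<psi> \<in> cochains n" unfolding \<psi>_def[abs_def] by (rule extend_cochain[OF K])
  show thesis
  proof
    show "(\<lambda>as. \<psi> (map reduced_rep as)) \<in> cochains n"
      by (rule cochains_comp[OF \<psi> reduced_rep_linear]) (simp add: norm_reduced_rep)
    show "\<psi> (map reduced_rep (map point_r xs)) = f xs" if l: "length xs = n + 1" for xs
    proof (cases "Zero \<in> set xs")
      case True
      then obtain us vs where xs: "xs = us @ Zero # vs" by (meson split_list)
      have "\<psi> (map (reduced_rep \<circ> point_r) us @ 0 # map (reduced_rep \<circ> point_r) vs) = 0"
        by (rule mlinear_0[OF cochainsD(2)[OF \<psi>]]) (use l xs in simp)
      then show ?thesis using True by (simp add: xs reduced_rep_point reducedD[OF f])
    next
      case False
      then have m: "map reduced_rep (map point_r xs) = map point xs"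
        by (auto simp: reduced_rep_point)
      show ?thesis unfolding m using l by (simp add: \<psi>_def extend_point)
    qed
  qed
qed

lemma ell1_extension:
  fixes f :: "'s::semigroup_mult list \<Rightarrow> complex"
  assumes bd: "bounded_on (n + 1) f"
  obtains \<phi> where "\<phi> \<in> cochains n" "\<And>xs. length xs = n + 1 \<Longrightarrow> \<phi> (map point xs) = f xs"
proof -
  obtain K where K: "\<And>x. length x = n + 1 \<Longrightarrow> cmod (f x) \<le> K" using bd by (auto simp: bounded_on_def)
  show thesis by (rule that[OF extend_cochain[OF K]]) (auto simp: extend_point)
qed

section \<open>Traces as functions on the semigroup\<close>

definition semigroup_traces :: "('i cuntz \<Rightarrow> complex) set" where
  "semigroup_traces = {t. t Zero = 0 \<and> t 1 = 0 \<and> (\<forall>a b. t (a * b) = t (b * a)) \<and> (\<exists>K. \<forall>s. cmod (t s) \<le> K)}"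

definition trace_of :: "('i cuntz \<Rightarrow> complex) \<Rightarrow> 'i reduced_cuntz \<Rightarrow> complex" where
  "trace_of t a = extend (\<lambda>x. t (hd x)) [reduced_rep a]"

lemma trace_of_lincomb:
  assumes "t \<in> semigroup_traces" "u \<in> semigroup_traces"
  shows "trace_of (\<lambda>s. c * t s + d * u s) = (\<lambda>a. c * trace_of t a + d * trace_of u a)"
proof
  fix a :: "'a reduced_cuntz"
  have sm: "(\<lambda>s. coeff (reduced_rep a) s * t s) summable_on UNIV" if u: "t \<in> semigroup_traces" for t
  proof -
    obtain K where "\<And>s. cmod (t s) \<le> K" using u by (auto simp: semigroup_traces_def)
    then show ?thesis using extend_bound(2)[of "[reduced_rep a]" "\<lambda>x. t (hd x)" K "reduced_rep a" "[]"] by simp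
  qed
  have "trace_of (\<lambda>s. c * t s + d * u s) a
    = (\<Sum>\<^sub>\<infinity>s. c * (coeff (reduced_rep a) s * t s) + d * (coeff (reduced_rep a) s * u s))"
    by (simp add: trace_of_def algebra_simps)
  also have "\<dots> = c * trace_of t a + d * trace_of u a"
    using infsum_add[OF summable_on_cmult_right[OF sm[OF assms(1)], of c] summable_on_cmult_right[OF sm[OF assms(2)], of d]]
    by (simp add: infsum_cmult_right' trace_of_def)
  finally show "trace_of (\<lambda>s. c * t s + d * u s) a = c * trace_of t a + d * trace_of u a" .
qed

text \<open>Functionals are 0-cochains, so the extension and uniqueness results for cochains apply
  to traces.\<close>

lemma dual_space_iff_cochains:
  "\<tau> \<in> dual_space \<longleftrightarrow> (\<lambda>as. if length as = 1 then \<tau> (hd as) else 0) \<in> cochains 0"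
proof
  assume "\<tau> \<in> dual_space"
  then have b: "bounded_linear \<tau>" and c: "\<And>c x. \<tau> (c *\<^sub>C x) = c * \<tau> x" by (auto simp: dual_space_def)
  obtain K where K: "\<And>x. cmod (\<tau> x) \<le> norm x * K" using bounded_linear.bounded[OF b] by auto
  have "cmod (if length as = 1 then \<tau> (hd as) else 0) \<le> K * prod_list (map norm as)" if "length as = 0 + 1" for as
    using that K[of "hd as"] by (cases as) (auto simp: mult.commute)
  moreover have "mlinear (0 + 1) (\<lambda>as. if length as = 1 then \<tau> (hd as) else 0)"
    unfolding mlinear_def using linear_add[OF bounded_linear.linear[OF b]] c by auto
  ultimately show "(\<lambda>as. if length as = 1 then \<tau> (hd as) else 0) \<in> cochains 0"
    unfolding cochains_iff by auto
next
  let ?\<phi> = "\<lambda>as. if length as = 1 then \<tau> (hd as) else 0"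
  assume \<phi>: "?\<phi> \<in> cochains 0"
  have lin: "\<tau> (k *\<^sub>C a + b) = k * \<tau> a + \<tau> b" for k a b
    using mlinearD[OF cochainsD(2)[OF \<phi>], of "[]" "[]" k a b] by simp
  have z: "\<tau> 0 = 0" using lin[of 1 0 0] by simp
  obtain K where K: "\<And>as. length as = 0 + 1 \<Longrightarrow> cmod (?\<phi> as) \<le> K * prod_list (map norm as)"
    using cochainsD(3)[OF \<phi>] by auto
  have "cmod (\<tau> x) \<le> norm x * K" for x using K[of "[x]"] by (simp add: mult.commute)
  moreover have "\<tau> (x + y) = \<tau> x + \<tau> y" for x y using lin[of 1 x y] by simp
  moreover have c: "\<tau> (c *\<^sub>C x) = c * \<tau> x" for c x using lin[of c x 0] z by simp
  moreover have "\<tau> (r *\<^sub>R x) = r *\<^sub>R \<tau> x" for r x using c by (simp add: scaleR_scaleC scaleR_conv_of_real)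
  ultimately have "bounded_linear \<tau>" by (intro bounded_linear_intro)
  then show "\<tau> \<in> dual_space" using c by (simp add: dual_space_def)
qed

lemma trace_of_point: "t \<in> semigroup_traces \<Longrightarrow> trace_of t (point_r s) = t s"
proof (cases "s = Zero")
  case False
  then show ?thesis using extend_point[of "\<lambda>x. t (hd x)" "[s]"] by (simp add: trace_of_def reduced_rep_point)
qed (simp add: trace_of_def reduced_rep_point semigroup_traces_def)

text \<open>The trace property is the vanishing of the coboundary of a 0-cochain, which can be
  checked on point masses.\<close>

lemma trace_of_mem:
  assumes t: "t \<in> semigroup_traces"
  shows "trace_of t \<in> {\<tau> \<in> traces. \<tau> 1 = 0}"
proof -
  obtain K where K: "\<And>s. cmod (t s) \<le> K" using t by (auto simp: semigroup_traces_def)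
  let ?\<psi> = "\<lambda>as. if length as = 1 then trace_of t (hd as) else 0"
  have "(\<lambda>as. if length as = 0 + 1 then extend (\<lambda>x. t (hd x)) as else 0) \<in> cochains 0"
    by (rule extend_cochain[of _ _ K]) (rule K)
  then have "(\<lambda>as. (\<lambda>as. if length as = 0 + 1 then extend (\<lambda>x. t (hd x)) as else 0) (map reduced_rep as)) \<in> cochains 0"
    by (rule cochains_comp[OF _ reduced_rep_linear]) (simp add: norm_reduced_rep)
  also have "(\<lambda>as. (\<lambda>as. if length as = 0 + 1 then extend (\<lambda>x. t (hd x)) as else 0) (map reduced_rep as)) = ?\<psi>"
    by (auto simp: fun_eq_iff trace_of_def length_Suc_conv)
  finally have \<psi>: "?\<psi> \<in> cochains 0" .
  then have d: "trace_of t \<in> dual_space" by (simp add: dual_space_iff_cochains)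
  have "coboundary 0 ?\<psi> = (\<lambda>_. 0)"
  proof (rule reduced_determined[of _ 1])
    show "coboundary 0 ?\<psi> \<in> cochains 1" using coboundary_cochains[OF \<psi>] by simp
    fix xs :: "'a cuntz list" assume "length xs = 1 + 1"
    then obtain a b where xs: "xs = [a, b]" by (cases xs; cases "tl xs") auto
    have "t (b * a) = t (a * b)" using t by (simp add: semigroup_traces_def)
    then show "coboundary 0 ?\<psi> (map point_r xs) = 0"
      using trace_of_point[OF t] by (simp add: xs coboundary_eq hochschild_def flip: point_r_mult)
  qed
  then have "coboundary 0 ?\<psi> [a, b] = 0" for a b by simp
  then have "trace_of t (b * a) = trace_of t (a * b)" for a b by (simp add: coboundary_eq hochschild_def)
  moreover have "trace_of t 1 = 0"
    using trace_of_point[OF t, of 1] t by (simp add: point_r_one semigroup_traces_def)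
  ultimately show ?thesis using d by (simp add: traces_def)
qed

lemma trace_of_onto:
  assumes \<tau>: "\<tau> \<in> traces" "\<tau> 1 = 0"
  obtains t where "t \<in> semigroup_traces" "trace_of t = \<tau>"
proof -
  define t where "t s = \<tau> (point_r s)" for s
  have dual: "\<tau> \<in> dual_space" using \<tau> by (simp add: traces_def)
  then have b: "bounded_linear \<tau>" by (simp add: dual_space_def)
  obtain K where K: "K \<ge> 0" "\<And>x. cmod (\<tau> x) \<le> norm x * K" using bounded_linear.nonneg_bounded[OF b] by auto
  have "cmod (t s) \<le> 1 * K" for s
    unfolding t_def using K(2)[of "point_r s"] mult_right_mono[OF norm_point_r K(1)] by (rule order_trans)
  then have t: "t \<in> semigroup_traces"
    using \<tau> linear_0[OF bounded_linear.linear[OF b]]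
    by (auto simp: semigroup_traces_def t_def point_r_mult point_r_Zero point_r_one traces_def)
  have "trace_of t \<in> dual_space" using trace_of_mem[OF t] by (simp add: traces_def)
  then have "(\<lambda>as. 1 * (if length as = 1 then trace_of t (hd as) else 0) + (- 1) * (if length as = 1 then \<tau> (hd as) else 0)) \<in> cochains 0"
    using dual unfolding dual_space_iff_cochains by (rule cochains_lincomb)
  then have "(\<lambda>as. 1 * (if length as = 1 then trace_of t (hd as) else 0) + (- 1) * (if length as = 1 then \<tau> (hd as) else 0)) = (\<lambda>_. 0)"
  proof (rule reduced_determined)
    fix xs :: "'a cuntz list" assume "length xs = 0 + 1"
    then obtain s where "xs = [s]" by (cases xs) auto
    then show "1 * (if length (map point_r xs) = 1 then trace_of t (hd (map point_r xs)) else 0)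
      + (- 1) * (if length (map point_r xs) = 1 then \<tau> (hd (map point_r xs)) else 0) = 0"
      using trace_of_point[OF t] by (simp add: t_def)
  qed
  from fun_cong[OF this, of "[_]"] have "trace_of t = \<tau>" by (simp add: fun_eq_iff)
  with t show thesis using that by blast
qed

text \<open>The cocycle identity at (a, b, 1) writes \<open>f [a * b, 1]\<close> as
  \<open>f [b, a] + f [a, b]\<close>, which is symmetric in a and b.\<close>

lemma cocycle_list_trace:
  fixes f :: "'i cuntz list \<Rightarrow> complex"
  assumes cocycle: "\<And>z. length z = 3 \<Longrightarrow> hochschild f z = 0" and bd: "bounded_on 2 f"
  shows "(\<lambda>s. f [s, 1]) \<in> semigroup_traces"
proof -
  have c: "f [b, c * a] - f [a * b, c] + f [a, b * c] = 0" for a b c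
    using cocycle[of "[a, b, c]"] by (simp add: hochschild_def algebra_simps)
  have z: "f [Zero, Zero] = 0" using c[of Zero Zero Zero] by simp
  have sym: "f [a * b, 1] = f [b, a] + f [a, b]" for a b using c[of b 1 a] c[of a b 1] by (simp add: algebra_simps)
  then have "f [a * b, 1] = f [b * a, 1]" for a b by (simp add: add.commute)
  moreover have "f [Zero, 1] = 0" using sym[of Zero Zero] z by simp
  moreover have "f [1, 1] = 0" using c[of 1 1 1] by simp
  moreover obtain K where "\<And>x. length x = 2 \<Longrightarrow> cmod (f x) \<le> K" using bd by (auto simp: bounded_on_def)
  then have "cmod (f [s, 1]) \<le> K" for s by simp
  ultimately show ?thesis by (auto simp: semigroup_traces_def)
qed

section \<open>Both algebras as instances of one scheme\<close>

text \<open>\<open>e\<close> embeds the semigroup as a generating set, and \<open>adm\<close>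
  singles out the functions on lists that cochains induce: all functions for ell^1(S_m), the reduced
  ones for the quotient, where \<open>e Zero = 0\<close>. Under \<open>extension\<close> and
  \<open>determined\<close>, cochains correspond to bounded admissible functions.\<close>

locale discretized =
  fixes e :: "'i cuntz \<Rightarrow> 'a::{complex_banach_algebra, real_normed_algebra_1}"
    and adm :: "('i cuntz list \<Rightarrow> complex) \<Rightarrow> bool"
  assumes e_mult: "e (s * t) = e s * e t" and e_one: "e 1 = 1" and norm_e: "norm (e s) \<le> 1"
    and determined: "\<phi> \<in> cochains n \<Longrightarrow> (\<And>xs. length xs = n + 1 \<Longrightarrow> \<phi> (map e xs) = 0) \<Longrightarrow> \<phi> = (\<lambda>_. 0)"
    and extension: "adm f \<Longrightarrow> bounded_on (n + 1) f \<Longrightarrow>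
      \<exists>\<phi>. \<phi> \<in> cochains n \<and> (\<forall>xs. length xs = n + 1 \<longrightarrow> \<phi> (map e xs) = f xs)"
    and restriction: "\<phi> \<in> cochains n \<Longrightarrow> adm (\<lambda>xs. \<phi> (map e xs))"
    and reduced_adm: "reduced f \<Longrightarrow> adm f"
    and exact: "n \<ge> 1 \<Longrightarrow> adm f \<Longrightarrow> bounded_on (n + 1) f \<Longrightarrow> (\<And>z. length z = n + 2 \<Longrightarrow> hochschild f z = 0) \<Longrightarrow>
      (n = 1 \<Longrightarrow> (\<And>s. f [s, 1] = 0)) \<Longrightarrow>
      \<exists>g. adm g \<and> bounded_on n g \<and> (\<forall>x. length x = n + 1 \<longrightarrow> hochschild g x = f x)"
begin

lemma restriction_bounded:
  assumes "\<phi> \<in> cochains n"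
  shows "bounded_on (n + 1) (\<lambda>xs. \<phi> (map e xs))"
proof -
  obtain K where K: "K \<ge> 0" "\<And>as. length as = n + 1 \<Longrightarrow> cmod (\<phi> as) \<le> K * prod_list (map norm as)"
    using cochainsD(3)[OF assms] by auto
  have p: "prod_list (map norm (map e xs)) \<le> 1" for xs
    by (induction xs) (auto intro!: mult_le_one norm_e prod_list_nonneg)
  have "cmod (\<phi> (map e xs)) \<le> K" if "length xs = n + 1" for xs
    using K(2)[of "map e xs"] mult_left_mono[OF p K(1), of xs] that by simp
  then show ?thesis by (rule bounded_onI)
qed

lemma coboundary_map:
  "length xs = n + 2 \<Longrightarrow> coboundary n \<phi> (map e xs) = hochschild (\<lambda>z. \<phi> (map e z)) xs"
  by (subst hochschild_map[OF e_mult, symmetric]) (auto simp: coboundary_eq)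

lemma cocycle_map:
  assumes "\<phi> \<in> cocycles n" "length xs = n + 2"
  shows "hochschild (\<lambda>z. \<phi> (map e z)) xs = 0"
  using assms coboundary_map[OF assms(2), of \<phi>] by (simp add: cocycles_def)

lemma cocycle_is_coboundary:
  assumes \<phi>: "\<phi> \<in> cocycles n" and n: "n \<ge> 1" and one: "n = 1 \<Longrightarrow> (\<And>s. \<phi> [e s, 1] = 0)"
  shows "\<phi> \<in> coboundaries n"
proof -
  have c: "\<phi> \<in> cochains n" using \<phi> by (simp add: cocycles_def)
  obtain g where g: "adm g" "bounded_on n g" "\<And>x. length x = n + 1 \<Longrightarrow> hochschild g x = \<phi> (map e x)"
    using exact[OF n restriction[OF c] restriction_bounded[OF c] cocycle_map[OF \<phi>]] one by (auto simp: e_one)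
  obtain m where m: "n = Suc m" using n by (cases n) auto
  obtain \<psi> where \<psi>: "\<psi> \<in> cochains m" "\<And>xs. length xs = n \<Longrightarrow> \<psi> (map e xs) = g xs"
    using extension[of g m] g m by auto
  have "(\<lambda>z. 1 * \<phi> z + (- 1) * coboundary m \<psi> z) = (\<lambda>_. 0)"
  proof (rule determined[of _ n])
    show "(\<lambda>z. 1 * \<phi> z + (- 1) * coboundary m \<psi> z) \<in> cochains n"
      by (rule cochains_lincomb[OF c]) (use coboundary_cochains[OF \<psi>(1)] m in simp)
    fix xs :: "'i cuntz list" assume l: "length xs = n + 1"
    have "hochschild (\<lambda>z. \<psi> (map e z)) xs = hochschild g xs" by (rule hochschild_cong) (use \<psi>(2) l in auto)
    then show "1 * \<phi> (map e xs) + (- 1) * coboundary m \<psi> (map e xs) = 0"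
      using coboundary_map[of xs m \<psi>] g(3) l m by simp
  qed
  then have "\<phi> = coboundary m \<psi>" by (simp add: fun_eq_iff)
  then show ?thesis using \<psi>(1) m by auto
qed

lemma coboundaries_lincomb:
  assumes "u \<in> (coboundaries n :: ('a list \<Rightarrow> complex) set)" "v \<in> coboundaries n"
  shows "(\<lambda>x. c * u x + d * v x) \<in> coboundaries n"
proof (cases n)
  case (Suc m)
  then obtain u' v' where uv: "u' \<in> cochains m" "v' \<in> cochains m" "u = coboundary m u'" "v = coboundary m v'"
    using assms by auto
  show ?thesis
    unfolding Suc coboundaries.simps
    by (rule image_eqI[OF _ cochains_lincomb[OF uv(1,2)]]) (simp only: coboundary_lincomb uv)
qed (use assms in auto)

lemma coboundaries_zero: "(\<lambda>_. 0) \<in> (coboundaries n :: ('a list \<Rightarrow> complex) set)"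
proof (cases n)
  case (Suc m)
  show ?thesis
    unfolding Suc coboundaries.simps by (rule image_eqI[where x = "\<lambda>_. 0"]) (simp_all add: coboundary_zero cochains_zero)
qed auto

lemma cocycles_lincomb:
  assumes "u \<in> (cocycles n :: ('a list \<Rightarrow> complex) set)" "v \<in> cocycles n"
  shows "(\<lambda>x. c * u x + d * v x) \<in> cocycles n"
  using assms by (auto simp: cocycles_def coboundary_lincomb intro: cochains_lincomb)

lemma HH_vanishes: "n \<ge> 2 \<Longrightarrow> HH_vanishes TYPE('a) n"
proof -
  assume n: "n \<ge> 2"
  let ?W = "coboundaries n :: ('a list \<Rightarrow> complex) set"
  have "vcoset ?W v = vcoset ?W (\<lambda>_. 0)" if "v \<in> cocycles n" for v
  proof (rule vcoset_eqI)
    show "(\<lambda>x. u x + v x) \<in> ?W" if "u \<in> ?W" "v \<in> ?W" for u v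
      using coboundaries_lincomb[OF that, of 1 1] by simp
    show "(\<lambda>x. c * v x) \<in> ?W" if "v \<in> ?W" for c v
      using coboundaries_lincomb[OF that that, of c 0] by simp
    show "(\<lambda>x. v x - 0) \<in> ?W" using cocycle_is_coboundary[OF that] n by simp
  qed
  moreover have "(\<lambda>_. 0) \<in> (cocycles n :: ('a list \<Rightarrow> complex) set)"
    by (simp add: cocycles_def cochains_zero coboundary_zero)
  ultimately show ?thesis unfolding HH_vanishes_def HH_def quotient_space_def by blast
qed

lemma HH_one: "HH_isomorphic TYPE('a) 1 {\<tau> \<in> (traces :: ('i reduced_cuntz \<Rightarrow> complex) set). \<tau> 1 = 0}"
  unfolding HH_isomorphic_def
proof (rule quotient_isomorphicI)
  let ?L = "\<lambda>\<phi> :: 'a list \<Rightarrow> complex. trace_of (\<lambda>s. \<phi> [e s, 1])"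
  have t: "(\<lambda>s. \<phi> [e s, 1]) \<in> semigroup_traces" if "\<phi> \<in> cocycles 1" for \<phi>
  proof -
    have "\<phi> \<in> cochains 1" using that by (simp add: cocycles_def)
    then have "bounded_on 2 (\<lambda>xs. \<phi> (map e xs))" using restriction_bounded[of \<phi> 1] by (simp add: one_add_one[symmetric] del: one_add_one)
    moreover have "hochschild (\<lambda>z. \<phi> (map e z)) z = 0" if "length z = 3" for z
      using cocycle_map[OF \<open>\<phi> \<in> cocycles 1\<close>] that by simp
    ultimately show ?thesis using cocycle_list_trace[of "\<lambda>z. \<phi> (map e z)"] by (simp add: e_one)
  qed
  show "(\<lambda>x. c * u x + d * v x) \<in> cocycles 1" if "u \<in> cocycles 1" "v \<in> cocycles 1" for c d and u v :: "'a list \<Rightarrow> complex"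
    using that by (rule cocycles_lincomb)
  show "(\<lambda>_. 0) \<in> (coboundaries 1 :: ('a list \<Rightarrow> complex) set)" by (rule coboundaries_zero)
  show "(\<lambda>x. c * u x + d * v x) \<in> coboundaries 1" if "u \<in> coboundaries 1" "v \<in> coboundaries 1" for c d and u v :: "'a list \<Rightarrow> complex"
    using that by (rule coboundaries_lincomb)
  show "?L (\<lambda>x. c * u x + d * v x) = (\<lambda>y. c * ?L u y + d * ?L v y)" if "u \<in> cocycles 1" "v \<in> cocycles 1" for c d u v
    by (rule trace_of_lincomb[OF t[OF that(1)] t[OF that(2)]])
  show "?L v = (\<lambda>_. 0) \<longleftrightarrow> v \<in> coboundaries 1" if v: "v \<in> cocycles 1" for v
  proof
    assume "?L v = (\<lambda>_. 0)"
    then have "v [e s, 1] = 0" for s using trace_of_point[OF t[OF v], of s] by simp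
    then show "v \<in> coboundaries 1" using cocycle_is_coboundary[OF v] by simp
  next
    assume "v \<in> coboundaries 1"
    moreover have "(coboundaries 1 :: ('a list \<Rightarrow> complex) set) = coboundary 0 ` cochains 0" by simp
    ultimately obtain \<psi> where "v = coboundary 0 \<psi>" by blast
    \<comment> \<open>The value is \<psi> at \<open>[1 * e s]\<close> minus \<psi> at
      \<open>[e s * 1]\<close>.\<close>
    then have "v [e s, 1] = 0" for s by (simp add: coboundary_eq hochschild_def)
    then show "?L v = (\<lambda>_. 0)" by (simp add: trace_of_def fun_eq_iff)
  qed
  show "?L ` cocycles 1 = {\<tau> \<in> (traces :: ('i reduced_cuntz \<Rightarrow> complex) set). \<tau> 1 = 0}"
  proof (intro equalityI subsetI)
    fix \<tau> assume "\<tau> \<in> ?L ` cocycles 1"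
    then show "\<tau> \<in> {\<tau> \<in> traces. \<tau> 1 = 0}" using trace_of_mem t by blast
  next
    fix \<tau> :: "'i reduced_cuntz \<Rightarrow> complex" assume "\<tau> \<in> {\<tau> \<in> traces. \<tau> 1 = 0}"
    then obtain t where t: "t \<in> semigroup_traces" "trace_of t = \<tau>" using trace_of_onto by blast
    obtain K where "\<And>s. cmod (t s) \<le> K" using t by (auto simp: semigroup_traces_def)
    then obtain f K' where f: "reduced f" "\<And>x. length x = 2 \<Longrightarrow> norm (f x) \<le> K'"
      "\<And>x. length x = 3 \<Longrightarrow> hochschild f x = 0" "\<And>s. f [s, 1] = t s"
      using trace_cocycle[of t K] t(1) by (auto simp: semigroup_traces_def)
    have "bounded_on 2 f" using f(2) by (rule bounded_onI)
    then have "bounded_on (1 + 1) f" by (simp only: one_add_one)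
    then obtain \<phi> where \<phi>: "\<phi> \<in> cochains 1" "\<And>xs. length xs = 1 + 1 \<Longrightarrow> \<phi> (map e xs) = f xs"
      using extension[OF reduced_adm[OF f(1)]] by blast
    have "coboundary 1 \<phi> = (\<lambda>_. 0)"
    proof (rule determined[of _ 2])
      show "coboundary 1 \<phi> \<in> cochains 2" using coboundary_cochains[OF \<phi>(1)] by (simp add: numeral_2_eq_2)
      fix xs :: "'i cuntz list" assume l: "length xs = 2 + 1"
      have "hochschild (\<lambda>z. \<phi> (map e z)) xs = hochschild f xs" by (rule hochschild_cong) (use \<phi>(2) l in auto)
      then show "coboundary 1 \<phi> (map e xs) = 0" using coboundary_map[of xs 1 \<phi>] f(3) l by simp
    qed
    then have "\<phi> \<in> cocycles 1" using \<phi>(1) by (simp add: cocycles_def)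
    moreover have "(\<lambda>s. \<phi> [e s, 1]) = t"
    proof
      fix s show "\<phi> [e s, 1] = t s" using \<phi>(2)[of "[s, 1]"] f(4)[of s] by (simp add: e_one)
    qed
    ultimately show "\<tau> \<in> ?L ` cocycles 1" using t(2) by (metis (no_types, lifting) image_eqI)
  qed
qed

end

interpretation reduced_cuntz: discretized "point_r :: 'i cuntz \<Rightarrow> 'i reduced_cuntz" reduced
proof
  show "\<exists>\<phi>. \<phi> \<in> cochains n \<and> (\<forall>xs. length xs = n + 1 \<longrightarrow> \<phi> (map point_r xs) = f xs)"
    if "reduced f" "bounded_on (n + 1) f" for n and f :: "'i cuntz list \<Rightarrow> complex"
    using reduced_extension[OF that] by metis
  show "reduced (\<lambda>xs. \<phi> (map point_r xs))" if \<phi>: "\<phi> \<in> cochains n" for n and \<phi> :: "'i reduced_cuntz list \<Rightarrow> complex"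
    unfolding reduced_def
  proof (intro allI impI)
    fix xs :: "'i cuntz list" assume "Zero \<in> set xs"
    then obtain us vs where xs: "xs = us @ Zero # vs" by (meson split_list)
    show "\<phi> (map point_r xs) = 0"
    proof (cases "length xs = n + 1")
      case True
      have "\<phi> (map point_r us @ 0 # map point_r vs) = 0"
        by (rule mlinear_0[OF cochainsD(2)[OF \<phi>]]) (use True xs in simp)
      then show ?thesis by (simp add: xs point_r_Zero)
    qed (use cochainsD(1)[OF \<phi>] in simp)
  qed
  show "\<exists>g. reduced g \<and> bounded_on n g \<and> (\<forall>x. length x = n + 1 \<longrightarrow> hochschild g x = f x)"
    if n: "n \<ge> 1" and r: "reduced f" and bd: "bounded_on (n + 1) f"
      and cocycle: "\<And>z. length z = n + 2 \<Longrightarrow> hochschild f z = 0" and one: "n = 1 \<Longrightarrow> (\<And>s. f [s, 1] = 0)" for n and f :: "'i cuntz list \<Rightarrow> complex"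
  proof -
    obtain K where K: "\<And>x. length x = n + 1 \<Longrightarrow> cmod (f x) \<le> K" using bd by (auto simp: bounded_on_def)
    show ?thesis
      using reduced_cocycle_coboundary[OF r cocycle n K one] by (metis bounded_onI)
  qed
qed (auto simp: point_r_mult point_r_one norm_point_r intro: reduced_determined)

interpretation ell1_cuntz: discretized "point :: 'i cuntz \<Rightarrow> 'i cuntz ell1" "\<lambda>_. True"
proof
  show "\<phi> = (\<lambda>_. 0)"
    if "\<phi> \<in> cochains n" "\<And>xs. length xs = n + 1 \<Longrightarrow> \<phi> (map point xs) = 0"
    for n and \<phi> :: "'i cuntz ell1 list \<Rightarrow> complex"
    using that by (rule cochain_determined_by_points)
  show "\<exists>\<phi>. \<phi> \<in> cochains n \<and> (\<forall>xs. length xs = n + 1 \<longrightarrow> \<phi> (map point xs) = f xs)"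
    if "bounded_on (n + 1) f" for n and f :: "'i cuntz list \<Rightarrow> complex"
    using ell1_extension[OF that] by metis
  show "\<exists>g. True \<and> bounded_on n g \<and> (\<forall>x. length x = n + 1 \<longrightarrow> hochschild g x = f x)"
    if n: "n \<ge> 1" and bd: "bounded_on (n + 1) f" and cocycle: "\<And>z. length z = n + 2 \<Longrightarrow> hochschild f z = 0"
      and one: "n = 1 \<Longrightarrow> (\<And>s. f [s, 1] = 0)" for n and f :: "'i cuntz list \<Rightarrow> complex"
  proof -
    obtain K where K: "\<And>x. length x = n + 1 \<Longrightarrow> cmod (f x) \<le> K" using bd by (auto simp: bounded_on_def)
    obtain g L where g: "\<And>x. length x = n \<Longrightarrow> norm (g x) \<le> L"
      "\<And>x. length x = n + 1 \<Longrightarrow> Zero \<in> set x \<Longrightarrow> hochschild g x = f x"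
      by (rule zero_part[OF cocycle n K]) (assumption | rule that)+
    \<comment> \<open>The value 0 on other lengths is chosen because \<open>reduced\<close> concerns
      lists of every length.\<close>
    define f1 where "f1 x = (if length x = n + 1 then f x - hochschild g x else 0)" for x
    have r: "reduced f1" using g(2) by (auto simp: reduced_def f1_def)
    have b1: "cmod (f1 x) \<le> K + real (n + 1) * L" if "length x = n + 1" for x
    proof -
      have "cmod (hochschild g x) \<le> real (length x) * L" by (rule norm_hochschild_le) (use that g(1) in auto)
      with K[OF that] have "cmod (f x - hochschild g x) \<le> K + real (length x) * L"
        by (intro order_trans[OF norm_triangle_ineq4] add_mono)
      then show ?thesis using that by (simp add: f1_def)
    qed
    have c1: "hochschild f1 z = 0" if "length z = n + 2" for z
    proof -
      have "hochschild f1 z = hochschild (\<lambda>x. f x - hochschild g x) z" by (rule hochschild_cong) (use that in \<open>auto simp: f1_def\<close>)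
      then show ?thesis using hochschild_hochschild[of z g] cocycle[OF that] that n by (simp add: hochschild_diff)
    qed
    \<comment> \<open>The coboundary that was subtracted has the value
      \<open>g [1 * s] - g [s * 1] = 0\<close> here.\<close>
    have o1: "f1 [s, 1] = 0" if "n = 1" for s
      using one[OF that] that by (simp add: f1_def hochschild_def)
    obtain h M where h: "\<And>x. length x = n \<Longrightarrow> norm (h x) \<le> M" "\<And>x. length x = n + 1 \<Longrightarrow> hochschild h x = f1 x"
      by (rule reduced_cocycle_coboundary[OF r c1 n b1 o1]) (assumption | rule that)+
    have "bounded_on n (\<lambda>x. g x + h x)"
      by (rule bounded_onI[of _ _ "L + M"], rule norm_triangle_mono) (simp_all add: g(1) h(1))
    moreover have "hochschild (\<lambda>x. g x + h x) x = f x" if "length x = n + 1" for x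
      using h(2)[OF that] that by (simp add: hochschild_add f1_def)
    ultimately show ?thesis by (intro exI[of _ "\<lambda>x. g x + h x"]) blast
  qed
qed (simp_all add: point_mult one_ell1_def)

theorem theorem6p7:
  shows "(\<forall>n\<ge>2. HH_vanishes TYPE('i::countable cuntz ell1) n)
       \<and> HH_isomorphic TYPE('i cuntz ell1) 1 {\<tau> \<in> (traces :: ('i reduced_cuntz \<Rightarrow> complex) set). \<tau> 1 = 0}
       \<and> (\<forall>n\<ge>2. HH_vanishes TYPE('i reduced_cuntz) n)
       \<and> HH_isomorphic TYPE('i reduced_cuntz) 1 {\<tau> \<in> (traces :: ('i reduced_cuntz \<Rightarrow> complex) set). \<tau> 1 = 0}"
  using ell1_cuntz.HH_vanishes ell1_cuntz.HH_one reduced_cuntz.HH_vanishes reduced_cuntz.HH_one by blast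

end
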